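(* Let $b\neq0$, $\lambda_1=0$, $\lambda_2\ge0$, $\lambda_3>0$, $\frac43\le p<4$. Assume that there exists $\omega>0$ such that $\alpha(\omega)\ge S_{b,\omega}(u)$, with $u$ being a ground state of $$-\Delta u+\omega u+b^2(x_1^2+x_2^2)u+\lambda_2(|\cdot|^{-1}\ast|u|^2)u-\lambda_3|u|^pu=0,\qquad x\in\mathbb{R}^3.$$ When $\frac43\le p<2$, assume additionally that $\partial_\lambda^2S_{b,\omega}(u_\lambda)|_{\lambda=1}\le0$, where $u_\lambda(x)=\lambda^{\frac32}u(\lambda x)$ (no additional assumption when $2\le p<4$). Then the set $$\mathcal{K}_\omega:=\{v\in X:\ S_{b,\omega}(v)<S_{b,\omega}(u),\ K_{b,\omega}(v)<0,\ Q_b(v)<0\}$$ is invariant under the flow of $$i\partial_t\psi=-\Delta\psi+b^2(x_1^2+x_2^2)\psi+\lambda_2(|\cdot|^{-1}\ast|\psi|^2)\psi-\lambda_3|\psi|^p\psi,\qquad\psi(0)=\psi_0,$$ and, for $\psi_0\in\mathcal{K}_\omega$, $$Q_b(\psi(t))\le2\big(S_{b,\omega}(\psi_0)-S_{b,\omega}(u)\big)\qquad\text{for any }t\in[0,T^* ).$$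
   Context: $X:=\{u\in H^1(\mathbb{R}^3):\int_{\mathbb{R}^3}(x_1^2+x_2^2)|u|^2dx<\infty\}$ (complex-valued) with norm $\|u\|_X^2:=\|\nabla u\|_{L^2}^2+\|u\|_{L^2}^2+\int_{\mathbb{R}^3}(x_1^2+x_2^2)|u|^2dx$. With $\lambda_1=0$, for $v\in X$, $$S_{b,\omega}(v):=\frac12\|\nabla v\|_{L^2}^2+\frac{\omega}{2}\|v\|_{L^2}^2+\frac{b^2}{2}\int_{\mathbb{R}^3}(x_1^2+x_2^2)|v|^2dx+\frac{\lambda_2}{4}\int_{\mathbb{R}^3}(|x|^{-1}\ast|v|^2)|v|^2dx-\frac{\lambda_3}{p+2}\|v\|_{L^{p+2}}^{p+2},$$ $$K_{b,\omega}(v):=\frac52\|\nabla v\|_{L^2}^2+\frac{3\omega}{2}\|v\|_{L^2}^2+\frac{b^2}{2}\int_{\mathbb{R}^3}(x_1^2+x_2^2)|v|^2dx+\frac{7\lambda_2}{4}\int_{\mathbb{R}^3}(|x|^{-1}\ast|v|^2)|v|^2dx-\frac{\lambda_3(3p+3)}{p+2}\|v\|_{L^{p+2}}^{p+2},$$ $$Q_b(v):=\|\nabla v\|_{L^2}^2-b^2\int_{\mathbb{R}^3}(x_1^2+x_2^2)|v|^2dx+\frac{\lambda_2}{4}\int_{\mathbb{R}^3}(|x|^{-1}\ast|v|^2)|v|^2dx-\frac{3\lambda_3p}{2(p+2)}\|v\|_{L^{p+2}}^{p+2}.$$ Further, $\mathcal{N}:=\{v\in X:K_{b,\omega}(v)<0,\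 Q_b(v)=0\}$ and $\alpha(\omega):=\inf\{S_{b,\omega}(v):v\in\mathcal{N}\}$. A ground state is an element $u$ of $\mathcal{F}_\omega:=\{v\in X\setminus\{0\}:S_{b,\omega}'(v)=0\}$ with $S_{b,\omega}(u)\le S_{b,\omega}(v)$ for all $v\in\mathcal{F}_\omega$. The Cauchy problem is locally well-posed in $X$ with conserved mass and energy; $[0,T^* )$ is the maximal existence interval of $\psi\in C([0,T^* ),X)$. Invariance of $\mathcal{K}_\omega$ means: $\psi_0\in\mathcal{K}_\omega$ implies $\psi(t)\in\mathcal{K}_\omega$ for all $t\in[0,T^* )$. *)

theory Defs
  imports "HOL-Analysis.Analysis"
begin

text \<open>
  Elements of the function spaces are represented by Borel functions on \<open>\<real>\<^sup>3\<close>; every class of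
  Lebesgue measurable functions modulo null sets has such a representative. Equality of
  elements is equality almost everywhere.
\<close>

type_synonym R3 = "real ^ 3"

section \<open>Weak derivatives and the energy space\<close>

definition partial_deriv :: "3 \<Rightarrow> (R3 \<Rightarrow> real) \<Rightarrow> R3 \<Rightarrow> real" where
  "partial_deriv j f = (\<lambda>x. frechet_derivative f (at x) (axis j 1))"

primrec Ck :: "nat \<Rightarrow> (R3 \<Rightarrow> real) \<Rightarrow> bool" where
  "Ck 0 f = continuous_on UNIV f"
| "Ck (Suc k) f = (f differentiable_on UNIV \<and> (\<forall>j. Ck k (partial_deriv j f)))"

definition test_function :: "(R3 \<Rightarrow> real) \<Rightarrow> bool" where
  "test_function \<phi> \<longleftrightarrow> (\<forall>k. Ck k \<phi>) \<and> compact (closure {x. \<phi> x \<noteq> 0})"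

definition square_integrable :: "(R3 \<Rightarrow> 'a::euclidean_space) \<Rightarrow> bool" where
  "square_integrable v \<longleftrightarrow>
     v \<in> borel_measurable lborel \<and> integrable lborel (\<lambda>x. (norm (v x))\<^sup>2)"

definition weak_gradient :: "(R3 \<Rightarrow> complex) \<Rightarrow> (R3 \<Rightarrow> complex ^ 3) \<Rightarrow> bool" where
  "weak_gradient v g \<longleftrightarrow>
     (\<forall>\<phi> j. test_function \<phi> \<longrightarrow>
        (LINT x|lborel. partial_deriv j \<phi> x *\<^sub>R v x) = - (LINT x|lborel. \<phi> x *\<^sub>R (g x $ j)))"

definition H1 :: "(R3 \<Rightarrow> complex) set" where
  "H1 = {v. square_integrable v \<and> (\<exists>g. square_integrable g \<and> weak_gradient v g)}"

text \<open>The weak gradient of an element of \<open>H1\<close>, unique up to a null set.\<close>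

definition grad :: "(R3 \<Rightarrow> complex) \<Rightarrow> R3 \<Rightarrow> complex ^ 3" where
  "grad v = (SOME g. square_integrable g \<and> weak_gradient v g)"

definition X :: "(R3 \<Rightarrow> complex) set" where
  "X = {v \<in> H1. integrable lborel (\<lambda>x. ((x $ 1)\<^sup>2 + (x $ 2)\<^sup>2) * (cmod (v x))\<^sup>2)}"

definition grad_sq :: "(R3 \<Rightarrow> complex) \<Rightarrow> real" where
  "grad_sq v = (LINT x|lborel. (norm (grad v x))\<^sup>2)"

definition mass :: "(R3 \<Rightarrow> complex) \<Rightarrow> real" where
  "mass v = (LINT x|lborel. (cmod (v x))\<^sup>2)"

definition trap :: "(R3 \<Rightarrow> complex) \<Rightarrow> real" where
  "trap v = (LINT x|lborel. ((x $ 1)\<^sup>2 + (x $ 2)\<^sup>2) * (cmod (v x))\<^sup>2)"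

text \<open>The convolution of \<open>1/|x|\<close> with \<open>|v|\<^sup>2\<close>.\<close>

definition coulomb :: "(R3 \<Rightarrow> complex) \<Rightarrow> R3 \<Rightarrow> real" where
  "coulomb v x = (LINT y|lborel. (cmod (v y))\<^sup>2 / norm (x - y))"

definition hartree :: "(R3 \<Rightarrow> complex) \<Rightarrow> real" where
  "hartree v = (LINT x|lborel. coulomb v x * (cmod (v x))\<^sup>2)"

definition Lnorm_pow :: "real \<Rightarrow> (R3 \<Rightarrow> complex) \<Rightarrow> real" where
  "Lnorm_pow q v = (LINT x|lborel. cmod (v x) powr q)"

definition Xnorm :: "(R3 \<Rightarrow> complex) \<Rightarrow> real" where
  "Xnorm v = sqrt (grad_sq v + mass v + trap v)"

definition Xdist :: "(R3 \<Rightarrow> complex) \<Rightarrow> (R3 \<Rightarrow> complex) \<Rightarrow> real" where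
  "Xdist v w = Xnorm (\<lambda>x. v x - w x)"

section \<open>The functionals\<close>

definition S :: "real \<Rightarrow> real \<Rightarrow> real \<Rightarrow> real \<Rightarrow> real \<Rightarrow> (R3 \<Rightarrow> complex) \<Rightarrow> real" where
  "S b \<omega> l2 l3 p v =
     1/2 * grad_sq v + \<omega>/2 * mass v + b\<^sup>2/2 * trap v + l2/4 * hartree v
     - l3 / (p + 2) * Lnorm_pow (p + 2) v"

definition K :: "real \<Rightarrow> real \<Rightarrow> real \<Rightarrow> real \<Rightarrow> real \<Rightarrow> (R3 \<Rightarrow> complex) \<Rightarrow> real" where
  "K b \<omega> l2 l3 p v =
     5/2 * grad_sq v + 3 * \<omega>/2 * mass v + b\<^sup>2/2 * trap v + 7 * l2/4 * hartree v
     - l3 * (3 * p + 3) / (p + 2) * Lnorm_pow (p + 2) v"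

definition Q :: "real \<Rightarrow> real \<Rightarrow> real \<Rightarrow> real \<Rightarrow> (R3 \<Rightarrow> complex) \<Rightarrow> real" where
  "Q b l2 l3 p v =
     grad_sq v - b\<^sup>2 * trap v + l2/4 * hartree v
     - 3 * l3 * p / (2 * (p + 2)) * Lnorm_pow (p + 2) v"

definition energy :: "real \<Rightarrow> real \<Rightarrow> real \<Rightarrow> real \<Rightarrow> (R3 \<Rightarrow> complex) \<Rightarrow> real" where
  "energy b l2 l3 p v =
     1/2 * grad_sq v + b\<^sup>2/2 * trap v + l2/4 * hartree v
     - l3 / (p + 2) * Lnorm_pow (p + 2) v"

definition N :: "real \<Rightarrow> real \<Rightarrow> real \<Rightarrow> real \<Rightarrow> real \<Rightarrow> (R3 \<Rightarrow> complex) set" where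
  "N b \<omega> l2 l3 p = {v \<in> X. K b \<omega> l2 l3 p v < 0 \<and> Q b l2 l3 p v = 0}"

text \<open>Extended real, so that the infimum of the empty set is \<open>\<infinity>\<close>.\<close>

definition alpha :: "real \<Rightarrow> real \<Rightarrow> real \<Rightarrow> real \<Rightarrow> real \<Rightarrow> ereal" where
  "alpha b \<omega> l2 l3 p = (INF v \<in> N b \<omega> l2 l3 p. ereal (S b \<omega> l2 l3 p v))"

section \<open>Ground states\<close>

text \<open>Real Frechet derivative on \<open>X\<close>; \<open>L\<close> is the derivative at \<open>v\<close> as an element of the dual of \<open>X\<close>.\<close>

definition has_X_derivative ::
  "((R3 \<Rightarrow> complex) \<Rightarrow> real) \<Rightarrow> ((R3 \<Rightarrow> complex) \<Rightarrow> real) \<Rightarrow> (R3 \<Rightarrow> complex) \<Rightarrow> bool" where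
  "has_X_derivative F L v \<longleftrightarrow>
     (\<forall>h\<in>X. \<forall>k\<in>X. L (\<lambda>x. h x + k x) = L h + L k) \<and>
     (\<forall>h\<in>X. \<forall>c. L (\<lambda>x. c *\<^sub>R h x) = c * L h) \<and>
     (\<exists>C. \<forall>h\<in>X. \<bar>L h\<bar> \<le> C * Xnorm h) \<and>
     (\<forall>\<epsilon>>0. \<exists>\<delta>>0. \<forall>h\<in>X. Xnorm h < \<delta> \<longrightarrow>
        \<bar>F (\<lambda>x. v x + h x) - F v - L h\<bar> \<le> \<epsilon> * Xnorm h)"

definition critical_points :: "real \<Rightarrow> real \<Rightarrow> real \<Rightarrow> real \<Rightarrow> real \<Rightarrow> (R3 \<Rightarrow> complex) set" where
  "critical_points b \<omega> l2 l3 p =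
     {v \<in> X. \<not> (AE x in lborel. v x = 0) \<and> has_X_derivative (S b \<omega> l2 l3 p) (\<lambda>_. 0) v}"

definition ground_state ::
  "real \<Rightarrow> real \<Rightarrow> real \<Rightarrow> real \<Rightarrow> real \<Rightarrow> (R3 \<Rightarrow> complex) \<Rightarrow> bool" where
  "ground_state b \<omega> l2 l3 p u \<longleftrightarrow>
     u \<in> critical_points b \<omega> l2 l3 p \<and>
     (\<forall>v \<in> critical_points b \<omega> l2 l3 p. S b \<omega> l2 l3 p u \<le> S b \<omega> l2 l3 p v)"

definition dilate :: "real \<Rightarrow> (R3 \<Rightarrow> complex) \<Rightarrow> R3 \<Rightarrow> complex" where
  "dilate s u = (\<lambda>x. (s powr (3/2)) *\<^sub>R u (s *\<^sub>R x))"

section \<open>The Cauchy problem\<close>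

text \<open>
  \<open>nls_form b l2 l3 p v \<phi>\<close> is the duality pairing of
  \<open>-\<Delta>v + b\<^sup>2(x\<^sub>1\<^sup>2 + x\<^sub>2\<^sup>2)v + l2 (1/|x| * |v|\<^sup>2)v - l3 |v|\<^sup>p v\<close> with \<open>\<phi> \<in> X\<close>.
\<close>

definition pairing :: "(R3 \<Rightarrow> complex) \<Rightarrow> (R3 \<Rightarrow> complex) \<Rightarrow> complex" where
  "pairing v \<phi> = (LINT x|lborel. v x * cnj (\<phi> x))"

definition nls_form ::
  "real \<Rightarrow> real \<Rightarrow> real \<Rightarrow> real \<Rightarrow> (R3 \<Rightarrow> complex) \<Rightarrow> (R3 \<Rightarrow> complex) \<Rightarrow> complex" where
  "nls_form b l2 l3 p v \<phi> =
     (LINT x|lborel. (\<Sum>j\<in>UNIV. grad v x $ j * cnj (grad \<phi> x $ j)))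
     + (LINT x|lborel. (b\<^sup>2 * ((x $ 1)\<^sup>2 + (x $ 2)\<^sup>2)) *\<^sub>R (v x * cnj (\<phi> x)))
     + (LINT x|lborel. (l2 * coulomb v x) *\<^sub>R (v x * cnj (\<phi> x)))
     - (LINT x|lborel. (l3 * cmod (v x) powr p) *\<^sub>R (v x * cnj (\<phi> x)))"

definition time_interval :: "ereal \<Rightarrow> real set" where
  "time_interval T = {t. 0 \<le> t \<and> ereal t < T}"

text \<open>
  \<open>\<psi> \<in> C([0,T), X)\<close> satisfies the equation in the dual of \<open>X\<close> at every time. The values of \<open>\<psi>\<close>
  outside \<open>[0,T)\<close> are irrelevant.
\<close>

definition nls_solution ::
  "real \<Rightarrow> real \<Rightarrow> real \<Rightarrow> real \<Rightarrow> (R3 \<Rightarrow> complex) \<Rightarrow> ereal \<Rightarrow> (real \<Rightarrow> R3 \<Rightarrow> complex) \<Rightarrow> bool" where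
  "nls_solution b l2 l3 p \<psi>0 T \<psi> \<longleftrightarrow>
     0 < T \<and>
     (AE x in lborel. \<psi> 0 x = \<psi>0 x) \<and>
     (\<forall>t \<in> time_interval T. \<psi> t \<in> X) \<and>
     (\<forall>t \<in> time_interval T. ((\<lambda>s. Xdist (\<psi> s) (\<psi> t)) \<longlongrightarrow> 0) (at t within time_interval T)) \<and>
     (\<forall>t \<in> time_interval T. \<forall>\<phi>\<in>X. \<exists>D.
        ((\<lambda>s. pairing (\<psi> s) \<phi>) has_vector_derivative D) (at t within time_interval T) \<and>
        \<i> * D = nls_form b l2 l3 p (\<psi> t) \<phi>)"

definition maximal_nls_solution ::
  "real \<Rightarrow> real \<Rightarrow> real \<Rightarrow> real \<Rightarrow> (R3 \<Rightarrow> complex) \<Rightarrow> ereal \<Rightarrow> (real \<Rightarrow> R3 \<Rightarrow> complex) \<Rightarrow> bool" where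
  "maximal_nls_solution b l2 l3 p \<psi>0 T \<psi> \<longleftrightarrow>
     nls_solution b l2 l3 p \<psi>0 T \<psi> \<and>
     \<not> (\<exists>T' \<eta>. T < T' \<and> nls_solution b l2 l3 p \<psi>0 T' \<eta> \<and>
          (\<forall>t \<in> time_interval T. AE x in lborel. \<eta> t x = \<psi> t x))"

text \<open>Existence, uniqueness and continuous dependence on the initial datum.\<close>

definition locally_well_posed :: "real \<Rightarrow> real \<Rightarrow> real \<Rightarrow> real \<Rightarrow> bool" where
  "locally_well_posed b l2 l3 p \<longleftrightarrow>
     (\<forall>\<psi>0\<in>X. \<exists>T \<psi>. nls_solution b l2 l3 p \<psi>0 T \<psi>) \<and>
     (\<forall>\<psi>0\<in>X. \<forall>T \<psi> \<eta>. nls_solution b l2 l3 p \<psi>0 T \<psi> \<and> nls_solution b l2 l3 p \<psi>0 T \<eta> \<longrightarrow>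
        (\<forall>t \<in> time_interval T. AE x in lborel. \<psi> t x = \<eta> t x)) \<and>
     (\<forall>\<psi>0\<in>X. \<forall>T \<psi>. nls_solution b l2 l3 p \<psi>0 T \<psi> \<longrightarrow>
        (\<forall>T'>0. ereal T' < T \<longrightarrow> (\<forall>\<epsilon>>0. \<exists>\<delta>>0. \<forall>\<eta>0\<in>X. Xdist \<eta>0 \<psi>0 < \<delta> \<longrightarrow>
          (\<exists>\<eta>. nls_solution b l2 l3 p \<eta>0 (ereal T') \<eta> \<and>
               (\<forall>t \<in> time_interval (ereal T'). Xdist (\<eta> t) (\<psi> t) < \<epsilon>)))))"

definition conserves_mass_and_energy :: "real \<Rightarrow> real \<Rightarrow> real \<Rightarrow> real \<Rightarrow> bool" where
  "conserves_mass_and_energy b l2 l3 p \<longleftrightarrow>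
     (\<forall>\<psi>0\<in>X. \<forall>T \<psi>. nls_solution b l2 l3 p \<psi>0 T \<psi> \<longrightarrow>
        (\<forall>t \<in> time_interval T. mass (\<psi> t) = mass \<psi>0 \<and>
           energy b l2 l3 p (\<psi> t) = energy b l2 l3 p \<psi>0))"

definition invariant_under_flow ::
  "real \<Rightarrow> real \<Rightarrow> real \<Rightarrow> real \<Rightarrow> (R3 \<Rightarrow> complex) set \<Rightarrow> bool" where
  "invariant_under_flow b l2 l3 p A \<longleftrightarrow>
     (\<forall>\<psi>0\<in>A. \<forall>T \<psi>. maximal_nls_solution b l2 l3 p \<psi>0 T \<psi> \<longrightarrow>
        (\<forall>t \<in> time_interval T. \<psi> t \<in> A))"

definition K_set ::
  "real \<Rightarrow> real \<Rightarrow> real \<Rightarrow> real \<Rightarrow> real \<Rightarrow> (R3 \<Rightarrow> complex) \<Rightarrow> (R3 \<Rightarrow> complex) set" where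
  "K_set b \<omega> l2 l3 p u =
     {v \<in> X. S b \<omega> l2 l3 p v < S b \<omega> l2 l3 p u \<and> K b \<omega> l2 l3 p v < 0 \<and> Q b l2 l3 p v < 0}"

end

theory Submission
  imports Defs
begin

text \<open>
  The mass-preserving dilation and the scaling \<open>\<lambda>\<^sup>3 v(\<lambda>x)\<close> span a two-parameter family
  \<open>w = k v(cx)\<close> on which \<open>S\<close> is an explicit combination of exponentials with \<open>\<partial>\<^sub>y S = K\<close> and
  \<open>\<partial>\<^sub>z S = (K - Q)/3\<close>. If \<open>K(v) = 0\<close> and \<open>S(v) < \<alpha>\<close>, then \<open>Q \<le> 0\<close> at every point of the curve \<open>K = 0\<close>
  with \<open>S < \<alpha>\<close>, so \<open>S\<close> could only decrease along that curve as \<open>z\<close> decreases, whereas it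
  tends to infinity. Hence \<open>K(v) = 0\<close> forces \<open>S(v) \<ge> \<alpha> \<ge> S(u)\<close>, and neither \<open>K\<close> nor \<open>Q\<close> can vanish along a
  trajectory that starts in the set with \<open>S < S(u)\<close>, \<open>K < 0\<close>, \<open>Q < 0\<close>. The bound on \<open>Q\<close> comes from
  decreasing the amplitude until \<open>K\<close> or \<open>Q\<close> vanishes.

  Continuity in time needs only the inequality
  \<open>2 \<integral> |v|\<^sup>2/|x - y| \<le> 3\<eta> \<parallel>v\<parallel>\<^sup>2 + \<parallel>\<nabla>v\<parallel>\<^sup>2/\<eta>\<close>, which controls the Hartree term: conservation of energy then
  makes the \<open>L\<^bsup>p+2\<^esup>\<close> term continuous.
\<close>

section \<open>Test functions\<close>

text \<open>The obstacle: \<open>alpha\<close> is an infimum over \<open>N\<close>, where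
  \<open>K < 0\<close> is strict, so it says nothing directly about points with
  \<open>K = 0\<close>, through which a trajectory might leave. From such a point, raising y makes
  \<open>K\<close> negative and lowers \<open>S\<close>, and one unit higher \<open>Q\<close> is
  negative. Were \<open>Q\<close> positive at the start, it would vanish in between, at a point of
  \<open>N\<close> where \<open>S\<close> is still below the infimum; this gives the sign of
  \<open>Q\<close> on the curve. The growth of \<open>S\<close> at the far end comes from gradient
  against nonlinearity: \<open>K <= 0\<close> forces y to be at least about -p z / (2(3p-2)) as z
  tends to minus infinity, and then the gradient exponent z + 5y grows like -z (4-p) / (2(3p-2)).
  This is where p < 4 enters. The bound p >= 4/3 says that the y-exponent 3p+3 of the nonlinear term
  is at least 7, that of the Hartree term, so the only negative term of \<open>K\<close> outgrows
  all others. The quotient (K - Q)/3 is an amplitude derivative: \<open>Q\<close> is the derivative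
  of \<open>S\<close> along t^(3/2) v(tx), and t^3 v(tx) differs from it by the factor t^(3/2),
  whereas z enters the amplitude as exp (z/2).\<close>

lemma has_derivative_partial_deriv:
  "(f has_derivative D) (at x) \<Longrightarrow> partial_deriv j f x = D (axis j 1)"
  by (simp add: partial_deriv_def frechet_derivative_at[symmetric])

lemma differentiable_imp_has_frechet:
  "f differentiable_on UNIV \<Longrightarrow> (f has_derivative frechet_derivative f (at x)) (at x)"
  by (simp add: differentiable_on_def frechet_derivative_works)

lemma Ck_Suc_D: "Ck (Suc k) f \<Longrightarrow> Ck k f"
  by (induction k arbitrary: f) (auto simp: differentiable_imp_continuous_on)

lemma Ck_const: "Ck k (\<lambda>x. c)"
proof (induction k arbitrary: c)
  case (Suc k)
  have "partial_deriv j (\<lambda>x. c) = (\<lambda>x. 0)" for j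
    using has_derivative_partial_deriv[OF has_derivative_const] by auto
  then show ?case using Suc by (simp add: differentiable_on_def)
qed simp

lemma partial_deriv_add:
  assumes "f differentiable_on UNIV" "g differentiable_on UNIV"
  shows "partial_deriv j (\<lambda>x. f x + g x) = (\<lambda>x. partial_deriv j f x + partial_deriv j g x)"
  using has_derivative_partial_deriv[OF has_derivative_add[OF assms[THEN differentiable_imp_has_frechet]]]
  by (auto simp: partial_deriv_def)

lemma partial_deriv_mult:
  assumes "f differentiable_on UNIV" "g differentiable_on UNIV"
  shows "partial_deriv j (\<lambda>x. f x * g x) = (\<lambda>x. f x * partial_deriv j g x + partial_deriv j f x * g x)"
  using has_derivative_partial_deriv[OF has_derivative_mult[OF assms[THEN differentiable_imp_has_frechet]]]
  by (auto simp: partial_deriv_def)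

lemma Ck_add: "Ck k f \<Longrightarrow> Ck k g \<Longrightarrow> Ck k (\<lambda>x. f x + g x)"
  by (induction k arbitrary: f g)
     (auto simp: partial_deriv_add continuous_on_add differentiable_on_add)

lemma Ck_mult: "Ck k f \<Longrightarrow> Ck k g \<Longrightarrow> Ck k (\<lambda>x. f x * g x)"
proof (induction k arbitrary: f g)
  case (Suc k)
  \<comment> \<open>The product rule leaves one factor undifferentiated, so both are also needed one
    order lower.\<close>
  then have "Ck k f" "Ck k g" by (blast dest: Ck_Suc_D)+
  with Suc show ?case by (auto simp: partial_deriv_mult intro!: Ck_add differentiable_on_mult)
qed (auto intro: continuous_on_mult)

lemma Ck_power: "Ck k f \<Longrightarrow> Ck k (\<lambda>x. f x ^ n)"
  by (induction n) (simp_all add: Ck_const Ck_mult)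

lemma Ck_prod: "(\<And>i. i \<in> I \<Longrightarrow> Ck k (f i)) \<Longrightarrow> Ck k (\<lambda>x. \<Prod>i\<in>I. f i x)"
  by (induction I rule: infinite_finite_induct) (simp_all add: Ck_const Ck_mult)

lemma partial_deriv_affine:
  assumes "f differentiable_on UNIV"
  shows "partial_deriv j (\<lambda>x. f (c *\<^sub>R x + a)) = (\<lambda>x. c * partial_deriv j f (c *\<^sub>R x + a))"
proof
  fix x
  have "((\<lambda>x. c *\<^sub>R x + a) has_derivative (\<lambda>h. c *\<^sub>R h)) (at x)"
    by (auto intro!: derivative_eq_intros)
  from has_derivative_compose[OF this differentiable_imp_has_frechet[OF assms]]
  have "partial_deriv j (\<lambda>x. f (c *\<^sub>R x + a)) x
      = frechet_derivative f (at (c *\<^sub>R x + a)) (c *\<^sub>R axis j 1)"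
    by (rule has_derivative_partial_deriv)
  also have "\<dots> = c * partial_deriv j f (c *\<^sub>R x + a)"
    using linear_scale[OF has_derivative_linear[OF differentiable_imp_has_frechet[OF assms]]]
    by (simp add: partial_deriv_def)
  finally show "partial_deriv j (\<lambda>x. f (c *\<^sub>R x + a)) x = c * partial_deriv j f (c *\<^sub>R x + a)" .
qed

lemma differentiable_on_affine:
  fixes f :: "R3 \<Rightarrow> real"
  assumes "f differentiable_on UNIV" shows "(\<lambda>x. f (c *\<^sub>R x + a)) differentiable_on UNIV"
proof -
  have "((\<lambda>x. c *\<^sub>R x + a) has_derivative (\<lambda>h. c *\<^sub>R h)) (at x)" for x :: R3
    by (auto intro!: derivative_eq_intros)
  from has_derivative_compose[OF this differentiable_imp_has_frechet[OF assms]]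
  show ?thesis unfolding differentiable_on_def differentiable_def by auto
qed

lemma Ck_affine: "Ck k f \<Longrightarrow> Ck k (\<lambda>x. f (c *\<^sub>R x + a))"
proof (induction k arbitrary: f)
  case 0
  then have "continuous_on UNIV f" by simp
  then show ?case
    by (auto intro!: continuous_on_compose2[of UNIV f _ "\<lambda>x. c *\<^sub>R x + a"] continuous_intros)
next
  case (Suc k)
  then show ?case
    by (auto simp: partial_deriv_affine differentiable_on_affine intro!: Ck_mult Ck_const)
qed

section \<open>A smooth function vanishing on the negative half-line\<close>

definition flat :: "nat \<Rightarrow> real \<Rightarrow> real" where
  "flat n t = (if t > 0 then exp (- inverse t) * inverse t ^ n else 0)"

lemma flat_pos_iff: "flat n t > 0 \<longleftrightarrow> t > 0" and flat_nonneg: "flat n t \<ge> 0"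
  by (auto simp: flat_def)

lemma flat_0_le_1: "flat 0 t \<le> 1" by (auto simp: flat_def)

lemma flat_tendsto_0: "((\<lambda>t. exp (- inverse t) * inverse t ^ n) \<longlongrightarrow> 0) (at_right (0::real))"
proof -
  have "((\<lambda>x::real. x ^ n / exp x) \<longlongrightarrow> 0) at_top" by (rule tendsto_power_div_exp_0)
  then have "((\<lambda>t::real. inverse t ^ n / exp (inverse t)) \<longlongrightarrow> 0) (at_right 0)"
    by (rule filterlim_compose) (rule filterlim_inverse_at_top_right)
  then show ?thesis by (simp add: exp_minus divide_inverse mult.commute)
qed

text \<open>The powers of \<open>inverse t\<close> are carried along because the family is then
  closed under differentiation, so smoothness of every order follows by one induction. At 0 the
  derivative vanishes because exp (-1/t) beats every power.\<close>

lemma has_derivative_flat: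
  "(flat n has_real_derivative (flat (n + 2) t - n * flat (n + 1) t)) (at t)"
proof -
  consider "t > 0" | "t < 0" | "t = 0" by linarith
  then show ?thesis
  proof cases
    case 1
    \<comment> \<open>For n = 0 the exponent \<open>n - 1\<close> is truncated, but the factor
      \<open>n\<close> is then zero.\<close>
    have pow: "real n * inverse t ^ (n - 1) * (inverse t * inverse t) = n * inverse t ^ (n + 1)"
      by (cases n) simp_all
    have "((\<lambda>t. exp (- inverse t) * inverse t ^ n) has_real_derivative
        (exp (- inverse t) * (inverse t * inverse t) * inverse t ^ n
         - exp (- inverse t) * (real n * inverse t ^ (n - 1) * (inverse t * inverse t)))) (at t)"
      using 1 by (auto intro!: derivative_eq_intros)
    also have "exp (- inverse t) * (inverse t * inverse t) * inverse t ^ n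
         - exp (- inverse t) * (real n * inverse t ^ (n - 1) * (inverse t * inverse t))
        = flat (n + 2) t - n * flat (n + 1) t"
      unfolding pow using 1 by (simp add: flat_def)
    finally have "((\<lambda>t. exp (- inverse t) * inverse t ^ n) has_real_derivative
        (flat (n + 2) t - n * flat (n + 1) t)) (at t)" .
    moreover have "eventually (\<lambda>t. exp (- inverse t) * inverse t ^ n = flat n t) (nhds t)"
      using eventually_nhds_in_open[of "{0<..}" t] 1 by (auto elim!: eventually_mono simp: flat_def)
    ultimately show ?thesis by (subst (asm) DERIV_cong_ev) auto
  next
    case 2
    have "eventually (\<lambda>t. 0 = flat n t) (nhds t)"
      using eventually_nhds_in_open[of "{..<0}" t] 2 by (auto elim!: eventually_mono simp: flat_def)
    moreover have "((\<lambda>t. 0) has_real_derivative 0) (at t)" by simp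
    ultimately show ?thesis using 2 by (subst (asm) DERIV_cong_ev) (auto simp: flat_def)
  next
    case 3
    have "((\<lambda>h. flat n h / h) \<longlongrightarrow> 0) (at 0)"
    proof (rule filterlim_split_at)
      show "((\<lambda>h. flat n h / h) \<longlongrightarrow> 0) (at_left 0)"
        by (rule tendsto_eventually) (auto simp: eventually_at_filter flat_def)
      \<comment> \<open>Dividing by \<open>h\<close> only raises the power of
        \<open>inverse h\<close> by one.\<close>
      show "((\<lambda>h. flat n h / h) \<longlongrightarrow> 0) (at_right 0)"
        by (rule Lim_transform_eventually[OF flat_tendsto_0[of "Suc n"]])
           (auto simp: eventually_at_filter flat_def divide_inverse)
    qed
    then show ?thesis using 3 by (simp add: DERIV_def flat_def)
  qed
qed

text \<open>The coefficient \<open>r\<close> will be 1 or -1, one for each of the two faces of a box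
  in direction \<open>i\<close>. The index \<open>n\<close> varies in the induction because
  differentiation leads to n+1 and n+2.\<close>

lemma Ck_flat: "Ck k (\<lambda>x. flat n (r * x $ i + d))"
proof (induction k arbitrary: n)
  case 0
  have "continuous_on UNIV (flat n)"
    using has_derivative_flat by (meson DERIV_isCont continuous_at_imp_continuous_on)
  then show ?case
    by (auto intro!: continuous_on_compose2[of UNIV "flat n" _ "\<lambda>x. r * x $ i + d"] continuous_intros)
next
  case (Suc k)
  have D: "((\<lambda>x. flat n (r * x $ i + d)) has_derivative
     (\<lambda>h. (r * h $ i) * (flat (n + 2) (r * x $ i + d) - n * flat (n + 1) (r * x $ i + d)))) (at x)" for x :: R3
  proof -
    have "((\<lambda>x. r * x $ i + d) has_derivative (\<lambda>h. r * h $ i)) (at x)"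
      by (auto intro!: derivative_eq_intros bounded_linear.has_derivative[OF bounded_linear_vec_nth])
    from has_derivative_compose[OF this has_derivative_flat[THEN has_field_derivative_imp_has_derivative]]
    show ?thesis by (simp add: mult.commute)
  qed
  have "partial_deriv j (\<lambda>x. flat n (r * x $ i + d)) = (\<lambda>x. (r * axis j 1 $ i) *
      (flat (n + 2) (r * x $ i + d) + (- n) * flat (n + 1) (r * x $ i + d)))" for j
    using has_derivative_partial_deriv[OF D] by (intro ext) simp
  moreover have "(\<lambda>x. flat n (r * x $ i + d)) differentiable_on UNIV"
    using D unfolding differentiable_on_def differentiable_def by blast
  moreover have "Ck k (\<lambda>x. (r * axis j 1 $ i) *
      (flat (n + 2) (r * x $ i + d) + (- n) * flat (n + 1) (r * x $ i + d)))" for j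
    by (intro Ck_mult Ck_add Ck_const Suc.IH)
  ultimately show ?case by (simp only: Ck.simps) blast
qed

section \<open>Support and closure properties of test functions\<close>

lemma test_functionI:
  assumes "\<And>k. Ck k \<phi>" "\<And>x. \<phi> x \<noteq> 0 \<Longrightarrow> norm x \<le> R"
  shows "test_function \<phi>"
proof -
  have "bounded {x. \<phi> x \<noteq> 0}" using assms(2) by (auto simp: bounded_iff)
  then show ?thesis using assms(1) by (simp add: test_function_def compact_closure)
qed

lemma test_function_support:
  assumes "test_function \<phi>"
  obtains R where "R > 0" "\<And>x. norm x > R \<Longrightarrow> \<phi> x = 0"
proof -
  have "bounded {x. \<phi> x \<noteq> 0}" using assms by (simp add: test_function_def compact_closure)
  then obtain R where "R > 0" "\<And>x. \<phi> x \<noteq> 0 \<Longrightarrow> norm x \<le> R" by (auto simp: bounded_pos)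
  then show ?thesis using that by (meson not_le)
qed

lemma test_function_Ck: "test_function \<phi> \<Longrightarrow> Ck k \<phi>" by (simp add: test_function_def)

lemma test_function_differentiable: "test_function \<phi> \<Longrightarrow> \<phi> differentiable_on UNIV"
  using test_function_Ck[of \<phi> 1] by simp

lemma test_function_continuous: "test_function \<phi> \<Longrightarrow> continuous_on UNIV \<phi>"
  using test_function_Ck[of \<phi> 0] by simp

lemma test_function_add:
  assumes "test_function \<phi>" "test_function \<psi>" shows "test_function (\<lambda>x. \<phi> x + \<psi> x)"
proof -
  obtain R1 where R1: "\<And>x. norm x > R1 \<Longrightarrow> \<phi> x = 0" using assms(1) test_function_support by blast
  obtain R2 where R2: "\<And>x. norm x > R2 \<Longrightarrow> \<psi> x = 0" using assms(2) test_function_support by blast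
  have "norm x \<le> max R1 R2" if "\<phi> x + \<psi> x \<noteq> 0" for x
    using R1[of x] R2[of x] that by (cases "norm x > R1"; cases "norm x > R2") (simp_all add: not_less)
  then show ?thesis
    using assms by (intro test_functionI[where R="max R1 R2"]) (simp_all add: Ck_add test_function_Ck)
qed

lemma test_function_mult:
  assumes "test_function \<phi>" "\<And>k. Ck k \<psi>" shows "test_function (\<lambda>x. \<phi> x * \<psi> x)"
proof -
  obtain R1 where R1: "\<And>x. norm x > R1 \<Longrightarrow> \<phi> x = 0" using assms(1) test_function_support by blast
  have "norm x \<le> R1" if "\<phi> x * \<psi> x \<noteq> 0" for x
    using R1[of x] that by (cases "norm x > R1") (simp_all add: not_less)
  then show ?thesis
    using assms by (intro test_functionI[where R=R1]) (simp_all add: Ck_mult test_function_Ck)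
qed

lemma test_function_cmult: "test_function \<phi> \<Longrightarrow> test_function (\<lambda>x. c * \<phi> x)"
  using test_function_mult[of \<phi> "\<lambda>x. c"] by (simp add: Ck_const mult.commute)

lemma test_function_affine:
  assumes "test_function \<phi>" "c \<noteq> 0" shows "test_function (\<lambda>x. \<phi> (c *\<^sub>R x + a))"
proof -
  obtain R where R: "\<And>x. norm x > R \<Longrightarrow> \<phi> x = 0" using assms(1) test_function_support by blast
  have "norm x \<le> (R + norm a) / \<bar>c\<bar>" if "\<phi> (c *\<^sub>R x + a) \<noteq> 0" for x
  proof -
    have "norm (c *\<^sub>R x) \<le> norm (c *\<^sub>R x + a) + norm a" by (metis add_diff_cancel_right' norm_triangle_ineq4)
    also have "norm (c *\<^sub>R x + a) \<le> R" using R[of "c *\<^sub>R x + a"] that by (meson not_le)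
    finally show ?thesis using assms(2) by (simp add: field_simps)
  qed
  then show ?thesis
    using assms
    by (intro test_functionI[where R="(R + norm a) / \<bar>c\<bar>"]) (simp_all add: Ck_affine test_function_Ck)
qed

lemma test_function_partial_deriv:
  assumes "test_function \<phi>" shows "test_function (partial_deriv j \<phi>)"
proof -
  obtain R where R: "\<And>x. norm x > R \<Longrightarrow> \<phi> x = 0" using assms test_function_support by blast
  show ?thesis
  proof (rule test_functionI)
    show "Ck k (partial_deriv j \<phi>)" for k using test_function_Ck[OF assms, of "Suc k"] by simp
    fix x assume *: "partial_deriv j \<phi> x \<noteq> 0"
    show "norm x \<le> R"
    proof (rule ccontr)
      assume "\<not> norm x \<le> R"
      then have x: "x \<in> {x. norm x > R}" by simp
      have "open {x::R3. norm x > R}" by (intro open_Collect_less continuous_intros)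
      then have "(\<phi> has_derivative (\<lambda>h. 0)) (at x)"
        by (rule has_derivative_transform_within_open[OF has_derivative_const[of 0] _ x]) (simp add: R)
      then show False using * by (simp add: has_derivative_partial_deriv)
    qed
  qed
qed

lemma test_function_bounded:
  assumes "test_function \<phi>" obtains B where "B > 0" "\<And>x. \<bar>\<phi> x\<bar> \<le> B"
proof -
  obtain R where R: "\<And>x. norm x > R \<Longrightarrow> \<phi> x = 0" using assms test_function_support by blast
  have "compact (\<phi> ` cball 0 R)"
    using test_function_continuous[OF assms] by (intro compact_continuous_image) (auto intro: continuous_on_subset)
  then obtain B where "B > 0" "\<And>x. x \<in> cball 0 R \<Longrightarrow> norm (\<phi> x) \<le> B"
    by (auto simp: bounded_pos dest!: compact_imp_bounded)
  then have "\<bar>\<phi> x\<bar> \<le> B" for x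
    by (cases "norm x \<le> R") (use R[of x] \<open>B > 0\<close> in auto)
  then show ?thesis using \<open>B > 0\<close> that by blast
qed

lemma test_function_measurable: "test_function \<phi> \<Longrightarrow> \<phi> \<in> borel_measurable borel"
  by (intro borel_measurable_continuous_onI test_function_continuous)

lemma integrable_cball_indicator: "integrable lborel (indicator (cball (0::R3) R) :: R3 \<Rightarrow> real)"
  using emeasure_lborel_cball_finite[of "0::R3" R] by (auto simp: integrable_indicator_iff)

text \<open>One factor of \<open>flat 0\<close> per face makes the product positive exactly on the
  open box. This exactness is what the density proof uses: powers of 1 - \<phi> then tend to 0
  inside the box and remain 1 outside.\<close>

lemma box_test_function:
  fixes a b :: R3
  shows "\<exists>\<phi>. test_function \<phi> \<and> (\<forall>x. 0 \<le> \<phi> x \<and> \<phi> x \<le> 1 \<and> (\<phi> x > 0 \<longleftrightarrow> x \<in> box a b))"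
proof -
  define \<phi> where "\<phi> x = (\<Prod>i\<in>UNIV. flat 0 (1 * x $ i + - a $ i) * flat 0 ((-1) * x $ i + b $ i))" for x :: R3
  have "Ck k \<phi>" for k unfolding \<phi>_def by (intro Ck_prod Ck_mult Ck_flat)
  have nn: "0 \<le> \<phi> x" for x unfolding \<phi>_def by (intro prod_nonneg) (simp add: flat_nonneg)
  have le: "\<phi> x \<le> 1" for x unfolding \<phi>_def
    by (intro prod_le_1) (auto simp: flat_nonneg flat_0_le_1 intro!: mult_le_one)
  have pos: "\<phi> x > 0 \<longleftrightarrow> x \<in> box a b" for x
  proof -
    have "\<phi> x > 0 \<longleftrightarrow> \<phi> x \<noteq> 0" using nn[of x] by linarith
    also have "\<dots> \<longleftrightarrow> (\<forall>i. flat 0 (x $ i - a $ i) * flat 0 (b $ i - x $ i) \<noteq> 0)" by (simp add: \<phi>_def)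
    also have "\<dots> \<longleftrightarrow> (\<forall>i. flat 0 (x $ i - a $ i) > 0 \<and> flat 0 (b $ i - x $ i) > 0)"
      using flat_nonneg by (simp add: less_le)
    also have "\<dots> \<longleftrightarrow> x \<in> box a b" by (auto simp: flat_pos_iff mem_box_cart)
    finally show ?thesis .
  qed
  obtain R where "\<And>x. x \<in> box a b \<Longrightarrow> norm x \<le> R" using bounded_box[of a b] by (auto simp: bounded_iff)
  then have "norm x \<le> R" if "\<phi> x \<noteq> 0" for x using that pos[of x] nn[of x] by simp
  then have "test_function \<phi>" using \<open>\<And>k. Ck k \<phi>\<close> by (rule test_functionI[rotated])
  then show ?thesis using nn le pos by blast
qed

section \<open>Square integrable functions\<close>

lemma lborel_affine_vec: "c \<noteq> 0 \<Longrightarrow>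
  (lborel :: R3 measure) = density (distr lborel borel (\<lambda>x. c *\<^sub>R x + a)) (\<lambda>_. \<bar>c\<bar> ^ 3)"
proof -
  assume c: "c \<noteq> 0"
  have "DIM(R3) = 3" by simp
  from lborel_affine[OF c, of a, unfolded this] show ?thesis by (simp only: add.commute[of a])
qed

lemma integral_affine_vec:
  fixes f :: "R3 \<Rightarrow> 'a::{banach, second_countable_topology}"
  assumes [measurable]: "f \<in> borel_measurable borel" and c: "c \<noteq> 0"
  shows "integral\<^sup>L lborel f = (\<bar>c\<bar> ^ 3) *\<^sub>R (LINT x|lborel. f (c *\<^sub>R x + a))"
  by (subst lborel_affine_vec[OF c, of a])
     (simp add: integral_density integral_distr)

lemma integrable_scaleR_right_eq:
  fixes f :: "'a \<Rightarrow> 'b::{banach, second_countable_topology}"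
  assumes "c \<noteq> 0" shows "integrable M (\<lambda>x. c *\<^sub>R f x) \<longleftrightarrow> integrable M f"
  using integrable_scaleR_right[of c M f] integrable_scaleR_right[of "inverse c" M "\<lambda>x. c *\<^sub>R f x"] assms
  by auto

lemma integrable_affine_vec:
  fixes f :: "R3 \<Rightarrow> 'a::{banach, second_countable_topology}"
  assumes [measurable]: "f \<in> borel_measurable borel" and c: "c \<noteq> 0"
  shows "integrable lborel (\<lambda>x. f (c *\<^sub>R x + a)) \<longleftrightarrow> integrable lborel f"
proof -
  have "integrable lborel f \<longleftrightarrow> integrable lborel (\<lambda>x. (\<bar>c\<bar> ^ 3) *\<^sub>R f (c *\<^sub>R x + a))"
    by (subst lborel_affine_vec[OF c, of a]) (simp add: integrable_density integrable_distr_eq)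
  moreover have "\<bar>c\<bar> ^ 3 \<noteq> 0" using c by simp
  ultimately show ?thesis by (metis integrable_scaleR_right_eq)
qed

lemma integral_translate_vec:
  fixes f :: "R3 \<Rightarrow> 'a::{banach, second_countable_topology}"
  assumes "f \<in> borel_measurable borel"
  shows "(LINT x|lborel. f (x + a)) = integral\<^sup>L lborel f"
  using integral_affine_vec[OF assms, of 1 a] by simp

lemma integrable_translate_vec:
  fixes f :: "R3 \<Rightarrow> 'a::{banach, second_countable_topology}"
  assumes "f \<in> borel_measurable borel"
  shows "integrable lborel (\<lambda>x. f (x + a)) \<longleftrightarrow> integrable lborel f"
  using integrable_affine_vec[OF assms, of 1 a] by simp

section \<open>Algebra of real square integrable functions\<close>

lemma square_integrable_real_iff:
  "square_integrable (f :: R3 \<Rightarrow> real) \<longleftrightarrow>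
     f \<in> borel_measurable borel \<and> integrable lborel (\<lambda>x. (f x)\<^sup>2)"
  by (simp add: square_integrable_def)

lemma square_integrable_measurable [measurable_dest]:
  "square_integrable (f :: R3 \<Rightarrow> real) \<Longrightarrow> f \<in> borel_measurable borel"
  by (simp add: square_integrable_def)

lemma square_integrable_integrable:
  "square_integrable (f :: R3 \<Rightarrow> real) \<Longrightarrow> integrable lborel (\<lambda>x. (f x)\<^sup>2)"
  by (simp add: square_integrable_def)

lemma two_mult_le_sum_squares: "\<bar>2 * (a::real) * b\<bar> \<le> a\<^sup>2 + b\<^sup>2"
  using zero_le_power2[of "a - b"] zero_le_power2[of "a + b"]
  by (simp add: power2_eq_square algebra_simps abs_le_iff)

lemma square_integrable_mult:
  fixes f g :: "R3 \<Rightarrow> real"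
  assumes f: "square_integrable f" and g: "square_integrable g"
  shows "integrable lborel (\<lambda>x. f x * g x)"
proof (rule Bochner_Integration.integrable_bound)
  note [measurable] = square_integrable_measurable[OF f] square_integrable_measurable[OF g]
  show "integrable lborel (\<lambda>x. (f x)\<^sup>2 + (g x)\<^sup>2)" using f g by (simp add: square_integrable_real_iff)
  show "(\<lambda>x. f x * g x) \<in> borel_measurable lborel" by measurable
  have "\<bar>a * b\<bar> \<le> a\<^sup>2 + b\<^sup>2" for a b :: real
    using two_mult_le_sum_squares[of a b] abs_ge_zero[of "a * b"] by (simp only: abs_mult mult.assoc abs_numeral)
  then show "AE x in lborel. norm (f x * g x) \<le> norm ((f x)\<^sup>2 + (g x)\<^sup>2)" by simp
qed

lemma square_integrable_add:
  fixes f g :: "R3 \<Rightarrow> real"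
  assumes f: "square_integrable f" and g: "square_integrable g"
  shows "square_integrable (\<lambda>x. f x + g x)"
  using square_integrable_mult[OF f g] f g
  by (auto simp: square_integrable_real_iff power2_sum mult.assoc)

lemma square_integrable_cmult:
  fixes f :: "R3 \<Rightarrow> real"
  assumes f: "square_integrable f" shows "square_integrable (\<lambda>x. c * f x)"
  using f by (auto simp: square_integrable_real_iff power_mult_distrib)

lemma square_integrable_diff:
  fixes f g :: "R3 \<Rightarrow> real"
  assumes f: "square_integrable f" and g: "square_integrable g"
  shows "square_integrable (\<lambda>x. f x - g x)"
  using square_integrable_add[OF f square_integrable_cmult[OF g, of "-1"]] by simp

lemma square_integrable_bound:
  fixes f g :: "R3 \<Rightarrow> real"
  assumes f: "square_integrable f" and [measurable]: "g \<in> borel_measurable borel"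
    and le: "\<And>x. \<bar>g x\<bar> \<le> \<bar>f x\<bar>"
  shows "square_integrable g"
proof -
  have "integrable lborel (\<lambda>x. (g x)\<^sup>2)"
    by (rule Bochner_Integration.integrable_bound[OF square_integrable_integrable[OF f]])
       (use le in \<open>auto simp: abs_le_square_iff\<close>)
  then show ?thesis by (simp add: square_integrable_real_iff)
qed

lemma square_integrable_translate:
  fixes f :: "R3 \<Rightarrow> real"
  assumes f: "square_integrable f" shows "square_integrable (\<lambda>x. f (x + a))"
proof -
  note [measurable] = square_integrable_measurable[OF f]
  show ?thesis using f integrable_translate_vec[of "\<lambda>x. (f x)\<^sup>2" a]
    by (simp add: square_integrable_real_iff)
qed

lemma square_integrable_test_function:
  assumes \<phi>: "test_function \<phi>" shows "square_integrable \<phi>"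
proof -
  obtain R where R: "\<And>x. norm x > R \<Longrightarrow> \<phi> x = 0" using \<phi> test_function_support by blast
  obtain B where B: "B > 0" "\<And>x. \<bar>\<phi> x\<bar> \<le> B" using \<phi> test_function_bounded by blast
  note [measurable] = test_function_measurable[OF \<phi>]
  have "\<bar>\<phi> x\<bar> \<le> \<bar>B * indicator (cball 0 R) x\<bar>" for x
    using R[of x] B by (cases "x \<in> cball 0 R") auto
  moreover have "square_integrable (\<lambda>x::R3. B * indicator (cball 0 R) x :: real)"
  proof (intro square_integrable_cmult)
    have "(\<lambda>x::R3. (indicator (cball 0 R) x :: real)\<^sup>2) = indicator (cball 0 R)" by (auto simp: indicator_def)
    then show "square_integrable (indicator (cball (0::R3) R) :: R3 \<Rightarrow> real)"
      using integrable_cball_indicator[of R] by (simp add: square_integrable_real_iff)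
  qed
  ultimately show ?thesis
    using square_integrable_bound[of "\<lambda>x. B * indicator (cball 0 R) x" \<phi>] by auto
qed

section \<open>Density of test functions\<close>

text \<open>The L2 closure of the test functions, measured by squared distance so that no quotient
  by null functions has to be formed.\<close>

definition approximable :: "(R3 \<Rightarrow> real) \<Rightarrow> bool" where
  "approximable f \<longleftrightarrow> square_integrable f \<and>
     (\<forall>\<epsilon>>0. \<exists>\<phi>. test_function \<phi> \<and> (LINT x|lborel. (f x - \<phi> x)\<^sup>2) < \<epsilon>)"

lemma approximableD:
  assumes "approximable f" "\<epsilon> > 0"
  obtains \<phi> where "test_function \<phi>" "(LINT x|lborel. (f x - \<phi> x)\<^sup>2) < \<epsilon>"
  using assms by (auto simp: approximable_def)

lemma approximable_test_function: "test_function \<phi> \<Longrightarrow> approximable \<phi>"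
  by (auto simp: approximable_def square_integrable_test_function intro!: exI[of _ \<phi>])

lemma integral_power2_add_le:
  fixes f g :: "R3 \<Rightarrow> real"
  assumes f: "square_integrable f" and g: "square_integrable g"
  shows "(LINT x|lborel. (f x + g x)\<^sup>2) \<le> 2 * (LINT x|lborel. (f x)\<^sup>2) + 2 * (LINT x|lborel. (g x)\<^sup>2)"
proof -
  have "(a + b)\<^sup>2 \<le> 2 * a\<^sup>2 + 2 * b\<^sup>2" for a b :: real
    using two_mult_le_sum_squares[of a b] by (simp add: power2_sum)
  then have "(LINT x|lborel. (f x + g x)\<^sup>2) \<le> (LINT x|lborel. 2 * (f x)\<^sup>2 + 2 * (g x)\<^sup>2)"
    using assms by (intro integral_mono square_integrable_integrable square_integrable_add)
      (auto intro!: square_integrable_integrable)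
  then show ?thesis using assms[THEN square_integrable_integrable] by simp
qed

lemma approximable_closed:
  assumes f: "square_integrable f"
    and ap: "\<And>\<epsilon>. \<epsilon> > 0 \<Longrightarrow> \<exists>g. approximable g \<and> (LINT x|lborel. (f x - g x)\<^sup>2) < \<epsilon>"
  shows "approximable f"
  unfolding approximable_def
proof (intro conjI allI impI f)
  fix \<epsilon> :: real assume "\<epsilon> > 0"
  \<comment> \<open>The splitting (a+b)^2 <= 2a^2 + 2b^2 doubles both errors, hence a quarter for
    each.\<close>
  then have e: "\<epsilon>/4 > 0" by simp
  obtain g where g: "approximable g" "(LINT x|lborel. (f x - g x)\<^sup>2) < \<epsilon>/4" using ap[OF e] by blast
  obtain \<phi> where \<phi>: "test_function \<phi>" "(LINT x|lborel. (g x - \<phi> x)\<^sup>2) < \<epsilon>/4"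
    using approximableD[OF g(1) e] .
  have "square_integrable g" using g by (simp add: approximable_def)
  then have "(LINT x|lborel. ((f x - g x) + (g x - \<phi> x))\<^sup>2)
      \<le> 2 * (LINT x|lborel. (f x - g x)\<^sup>2) + 2 * (LINT x|lborel. (g x - \<phi> x)\<^sup>2)"
    using f square_integrable_test_function[OF \<phi>(1)]
    by (intro integral_power2_add_le square_integrable_diff)
  then have "(LINT x|lborel. (f x - \<phi> x)\<^sup>2) < \<epsilon>" using g(2) \<phi>(2) by simp
  then show "\<exists>\<phi>. test_function \<phi> \<and> (LINT x|lborel. (f x - \<phi> x)\<^sup>2) < \<epsilon>" using \<phi> by blast
qed

lemma approximable_add:
  assumes f: "approximable f" and g: "approximable g"
  shows "approximable (\<lambda>x. f x + g x)"
  unfolding approximable_def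
proof (intro conjI allI impI)
  have L: "square_integrable f" "square_integrable g" using f g by (auto simp: approximable_def)
  then show "square_integrable (\<lambda>x. f x + g x)" by (rule square_integrable_add)
  fix \<epsilon> :: real assume "\<epsilon> > 0"
  then have e: "\<epsilon>/4 > 0" by simp
  obtain \<phi> where \<phi>: "test_function \<phi>" "(LINT x|lborel. (f x - \<phi> x)\<^sup>2) < \<epsilon>/4"
    using approximableD[OF f e] .
  obtain \<psi> where \<psi>: "test_function \<psi>" "(LINT x|lborel. (g x - \<psi> x)\<^sup>2) < \<epsilon>/4"
    using approximableD[OF g e] .
  have "(LINT x|lborel. ((f x - \<phi> x) + (g x - \<psi> x))\<^sup>2)
      \<le> 2 * (LINT x|lborel. (f x - \<phi> x)\<^sup>2) + 2 * (LINT x|lborel. (g x - \<psi> x)\<^sup>2)"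
    using L square_integrable_test_function[OF \<phi>(1)] square_integrable_test_function[OF \<psi>(1)]
    by (intro integral_power2_add_le square_integrable_diff)
  then have "(LINT x|lborel. ((f x + g x) - (\<phi> x + \<psi> x))\<^sup>2) < \<epsilon>"
    using \<phi>(2) \<psi>(2) by (simp add: algebra_simps)
  then show "\<exists>\<phi>. test_function \<phi> \<and> (LINT x|lborel. ((f x + g x) - \<phi> x)\<^sup>2) < \<epsilon>"
    using test_function_add[OF \<phi>(1) \<psi>(1)] by blast
qed

lemma approximable_cmult:
  assumes f: "approximable f" shows "approximable (\<lambda>x. c * f x)"
  unfolding approximable_def
proof (intro conjI allI impI)
  show "square_integrable (\<lambda>x. c * f x)" using f by (auto simp: approximable_def intro: square_integrable_cmult)
  fix \<epsilon> :: real assume "\<epsilon> > 0"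
  \<comment> \<open>The summand 1 covers c = 0.\<close>
  then have e: "\<epsilon>/(c\<^sup>2+1) > 0" by (simp add: add_nonneg_pos)
  obtain \<phi> where \<phi>: "test_function \<phi>" "(LINT x|lborel. (f x - \<phi> x)\<^sup>2) < \<epsilon>/(c\<^sup>2+1)"
    using approximableD[OF f e] .
  have "(LINT x|lborel. (c * f x - c * \<phi> x)\<^sup>2) = c\<^sup>2 * (LINT x|lborel. (f x - \<phi> x)\<^sup>2)"
    by (simp add: power_mult_distrib flip: right_diff_distrib)
  also have "\<dots> \<le> c\<^sup>2 * (\<epsilon>/(c\<^sup>2+1))" using \<phi>(2) by (intro mult_left_mono) auto
  also have "\<dots> < \<epsilon>" using \<open>\<epsilon> > 0\<close> by (subst times_divide_eq_right, subst pos_divide_less_eq) (simp_all add: algebra_simps add_pos_nonneg)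
  finally show "\<exists>\<phi>. test_function \<phi> \<and> (LINT x|lborel. (c * f x - \<phi> x)\<^sup>2) < \<epsilon>"
    using test_function_cmult[OF \<phi>(1)] by blast
qed

lemma approximable_diff: "approximable f \<Longrightarrow> approximable g \<Longrightarrow> approximable (\<lambda>x. f x - g x)"
  using approximable_add[of f "\<lambda>x. (-1) * g x"] approximable_cmult[of g "-1"] by simp

text \<open>A square integrable majorant turns pointwise convergence into L2 convergence by
  dominated convergence, since the squared error is at most 4 w^2. The passages to the limit below,
  from boxes to Borel sets and on to functions, rest on this.\<close>

lemma approximable_LIMSEQ:
  assumes F: "\<And>n. approximable (F n)" and lim: "\<And>x. (\<lambda>n. F n x) \<longlonglongrightarrow> f x"
    and w: "square_integrable w" and bd: "\<And>n x. \<bar>F n x\<bar> \<le> w x"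
  shows "approximable f"
proof (rule approximable_closed)
  have Fm [measurable]: "F n \<in> borel_measurable borel" for n
    using F by (auto simp: approximable_def square_integrable_measurable)
  have fm [measurable]: "f \<in> borel_measurable borel" by (rule borel_measurable_LIMSEQ_real[OF lim]) simp
  have fw: "\<bar>f x\<bar> \<le> w x" for x by (rule Lim_bounded[OF tendsto_rabs[OF lim], of 0]) (use bd in auto)
  have "\<bar>f x\<bar> \<le> \<bar>w x\<bar>" for x using fw[of x] by linarith
  then show f: "square_integrable f" by (intro square_integrable_bound[OF w fm])
  have "(\<lambda>n. LINT x|lborel. (f x - F n x)\<^sup>2) \<longlonglongrightarrow> (LINT (x::R3)|lborel. 0)"
  proof (rule integral_dominated_convergence[where w="\<lambda>x. 4 * (w x)\<^sup>2"])
    show "integrable lborel (\<lambda>x. 4 * (w x)\<^sup>2)" using square_integrable_integrable[OF w] by simp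
    have "(\<lambda>n. (f x - F n x)\<^sup>2) \<longlonglongrightarrow> (f x - f x)\<^sup>2" for x by (intro tendsto_intros lim)
    then show "AE x in lborel. (\<lambda>n. (f x - F n x)\<^sup>2) \<longlonglongrightarrow> 0" by simp
    have "(f x - F n x)\<^sup>2 \<le> (2 * w x)\<^sup>2" for x n
      using fw[of x] bd[of n x] by (intro abs_le_square_iff[THEN iffD1]) linarith
    then show "AE x in lborel. norm ((f x - F n x)\<^sup>2) \<le> 4 * (w x)\<^sup>2" for n by (simp add: power_mult_distrib)
  qed auto
  then have lim0: "(\<lambda>n. LINT x|lborel. (f x - F n x)\<^sup>2) \<longlonglongrightarrow> 0" by simp
  show "\<exists>g. approximable g \<and> (LINT x|lborel. (f x - g x)\<^sup>2) < \<epsilon>" if "\<epsilon> > 0" for \<epsilon>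
    using F order_tendstoD(2)[OF lim0 that] by (auto simp: eventually_sequentially)
qed

lemma square_integrable_box: "square_integrable (indicator (box a b) :: R3 \<Rightarrow> real)"
proof -
  have "(\<lambda>x::R3. (indicator (box a b) x :: real)\<^sup>2) = indicator (box a b)" by (auto simp: indicator_def)
  then show ?thesis by (simp add: square_integrable_real_iff integrable_indicator_iff emeasure_lborel_box_eq)
qed

lemma approximable_box: "approximable (indicator (box a b))"
proof -
  obtain \<phi> where \<phi>: "test_function \<phi>" "\<And>x. 0 \<le> \<phi> x" "\<And>x. \<phi> x \<le> 1" "\<And>x. \<phi> x > 0 \<longleftrightarrow> x \<in> box a b"
    using box_test_function[of a b] by blast
  \<comment> \<open>Subtracting the power from 1 restores compact support, and F n tends to 1 where
    0 < \<phi> <= 1 and to 0 where \<phi> = 0. Differences are written as sums to match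
    \<open>Ck_add\<close> and \<open>Ck_mult\<close>.\<close>
  define F where "F n x = 1 + (-1) * (1 + (-1) * \<phi> x) ^ n" for n :: nat and x
  obtain R where R: "\<And>x. norm x > R \<Longrightarrow> \<phi> x = 0" using \<phi>(1) test_function_support by blast
  have test: "test_function (F n)" for n
  proof (rule test_functionI)
    show "Ck k (F n)" for k
      using test_function_Ck[OF \<phi>(1), of k] unfolding F_def by (simp only: Ck_add Ck_mult Ck_power Ck_const)
    show "norm x \<le> R" if "F n x \<noteq> 0" for x
      using R[of x] that by (cases "norm x > R") (auto simp: F_def)
  qed
  show ?thesis
  proof (rule approximable_LIMSEQ[OF approximable_test_function[OF test] _ square_integrable_box])
    fix x
    show "(\<lambda>n. F n x) \<longlonglongrightarrow> indicator (box a b) x"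
    proof (cases "x \<in> box a b")
      case True
      then have "norm (1 + (-1) * \<phi> x) < 1" using \<phi>(3)[of x] \<phi>(4)[of x] by simp
      from tendsto_add[OF tendsto_const tendsto_mult[OF tendsto_const LIMSEQ_power_zero[OF this]]]
      have "(\<lambda>n. 1 + (-1) * (1 + (-1) * \<phi> x) ^ n) \<longlonglongrightarrow> 1 + (-1) * 0" .
      then show ?thesis using True by (simp add: F_def)
    next
      case False
      then have "\<phi> x = 0" using \<phi>(2,4)[of x] by simp
      then show ?thesis using False by (simp add: F_def)
    qed
    fix n
    have "0 \<le> (1 - \<phi> x) ^ n" "(1 - \<phi> x) ^ n \<le> 1" using \<phi>(2,3)[of x] by (auto intro: power_le_one)
    moreover have "\<phi> x = 0" if "x \<notin> box a b" using \<phi>(2,4)[of x] that by simp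
    ultimately show "\<bar>F n x\<bar> \<le> indicator (box a b) x" 
      by (cases "x \<in> box a b") (simp_all add: F_def)
  qed
qed

lemma approximable_zero: "approximable (\<lambda>x. 0)"
  using approximable_cmult[OF approximable_box[of 0 0], of 0] by simp

lemma approximable_sum: "(\<And>i. i \<in> I \<Longrightarrow> approximable (F i)) \<Longrightarrow> approximable (\<lambda>x. \<Sum>i\<in>I. F i x)"
proof (induction I rule: infinite_finite_induct)
  case (insert i I)
  then show ?case using approximable_add[of "F i" "\<lambda>x. \<Sum>i\<in>I. F i x"] by simp
qed (simp_all add: approximable_zero)

text \<open>A Dynkin argument: boxes are stable under intersection and generate the Borel sets. The
  fixed box keeps complements and countable unions square integrable.\<close>

lemma approximable_Int_box:
  assumes "A \<in> sets borel" shows "approximable (indicator (A \<inter> box a b))"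
proof -
  have "Int_stable (range (\<lambda>(a, b). box a b :: R3 set))" by (auto simp: Int_stable_def box_Int_box)
  moreover have "range (\<lambda>(a, b). box a b :: R3 set) \<subseteq> Pow UNIV" by auto
  moreover have "A \<in> sigma_sets UNIV (range (\<lambda>(a, b). box a b))" using assms by (simp add: borel_eq_box)
  ultimately show ?thesis
  proof (induction rule: sigma_sets_induct_disjoint)
    case (basic A) then show ?case by (auto simp: box_Int_box approximable_box)
  next
    case empty then show ?case by (simp add: indicator_def approximable_zero)
  next
    case (compl A)
    have "indicator ((UNIV - A) \<inter> box a b) = (\<lambda>x. indicator (box a b) x - indicator (A \<inter> box a b) x :: real)"
      by (auto simp: indicator_def)
    then show ?case using approximable_diff[OF approximable_box compl.IH] by simp
  next
    case (union F)
    show ?case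
    proof (rule approximable_LIMSEQ[OF approximable_sum _ square_integrable_box])
      fix x :: R3 and n :: nat
      have e: "(\<Sum>i<n. indicator (F i \<inter> box a b) x) = (indicator (\<Union>i<n. F i \<inter> box a b) x :: real)" for n
        using union(1) by (subst indicator_UN_disjoint) (auto simp: disjoint_family_on_def)
      show "\<bar>\<Sum>i<n. indicator (F i \<inter> box a b) x\<bar> \<le> (indicator (box a b) x :: real)"
        unfolding e by (auto simp: indicator_def)
      show "(\<lambda>n. \<Sum>i<n. indicator (F i \<inter> box a b) x) \<longlonglongrightarrow> (indicator (\<Union> (range F) \<inter> box a b) x :: real)"
        unfolding e using LIMSEQ_indicator_UN[of "\<lambda>i. F i \<inter> box a b" x] by simp
    qed (use union in simp)
  qed
qed

text \<open>Square integrability is a premise of the induction claim, so it has to be handed down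
  from a sum or a limit to its parts; nonnegativity makes this possible.\<close>

lemma approximable_nonneg_box:
  assumes u: "u \<in> borel_measurable borel" "\<And>x. 0 \<le> u x"
  shows "square_integrable (\<lambda>x. u x * indicator (box a b) x) \<Longrightarrow> approximable (\<lambda>x. u x * indicator (box a b) x)"
  using u
proof (induction rule: borel_measurable_induct_real)
  case (set A)
  then show ?case using approximable_Int_box[of A a b] by (simp add: indicator_inter_arith[abs_def])
next
  case (mult u c)
  show ?case
  proof (cases "c = 0")
    case False
    have "square_integrable (\<lambda>x. u x * indicator (box a b) x)"
      using square_integrable_cmult[OF mult.prems, of "1/c"] False by (simp add: mult.assoc)
    from approximable_cmult[OF mult.IH[OF this], of c] show ?thesis by (simp add: mult.assoc)
  qed (simp add: approximable_zero)
next
  case (add u v)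
  have "square_integrable (\<lambda>x. u x * indicator (box a b) x)" "square_integrable (\<lambda>x. v x * indicator (box a b) x)"
    using add.hyps by (auto intro!: square_integrable_bound[OF add.prems] split: split_indicator)
  then show ?case using approximable_add[OF add.IH(2,1)] by (simp add: algebra_simps)
next
  case (seq U)
  note [measurable] = seq.hyps(1)
  have Ule: "U i x \<le> u x" for i x
    using incseq_le[OF _ seq.hyps(4)[of x], of i] seq.hyps(3) by (auto simp: incseq_def le_fun_def)
  have "approximable (\<lambda>x. U i x * indicator (box a b) x)" for i
    using Ule[of i] seq.hyps(2)
    by (intro seq.IH square_integrable_bound[OF seq.prems]) (auto split: split_indicator intro: order_trans[OF _ abs_ge_self])
  then show ?case
  proof (rule approximable_LIMSEQ[OF _ _ seq.prems])
    show "(\<lambda>n. U n x * indicator (box a b) x) \<longlonglongrightarrow> u x * indicator (box a b) x" for x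
      using seq.hyps(4) by (intro tendsto_intros) auto
    show "\<bar>U n x * indicator (box a b) x\<bar> \<le> u x * indicator (box a b) x" for n x
      using Ule[of n x] seq.hyps(2)[of n x] by (auto split: split_indicator)
  qed
qed

lemma approximable_nonneg:
  assumes f: "square_integrable f" "\<And>x. 0 \<le> f x" shows "approximable f"
proof (rule approximable_LIMSEQ[OF _ _ f(1)])
  note [measurable] = square_integrable_measurable[OF f(1)]
  let ?B = "\<lambda>n. box (\<chi> i. - real n) (\<chi> i. real n) :: R3 set"
  show "approximable (\<lambda>x. f x * indicator (?B n) x)" for n
    by (intro approximable_nonneg_box square_integrable_bound[OF f(1)]) (auto simp: f split: split_indicator)
  show "(\<lambda>n. f x * indicator (?B n) x) \<longlonglongrightarrow> f x" for x
  proof (rule tendsto_eventually)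
    obtain N where N: "norm x < real N" using reals_Archimedean2 by blast
    have "x \<in> ?B n" if "N \<le> n" for n
    proof -
      have "\<bar>x $ i\<bar> < real n" for i using component_le_norm_cart[of x i] N that by linarith
      then show ?thesis by (auto simp: mem_box_cart abs_less_iff minus_less_iff)
    qed
    then show "eventually (\<lambda>n. f x * indicator (?B n) x = f x) sequentially"
      by (auto simp: eventually_sequentially intro!: exI[of _ N])
  qed
  show "\<bar>f x * indicator (?B n) x\<bar> \<le> f x" for n x using f(2)[of x] by (auto split: split_indicator)
qed

theorem square_integrable_approximable:
  assumes f: "square_integrable f" shows "approximable f"
proof -
  note [measurable] = square_integrable_measurable[OF f]
  have "approximable (\<lambda>x. max (f x) 0)" "approximable (\<lambda>x. max (- f x) 0)"
    by (intro approximable_nonneg square_integrable_bound[OF f]; force)+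
  from approximable_diff[OF this] show ?thesis
    by (rule back_subst[of approximable]) (auto simp: max_def)
qed

section \<open>Weak derivatives and translations\<close>

text \<open>The majorant is required only near \<open>t0\<close>, so along a sequence it is
  available from some index on and the initial segment is dropped.\<close>

lemma integral_dominated_convergence_at:
  fixes f :: "'a \<Rightarrow> real" and s :: "real \<Rightarrow> 'a \<Rightarrow> real"
  assumes [measurable]: "\<And>t. s t \<in> borel_measurable M" "f \<in> borel_measurable M"
    and w: "integrable M w"
    and lim: "\<And>x. ((\<lambda>t. s t x) \<longlongrightarrow> f x) (at t0)"
    and bound: "eventually (\<lambda>t. \<forall>x. \<bar>s t x\<bar> \<le> w x) (at t0)"
  shows "((\<lambda>t. integral\<^sup>L M (s t)) \<longlongrightarrow> integral\<^sup>L M f) (at t0)"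
  unfolding tendsto_at_iff_sequentially comp_def
proof (intro allI impI)
  fix X :: "nat \<Rightarrow> real" assume X: "\<forall>i. X i \<in> UNIV - {t0}" "X \<longlonglongrightarrow> t0"
  then have fl: "filterlim X (at t0) sequentially" by (auto simp: filterlim_at)
  from filterlim_iff[THEN iffD1, OF this, rule_format, OF bound]
  obtain N where N: "\<And>n x. N \<le> n \<Longrightarrow> \<bar>s (X n) x\<bar> \<le> w x" by (auto simp: eventually_sequentially)
  show "(\<lambda>n. integral\<^sup>L M (s (X n))) \<longlonglongrightarrow> integral\<^sup>L M f"
  proof (rule LIMSEQ_offset[where k=N], rule integral_dominated_convergence[OF _ _ w])
    show "AE x in M. (\<lambda>n. s (X (n + N)) x) \<longlonglongrightarrow> f x"
      using LIMSEQ_ignore_initial_segment[OF filterlim_compose[OF lim fl]] by simp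
    show "AE x in M. norm (s (X (n + N)) x) \<le> w x" for n using N[of "n + N"] by simp
  qed auto
qed

lemma test_function_translation_continuous:
  assumes \<phi>: "test_function \<phi>" and \<epsilon>: "\<epsilon> > 0"
  shows "\<exists>\<delta>>0. \<forall>h. norm h < \<delta> \<longrightarrow> (LINT x|lborel. (\<phi> (x + h) - \<phi> x)\<^sup>2) < \<epsilon>"
proof -
  obtain R where R: "R > 0" "\<And>x. norm x > R \<Longrightarrow> \<phi> x = 0" using \<phi> test_function_support by blast
  note [measurable] = test_function_measurable[OF \<phi>]
  define V where "V = measure lborel (cball (0::R3) (R + 1))"
  \<comment> \<open>Chosen so that a difference of size \<kappa> on a set of volume \<open>V\<close>
    has squared norm below \<epsilon>; the 1 avoids dividing by zero.\<close>
  define \<kappa> where "\<kappa> = sqrt (\<epsilon> / (2 * (V + 1)))"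
  have V: "V \<ge> 0" by (simp add: V_def)
  then have \<kappa>: "\<kappa> > 0" "\<kappa>\<^sup>2 * V < \<epsilon>" using \<epsilon>
    by (auto simp: \<kappa>_def field_simps add_nonneg_pos)
  \<comment> \<open>For shifts shorter than 1 the difference vanishes outside radius R + 1, and both
    arguments stay within R + 2.\<close>
  have "uniformly_continuous_on (cball 0 (R + 2)) \<phi>"
    by (intro compact_uniformly_continuous continuous_on_subset[OF test_function_continuous[OF \<phi>]]) auto
  then obtain d where d: "d > 0"
    "\<And>x y. x \<in> cball 0 (R + 2) \<Longrightarrow> y \<in> cball 0 (R + 2) \<Longrightarrow> dist y x < d \<Longrightarrow> dist (\<phi> y) (\<phi> x) < \<kappa>"
    unfolding uniformly_continuous_on_def using \<kappa>(1) by blast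
  show ?thesis
  proof (intro exI[of _ "min 1 d"] conjI allI impI)
    show "min 1 d > 0" using d by simp
    fix h :: R3 assume h: "norm h < min 1 d"
    have bd: "\<bar>\<phi> (x + h) - \<phi> x\<bar> \<le> \<kappa> * indicator (cball 0 (R + 1)) x" for x
    proof (cases "norm x \<le> R + 1")
      case True
      have "norm (x + h) \<le> R + 2" using True h norm_triangle_ineq[of x h] by simp
      then have "x + h \<in> cball 0 (R + 2)" "x \<in> cball 0 (R + 2)" using True by simp_all
      then have "dist (\<phi> (x + h)) (\<phi> x) < \<kappa>" using h by (intro d) (simp_all add: dist_norm)
      then show ?thesis using True by (simp add: dist_real_def)
    next
      case False
      have "norm (x + h) > R" using False h norm_diff_ineq[of x h] by simp
      then show ?thesis using False R by simp
    qed
    have "(\<phi> (x + h) - \<phi> x)\<^sup>2 \<le> \<kappa>\<^sup>2 * indicator (cball 0 (R + 1)) x" for x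
      using power_mono[OF bd[of x], of 2] by (auto simp: indicator_def split: if_splits)
    then have "(LINT x|lborel. (\<phi> (x + h) - \<phi> x)\<^sup>2) \<le> (LINT (x::R3)|lborel. \<kappa>\<^sup>2 * indicator (cball 0 (R + 1)) x)"
      using square_integrable_test_function[OF \<phi>] integrable_cball_indicator[of "R + 1"]
      by (intro integral_mono square_integrable_integrable square_integrable_diff square_integrable_translate) auto
    also have "\<dots> = \<kappa>\<^sup>2 * V" by (simp add: V_def)
    finally show "(LINT x|lborel. (\<phi> (x + h) - \<phi> x)\<^sup>2) < \<epsilon>" using \<kappa> by simp
  qed
qed

lemma translation_continuous:
  assumes f: "square_integrable (f :: R3 \<Rightarrow> real)" and \<epsilon>: "\<epsilon> > 0"
  shows "\<exists>\<delta>>0. \<forall>h. norm h < \<delta> \<longrightarrow> (LINT x|lborel. (f (x + h) - f x)\<^sup>2) < \<epsilon>"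
proof -
  \<comment> \<open>Two nested splittings produce 4 + 4 + 2 = 10 of these pieces.\<close>
  have e: "\<epsilon> / 12 > 0" using \<epsilon> by simp
  obtain \<phi> where \<phi>: "test_function \<phi>" "(LINT x|lborel. (f x - \<phi> x)\<^sup>2) < \<epsilon> / 12"
    using approximableD[OF square_integrable_approximable[OF f] e] by blast
  obtain \<delta> where \<delta>: "\<delta> > 0" "\<And>h. norm h < \<delta> \<Longrightarrow> (LINT x|lborel. (\<phi> (x + h) - \<phi> x)\<^sup>2) < \<epsilon> / 12"
    using test_function_translation_continuous[OF \<phi>(1) e] by blast
  note s\<phi> = square_integrable_test_function[OF \<phi>(1)]
  note [measurable] = square_integrable_measurable[OF f] test_function_measurable[OF \<phi>(1)]
  show ?thesis
  proof (intro exI[of _ \<delta>] conjI allI impI \<delta>(1))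
    fix h :: R3 assume h: "norm h < \<delta>"
    define a where "a x = f x - \<phi> x" for x
    have a: "square_integrable a" unfolding a_def using f s\<phi> by (rule square_integrable_diff)
    note [measurable] = square_integrable_measurable[OF a]
    have ah: "square_integrable (\<lambda>x. a (x + h))" using a by (rule square_integrable_translate)
    have a1: "(LINT x|lborel. (a x)\<^sup>2) < \<epsilon> / 12" using \<phi>(2) by (simp add: a_def)
    have a2: "(LINT x|lborel. (a (x + h))\<^sup>2) < \<epsilon> / 12"
      using a1 integral_translate_vec[of "\<lambda>x. (a x)\<^sup>2" h] by simp
    have a3: "(LINT x|lborel. (a (x + h) - a x)\<^sup>2) \<le> 2 * (LINT x|lborel. (a (x + h))\<^sup>2) + 2 * (LINT x|lborel. (a x)\<^sup>2)"
      using integral_power2_add_le[OF ah square_integrable_cmult[OF a, of "-1"]] by simp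
    have "(LINT x|lborel. ((a (x + h) - a x) + (\<phi> (x + h) - \<phi> x))\<^sup>2) \<le>
       2 * (LINT x|lborel. (a (x + h) - a x)\<^sup>2) + 2 * (LINT x|lborel. (\<phi> (x + h) - \<phi> x)\<^sup>2)"
      using square_integrable_diff[OF ah a] square_integrable_diff[OF square_integrable_translate[OF s\<phi>] s\<phi>]
      by (rule integral_power2_add_le)
    then show "(LINT x|lborel. (f (x + h) - f x)\<^sup>2) < \<epsilon>"
      using \<epsilon> a1 a2 a3 \<delta>(2)[OF h] by (simp add: a_def)
  qed
qed

text \<open>A real scalar version: the complex weak gradient amounts to six of these, for the real
  and imaginary parts of three components.\<close>

definition weak_deriv :: "3 \<Rightarrow> (R3 \<Rightarrow> real) \<Rightarrow> (R3 \<Rightarrow> real) \<Rightarrow> bool" where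
  "weak_deriv j f g \<longleftrightarrow> (\<forall>\<phi>. test_function \<phi> \<longrightarrow>
     (LINT x|lborel. partial_deriv j \<phi> x * f x) = - (LINT x|lborel. \<phi> x * g x))"

section \<open>Difference quotients along a coordinate axis\<close>

lemma deriv_along_axis:
  assumes "\<phi> differentiable_on UNIV"
  shows "((\<lambda>t. \<phi> (x + t *\<^sub>R axis j 1)) has_real_derivative partial_deriv j \<phi> (x + t *\<^sub>R axis j 1)) (at t)"
proof -
  have "((\<lambda>t. x + t *\<^sub>R axis j 1) has_derivative (\<lambda>h. h *\<^sub>R axis j 1)) (at t)"
    by (auto intro!: derivative_eq_intros)
  from has_derivative_compose[OF this differentiable_imp_has_frechet[OF assms]]
  have "((\<lambda>t. \<phi> (x + t *\<^sub>R axis j 1)) has_derivative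
     (\<lambda>h. frechet_derivative \<phi> (at (x + t *\<^sub>R axis j 1)) (h *\<^sub>R axis j 1))) (at t)" .
  moreover have "frechet_derivative \<phi> (at (x + t *\<^sub>R axis j 1)) (h *\<^sub>R axis j 1)
      = partial_deriv j \<phi> (x + t *\<^sub>R axis j 1) * h" for h
    using linear_scale[OF has_derivative_linear[OF differentiable_imp_has_frechet[OF assms]]]
    by (simp add: partial_deriv_def mult.commute)
  ultimately show ?thesis by (simp add: has_field_derivative_def)
qed

text \<open>The shift is by -h because translating one factor of an integral by h amounts to
  translating the other by -h.\<close>

lemma diff_quotient_along_axis:
  assumes "\<phi> differentiable_on UNIV"
  shows "((\<lambda>h. (\<phi> (x - h *\<^sub>R axis j 1) - \<phi> x) / h) \<longlongrightarrow> - partial_deriv j \<phi> x) (at 0)"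
proof -
  have "((\<lambda>h. \<phi> (x + (- h) *\<^sub>R axis j 1)) has_real_derivative
      partial_deriv j \<phi> (x + (- 0) *\<^sub>R axis j 1) * (- 1)) (at 0)"
    by (rule DERIV_chain2[OF deriv_along_axis[OF assms] DERIV_minus[OF DERIV_ident]])
  then show ?thesis by (simp add: DERIV_def)
qed

lemma abs_diff_along_axis_le:
  assumes \<phi>: "\<phi> differentiable_on UNIV" and B: "\<And>x. \<bar>partial_deriv j \<phi> x\<bar> \<le> B"
  shows "\<bar>\<phi> (x + h *\<^sub>R axis j 1) - \<phi> x\<bar> \<le> B * \<bar>h\<bar>"
proof -
  have "\<bar>\<phi> (x + h *\<^sub>R axis j 1) - \<phi> (x + 0 *\<^sub>R axis j 1)\<bar> \<le> B * norm (h - 0)"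
    using field_differentiable_bound[of UNIV "\<lambda>t. \<phi> (x + t *\<^sub>R axis j 1)"
        "\<lambda>t. partial_deriv j \<phi> (x + t *\<^sub>R axis j 1)" B h 0]
      deriv_along_axis[OF \<phi>] B by (auto intro: has_field_derivative_at_within)
  then show ?thesis by simp
qed

text \<open>The parameter sits in the test function only, so \<open>f\<close> need not be
  differentiable in any sense. For |h| < 1 all translates live in one ball and their quotients are
  bounded by the supremum of the partial derivative, which yields a majorant.\<close>

lemma has_derivative_pairing_translate:
  assumes \<phi>: "test_function \<phi>" and f: "square_integrable f"
  shows "((\<lambda>s. LINT x|lborel. f x * \<phi> (x - s *\<^sub>R axis j 1)) has_real_derivative
    - (LINT x|lborel. f x * partial_deriv j \<phi> (x - s *\<^sub>R axis j 1))) (at s)"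
  unfolding DERIV_def
proof -
  let ?e = "axis j 1 :: R3"
  have \<phi>': "test_function (partial_deriv j \<phi>)" using \<phi> by (rule test_function_partial_deriv)
  note d\<phi> = test_function_differentiable[OF \<phi>]
  obtain B where B: "B > 0" "\<And>x. \<bar>partial_deriv j \<phi> x\<bar> \<le> B" using \<phi>' test_function_bounded by blast
  obtain R where R: "R > 0" "\<And>x. norm x > R \<Longrightarrow> \<phi> x = 0" using \<phi> test_function_support by blast
  note [measurable] = square_integrable_measurable[OF f] test_function_measurable[OF \<phi>] test_function_measurable[OF \<phi>']
  let ?w = "\<lambda>x. \<bar>f x * (B * indicator (cball 0 (R + \<bar>s\<bar> + 1)) x)\<bar>"
  let ?s = "\<lambda>h x. f x * ((\<phi> (x - (s + h) *\<^sub>R ?e) - \<phi> (x - s *\<^sub>R ?e)) / h)"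
  have test_translate: "test_function (\<lambda>x. \<phi> (x - r *\<^sub>R ?e))" for r
    using test_function_affine[OF \<phi>, of 1 "- r *\<^sub>R ?e"] by simp
  have int: "integrable lborel (\<lambda>x. f x * \<phi> (x - r *\<^sub>R ?e))" for r
    by (intro square_integrable_mult f square_integrable_test_function test_translate)
  have lim: "((\<lambda>h. LINT x|lborel. ?s h x) \<longlongrightarrow> (LINT x|lborel. f x * (- partial_deriv j \<phi> (x - s *\<^sub>R ?e)))) (at 0)"
  proof (rule integral_dominated_convergence_at[where w="?w"])
    have "(indicator (cball (0::R3) (R + \<bar>s\<bar> + 1)) x :: real)\<^sup>2 = indicator (cball 0 (R + \<bar>s\<bar> + 1)) x" for x
      by (auto simp: indicator_def)
    then have "square_integrable (\<lambda>x::R3. B * indicator (cball 0 (R + \<bar>s\<bar> + 1)) x :: real)"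
      using integrable_cball_indicator[of "R + \<bar>s\<bar> + 1"]
      by (intro square_integrable_cmult) (simp add: square_integrable_real_iff)
    from square_integrable_mult[OF f this] show "integrable lborel ?w" by (rule integrable_abs)
    fix x
    have "((\<lambda>h. f x * ((\<phi> ((x - s *\<^sub>R ?e) - h *\<^sub>R ?e)  - \<phi> (x - s *\<^sub>R ?e)) / h)) \<longlongrightarrow>
        f x * (- partial_deriv j \<phi> (x - s *\<^sub>R ?e))) (at 0)"
      by (intro tendsto_mult tendsto_const diff_quotient_along_axis d\<phi>)
    then show "((\<lambda>h. ?s h x) \<longlongrightarrow> f x * (- partial_deriv j \<phi> (x - s *\<^sub>R ?e))) (at 0)"
      by (simp add: scaleR_add_left diff_diff_eq)
  next
    have bd: "\<bar>(\<phi> (x - (s + h) *\<^sub>R ?e) - \<phi> (x - s *\<^sub>R ?e)) / h\<bar> \<le> B * indicator (cball 0 (R + \<bar>s\<bar> + 1)) x"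
      if h: "\<bar>h\<bar> < 1" "h \<noteq> 0" for h x
    proof (cases "norm x \<le> R + \<bar>s\<bar> + 1")
      case True
      have "\<bar>\<phi> ((x - s *\<^sub>R ?e) + (- h) *\<^sub>R ?e) - \<phi> (x - s *\<^sub>R ?e)\<bar> \<le> B * \<bar>- h\<bar>"
        by (rule abs_diff_along_axis_le[OF d\<phi> B(2)])
      then have "\<bar>\<phi> (x - (s + h) *\<^sub>R ?e) - \<phi> (x - s *\<^sub>R ?e)\<bar> \<le> B * \<bar>h\<bar>" by (simp add: algebra_simps)
      then show ?thesis using True h by (simp add: field_simps)
    next
      case False
      have "norm x - norm (r *\<^sub>R ?e) \<le> norm (x - r *\<^sub>R ?e)" for r by (rule norm_triangle_ineq2)
      from this[of "s + h"] this[of s] have "norm (x - (s + h) *\<^sub>R ?e) > R" "norm (x - s *\<^sub>R ?e) > R"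
        using False h by (auto simp: norm_axis_1)
      then show ?thesis using R False by simp
    qed
    have "\<forall>x. \<bar>?s h x\<bar> \<le> ?w x" if "\<bar>h\<bar> < 1" "h \<noteq> 0" for h
    proof
      fix x
      have "\<bar>f x\<bar> * \<bar>(\<phi> (x - (s + h) *\<^sub>R ?e) - \<phi> (x - s *\<^sub>R ?e)) / h\<bar>
          \<le> \<bar>f x\<bar> * \<bar>B * indicator (cball 0 (R + \<bar>s\<bar> + 1)) x\<bar>"
        by (intro mult_left_mono order_trans[OF bd[OF that] abs_ge_self]) simp
      then show "\<bar>?s h x\<bar> \<le> ?w x" by (simp only: abs_mult)
    qed
    then show "eventually (\<lambda>h. \<forall>x. \<bar>?s h x\<bar> \<le> ?w x) (at 0)"
      by (auto simp: eventually_at dist_real_def intro!: exI[of _ 1])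
  qed auto
  have eq: "(LINT x|lborel. ?s h x) =
      ((LINT x|lborel. f x * \<phi> (x - (s + h) *\<^sub>R ?e)) - (LINT x|lborel. f x * \<phi> (x - s *\<^sub>R ?e))) / h" for h
    using int[of "s + h"] int[of s]
    by (subst Bochner_Integration.integral_diff[symmetric]) (auto simp: right_diff_distrib diff_divide_distrib simp flip: integral_divide)
  have r: "(LINT x|lborel. f x * (- partial_deriv j \<phi> (x - s *\<^sub>R ?e)))
      = - (LINT x|lborel. f x * partial_deriv j \<phi> (x - s *\<^sub>R ?e))" by simp
  show "((\<lambda>h. ((LINT x|lborel. f x * \<phi> (x - (s + h) *\<^sub>R ?e)) - (LINT x|lborel. f x * \<phi> (x - s *\<^sub>R ?e))) / h)
      \<longlongrightarrow> - (LINT x|lborel. f x * partial_deriv j \<phi> (x - s *\<^sub>R ?e))) (at 0)"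
    using lim unfolding eq r .
qed

text \<open>Stated with Young's inequality in place of Cauchy-Schwarz, so that no square roots occur.\<close>

lemma norm_le_by_test_functions:
  assumes D: "square_integrable (D :: R3 \<Rightarrow> real)"
    and le: "\<And>\<phi>. test_function \<phi> \<Longrightarrow> 2 * (LINT x|lborel. D x * \<phi> x) \<le> C + (LINT x|lborel. (\<phi> x)\<^sup>2)"
  shows "(LINT x|lborel. (D x)\<^sup>2) \<le> C"
proof (rule field_le_epsilon)
  fix \<epsilon> :: real assume "\<epsilon> > 0"
  then obtain \<phi> where \<phi>: "test_function \<phi>" "(LINT x|lborel. (D x - \<phi> x)\<^sup>2) < \<epsilon>"
    using approximableD[OF square_integrable_approximable[OF D]] by blast
  note s\<phi> = square_integrable_test_function[OF \<phi>(1)]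
  have "(LINT x|lborel. (D x - \<phi> x)\<^sup>2) = (LINT x|lborel. (D x)\<^sup>2 - 2 * (D x * \<phi> x) + (\<phi> x)\<^sup>2)"
    by (simp add: power2_diff algebra_simps)
  also have "\<dots> = (LINT x|lborel. (D x)\<^sup>2) - 2 * (LINT x|lborel. D x * \<phi> x) + (LINT x|lborel. (\<phi> x)\<^sup>2)"
    using square_integrable_integrable[OF D] square_integrable_integrable[OF s\<phi>] square_integrable_mult[OF D s\<phi>]
    by simp
  finally show "(LINT x|lborel. (D x)\<^sup>2) \<le> C + \<epsilon>" using le[OF \<phi>(1)] \<phi>(2) by simp
qed

text \<open>By duality. Paired with a test function, the remainder becomes the increment of a scalar
  function \<open>P\<close>, whose derivative, by the weak derivative identity, is the pairing with
  g(x + s e) - g(x). The mean value theorem brings out a factor h, and continuity of translations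
  makes what remains small uniformly in the test function.\<close>

lemma translation_differentiable:
  assumes f: "square_integrable f" and g: "square_integrable g" and wd: "weak_deriv j f g"
    and \<epsilon>: "\<epsilon> > 0"
  shows "\<exists>\<delta>>0. \<forall>h. \<bar>h\<bar> < \<delta> \<longrightarrow>
     (LINT x|lborel. (f (x + h *\<^sub>R axis j 1) - f x - h * g x)\<^sup>2) \<le> \<epsilon> * h\<^sup>2"
proof -
  let ?e = "axis j 1 :: R3"
  obtain \<delta> where \<delta>: "\<delta> > 0" "\<And>h. norm h < \<delta> \<Longrightarrow> (LINT x|lborel. (g (x + h) - g x)\<^sup>2) < \<epsilon>"
    using translation_continuous[OF g \<epsilon>] by blast
  note [measurable] = square_integrable_measurable[OF f] square_integrable_measurable[OF g]
  show ?thesis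
  proof (intro exI[of _ \<delta>] conjI allI impI \<delta>(1))
    fix h :: real assume h: "\<bar>h\<bar> < \<delta>"
    define D where "D x = f (x + h *\<^sub>R ?e) - f x - h * g x" for x
    have fh: "square_integrable (\<lambda>x. f (x + h *\<^sub>R ?e))" using f by (rule square_integrable_translate)
    have D: "square_integrable D" unfolding D_def
      by (rule square_integrable_diff[OF square_integrable_diff[OF fh f] square_integrable_cmult[OF g]])
    have "(LINT x|lborel. (D x)\<^sup>2) \<le> \<epsilon> * h\<^sup>2"
    proof (rule norm_le_by_test_functions[OF D])
      fix \<phi> :: "R3 \<Rightarrow> real" assume \<phi>: "test_function \<phi>"
      note s\<phi> = square_integrable_test_function[OF \<phi>]
      note [measurable] = test_function_measurable[OF \<phi>]
      define P where "P s = (LINT x|lborel. f x * \<phi> (x - s *\<^sub>R ?e)) - s * (LINT x|lborel. g x * \<phi> x)" for s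
      have shift: "(LINT x|lborel. u (x + s *\<^sub>R ?e) * \<phi> x) = (LINT x|lborel. u x * \<phi> (x - s *\<^sub>R ?e))"
        if [measurable]: "u \<in> borel_measurable borel" for u s
        using integral_translate_vec[of "\<lambda>x. u x * \<phi> (x - s *\<^sub>R ?e)" "s *\<^sub>R ?e"] by simp
      have gs: "square_integrable (\<lambda>x. g (x + s *\<^sub>R ?e) - g x)" for s
        by (rule square_integrable_diff[OF square_integrable_translate[OF g] g])
      have P': "(P has_real_derivative (LINT x|lborel. (g (x + s *\<^sub>R ?e) - g x) * \<phi> x)) (at s)" for s
      proof -
        \<comment> \<open>The weak derivative identity is applied to the translated test
          function.\<close>
        have t: "test_function (\<lambda>x. \<phi> (1 *\<^sub>R x + - (s *\<^sub>R ?e)))" using \<phi> by (rule test_function_affine) simp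
        have "partial_deriv j (\<lambda>x. \<phi> (1 *\<^sub>R x + - (s *\<^sub>R ?e))) = (\<lambda>x. 1 * partial_deriv j \<phi> (1 *\<^sub>R x + - (s *\<^sub>R ?e)))"
          using test_function_differentiable[OF \<phi>] by (rule partial_deriv_affine)
        then have "- (LINT x|lborel. f x * partial_deriv j \<phi> (x - s *\<^sub>R ?e)) = (LINT x|lborel. g x * \<phi> (x - s *\<^sub>R ?e))"
          using wd[unfolded weak_deriv_def, rule_format, OF t] by (simp add: mult.commute)
        also have "\<dots> = (LINT x|lborel. g (x + s *\<^sub>R ?e) * \<phi> x)" by (rule shift[symmetric]) simp
        also have "\<dots> - (LINT x|lborel. g x * \<phi> x) = (LINT x|lborel. (g (x + s *\<^sub>R ?e) - g x) * \<phi> x)"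
          using square_integrable_mult[OF square_integrable_translate[OF g] s\<phi>] square_integrable_mult[OF g s\<phi>]
          by (simp add: left_diff_distrib)
        finally have e: "- (LINT x|lborel. f x * partial_deriv j \<phi> (x - s *\<^sub>R ?e)) - (LINT x|lborel. g x * \<phi> x)
           = (LINT x|lborel. (g (x + s *\<^sub>R ?e) - g x) * \<phi> x)" by simp
        show ?thesis unfolding P_def e[symmetric]
          by (rule derivative_eq_intros has_derivative_pairing_translate[OF \<phi> f] refl)+ simp
      qed
      have P0: "P h - P 0 = (LINT x|lborel. D x * \<phi> x)"
      proof -
        have "(LINT x|lborel. D x * \<phi> x) = (LINT x|lborel. f (x + h *\<^sub>R ?e) * \<phi> x - f x * \<phi> x - h * (g x * \<phi> x))"
          by (simp add: D_def left_diff_distrib mult.assoc)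
        also have "\<dots> = (LINT x|lborel. f (x + h *\<^sub>R ?e) * \<phi> x) - (LINT x|lborel. f x * \<phi> x) - h * (LINT x|lborel. g x * \<phi> x)"
          using square_integrable_mult[OF fh s\<phi>] square_integrable_mult[OF f s\<phi>] square_integrable_mult[OF g s\<phi>]
          by simp
        finally show ?thesis by (simp add: P_def shift)
      qed
      obtain s where s: "\<bar>s\<bar> \<le> \<bar>h\<bar>" "P h - P 0 = h * (LINT x|lborel. (g (x + s *\<^sub>R ?e) - g x) * \<phi> x)"
      proof -
        consider "h > 0" | "h < 0" | "h = 0" by linarith
        then show ?thesis
        proof cases
          case 1 then show ?thesis using MVT2[OF 1, of P, OF P'] that by force
        next
          case 2
          from MVT2[OF 2, of P, OF P'] obtain z where "h < z" "z < 0"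
            "P 0 - P h = (0 - h) * (LINT x|lborel. (g (x + z *\<^sub>R ?e) - g x) * \<phi> x)" by auto
          then show ?thesis using that[of z] by simp
        next
          case 3 then show ?thesis using that[of 0] by simp
        qed
      qed
      have ns: "norm (s *\<^sub>R ?e) < \<delta>" using s(1) h by (simp add: norm_axis_1)
      have "2 * (LINT x|lborel. D x * \<phi> x) = (LINT x|lborel. 2 * (h * (g (x + s *\<^sub>R ?e) - g x)) * \<phi> x)"
        using s(2) P0 by (simp add: mult.assoc)
      also have "\<dots> \<le> (LINT x|lborel. (h * (g (x + s *\<^sub>R ?e) - g x))\<^sup>2 + (\<phi> x)\<^sup>2)"
      proof (rule integral_mono)
        show "integrable lborel (\<lambda>x. 2 * (h * (g (x + s *\<^sub>R ?e) - g x)) * \<phi> x)"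
          using square_integrable_mult[OF square_integrable_cmult[OF gs] s\<phi>] by (simp add: mult.assoc)
        show "integrable lborel (\<lambda>x. (h * (g (x + s *\<^sub>R ?e) - g x))\<^sup>2 + (\<phi> x)\<^sup>2)"
          using square_integrable_integrable[OF square_integrable_cmult[OF gs]] square_integrable_integrable[OF s\<phi>]
          by (rule Bochner_Integration.integrable_add)
        show "2 * (h * (g (x + s *\<^sub>R ?e) - g x)) * \<phi> x \<le> (h * (g (x + s *\<^sub>R ?e) - g x))\<^sup>2 + (\<phi> x)\<^sup>2" for x
          using two_mult_le_sum_squares[of "h * (g (x + s *\<^sub>R ?e) - g x)" "\<phi> x"] by linarith
      qed
      also have "\<dots> = h\<^sup>2 * (LINT x|lborel. (g (x + s *\<^sub>R ?e) - g x)\<^sup>2) + (LINT x|lborel. (\<phi> x)\<^sup>2)"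
        using square_integrable_integrable[OF gs] square_integrable_integrable[OF s\<phi>]
        by (simp add: power_mult_distrib)
      also have "\<dots> \<le> h\<^sup>2 * \<epsilon> + (LINT x|lborel. (\<phi> x)\<^sup>2)"
        using \<delta>(2)[OF ns] by (intro add_mono mult_left_mono) auto
      finally show "2 * (LINT x|lborel. D x * \<phi> x) \<le> \<epsilon> * h\<^sup>2 + (LINT x|lborel. (\<phi> x)\<^sup>2)"
        by (simp add: mult.commute)
    qed
    then show "(LINT x|lborel. (f (x + h *\<^sub>R ?e) - f x - h * g x)\<^sup>2) \<le> \<epsilon> * h\<^sup>2" by (simp add: D_def)
  qed
qed

text \<open>Substituting f1 = f + h g + D, the left side is the modulus of 2 f D/h + (h g + D)^2 /
  h; Young's inequality with weight \<kappa> treats the first summand. When the integral of D^2 is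
  at most \<kappa>^2 h^2 and |h| < \<kappa> < 1, every term on the right integrates to a multiple of
  \<kappa>.\<close>

lemma square_increment_bound:
  fixes f1 f g h \<kappa> :: real
  assumes \<kappa>: "\<kappa> > 0" and h: "h \<noteq> 0"
  defines "D \<equiv> f1 - f - h * g"
  shows "\<bar>(f1\<^sup>2 - f\<^sup>2) / h - 2 * f * g\<bar> \<le> \<kappa> * f\<^sup>2 + D\<^sup>2 / (\<kappa> * h\<^sup>2) + 2 * \<bar>h\<bar> * g\<^sup>2 + 2 * D\<^sup>2 / \<bar>h\<bar>"
proof -
  have eq: "(f1\<^sup>2 - f\<^sup>2) / h - 2 * f * g = 2 * f * (D / h) + (h * g + D)\<^sup>2 / h"
    using h unfolding D_def by (simp add: field_simps power2_eq_square)
  have "\<bar>2 * f * (D / h)\<bar> \<le> \<kappa> * f\<^sup>2 + D\<^sup>2 / (\<kappa> * h\<^sup>2)"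
  proof -
    have "\<bar>2 * (sqrt \<kappa> * f) * (D / h / sqrt \<kappa>)\<bar> \<le> (sqrt \<kappa> * f)\<^sup>2 + (D / h / sqrt \<kappa>)\<^sup>2"
      by (rule two_mult_le_sum_squares)
    then show ?thesis using \<kappa> by (simp add: power_mult_distrib power_divide mult.commute)
  qed
  moreover have "\<bar>(h * g + D)\<^sup>2 / h\<bar> \<le> 2 * \<bar>h\<bar> * g\<^sup>2 + 2 * D\<^sup>2 / \<bar>h\<bar>"
  proof -
    have "(h * g + D)\<^sup>2 \<le> 2 * (h * g)\<^sup>2 + 2 * D\<^sup>2"
      using two_mult_le_sum_squares[of "h * g" D] by (simp add: power2_sum)
    then have "(h * g + D)\<^sup>2 / \<bar>h\<bar> \<le> (2 * (h * g)\<^sup>2 + 2 * D\<^sup>2) / \<bar>h\<bar>" using h by (intro divide_right_mono) auto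
    also have "\<dots> = 2 * \<bar>h\<bar> * g\<^sup>2 + 2 * D\<^sup>2 / \<bar>h\<bar>"
      using h by (simp add: add_divide_distrib power_mult_distrib) (simp add: power2_eq_square abs_if)
    finally show ?thesis by (simp add: abs_divide)
  qed
  ultimately show ?thesis unfolding eq
    using abs_triangle_ineq[of "2 * f * (D / h)" "(h * g + D)\<^sup>2 / h"] by linarith
qed

text \<open>No continuity of the derivative is assumed; measurability comes from it being a
  pointwise limit of difference quotients.\<close>

lemma borel_measurable_partial_deriv:
  assumes "\<Phi> differentiable_on UNIV" shows "partial_deriv j \<Phi> \<in> borel_measurable borel"
proof (rule borel_measurable_LIMSEQ_real)
  let ?X = "\<lambda>n. inverse (real (Suc n))"
  note m = borel_measurable_continuous_onI[OF differentiable_imp_continuous_on[OF assms]]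
  have "(\<lambda>x. \<Phi> (x + ?X n *\<^sub>R axis j 1)) \<in> borel_measurable borel" for n
    by (rule measurable_compose[OF _ m]) simp
  then show "(\<lambda>x. (\<Phi> (x + ?X n *\<^sub>R axis j 1) - \<Phi> x) / ?X n) \<in> borel_measurable borel" for n
    using m by (intro borel_measurable_divide borel_measurable_diff) auto
  show "(\<lambda>n. (\<Phi> (x + ?X n *\<^sub>R axis j 1) - \<Phi> x) / ?X n) \<longlonglongrightarrow> partial_deriv j \<Phi> x" for x
  proof -
    have "((\<lambda>h. (\<Phi> (x + h *\<^sub>R axis j 1) - \<Phi> x) / h) \<longlongrightarrow> partial_deriv j \<Phi> x) (at 0)"
      using deriv_along_axis[OF assms, of x j 0] by (simp add: DERIV_def)
    moreover have "filterlim ?X (at 0) sequentially"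
      using LIMSEQ_inverse_real_of_nat by (auto simp: filterlim_at)
    ultimately show ?thesis by (rule filterlim_compose)
  qed
qed

text \<open>Since \<Phi> need not have compact support and f^2 has no weak derivative at hand, the
  definition cannot be applied directly. Instead the integral \<open>T h\<close> has its limit
  computed twice: with the quotient on \<Phi>, by dominated convergence, and, after a translation,
  with the quotient on f^2, by L2 differentiability of translations.\<close>

lemma integral_partial_deriv_square:
  assumes f: "square_integrable f" and g: "square_integrable g" and wd: "weak_deriv j f g"
    and \<Phi>: "\<Phi> differentiable_on UNIV" and B: "\<And>x. \<bar>\<Phi> x\<bar> \<le> B" "\<And>x. \<bar>partial_deriv j \<Phi> x\<bar> \<le> B"
  shows "(LINT x|lborel. partial_deriv j \<Phi> x * (f x)\<^sup>2) = - 2 * (LINT x|lborel. \<Phi> x * f x * g x)"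
proof -
  let ?e = "axis j 1 :: R3"
  have B0: "B \<ge> 0" using B(1)[of 0] by linarith
  note [measurable] = square_integrable_measurable[OF f] square_integrable_measurable[OF g]
    borel_measurable_continuous_onI[OF differentiable_imp_continuous_on[OF \<Phi>]]
    borel_measurable_partial_deriv[OF \<Phi>, of j]
  have iB: "integrable lborel (\<lambda>x. u x * v x)"
    if u[measurable]: "u \<in> borel_measurable borel" "\<And>x. \<bar>u x\<bar> \<le> B" and v: "integrable lborel v"
    for u v :: "R3 \<Rightarrow> real"
  proof (rule Bochner_Integration.integrable_bound[where f="\<lambda>x. B * v x"])
    note [measurable] = borel_measurable_integrable[OF v]
    show "integrable lborel (\<lambda>x. B * v x)" using v by simp
    show "(\<lambda>x. u x * v x) \<in> borel_measurable lborel" by measurable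
    show "AE x in lborel. norm (u x * v x) \<le> norm (B * v x)"
      using u(2) B0 by (auto simp: abs_mult intro!: mult_right_mono)
  qed
  define T where "T h = (LINT x|lborel. (\<Phi> (x - h *\<^sub>R ?e) - \<Phi> x) / h * (f x)\<^sup>2)" for h
  have quot: "((\<lambda>h. (\<Phi> (x - h *\<^sub>R ?e) - \<Phi> x) / h) \<longlongrightarrow> - partial_deriv j \<Phi> x) (at 0)" for x
    by (rule diff_quotient_along_axis[OF \<Phi>])
  have lim1: "(T \<longlongrightarrow> (LINT x|lborel. - partial_deriv j \<Phi> x * (f x)\<^sup>2)) (at 0)"
    unfolding T_def
  proof (rule integral_dominated_convergence_at[where w="\<lambda>x. B * (f x)\<^sup>2"])
    show "integrable lborel (\<lambda>x. B * (f x)\<^sup>2)" using square_integrable_integrable[OF f] by simp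
    show "((\<lambda>h. (\<Phi> (x - h *\<^sub>R ?e) - \<Phi> x) / h * (f x)\<^sup>2) \<longlongrightarrow> - partial_deriv j \<Phi> x * (f x)\<^sup>2) (at 0)" for x
      by (intro tendsto_intros quot)
    have "\<bar>(\<Phi> (x - h *\<^sub>R ?e) - \<Phi> x) / h\<bar> \<le> B" for x h
      using abs_diff_along_axis_le[OF \<Phi> B(2), of x "-h"] B0 by (cases "h = 0") (auto simp: field_simps)
    then show "eventually (\<lambda>h. \<forall>x. \<bar>(\<Phi> (x - h *\<^sub>R ?e) - \<Phi> x) / h * (f x)\<^sup>2\<bar> \<le> B * (f x)\<^sup>2) (at 0)"
      unfolding abs_mult abs_power2 by (intro always_eventually allI mult_right_mono) auto
  qed auto
  define L where "L = 2 * (LINT x|lborel. \<Phi> x * (f x * g x))"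
  \<comment> \<open>Collects the four terms of \<open>square_increment_bound\<close>, after the
    factor \<kappa> has been taken out of each.\<close>
  define C where "C = B * ((LINT x|lborel. (f x)\<^sup>2) + 1 + 2 * (LINT x|lborel. (g x)\<^sup>2) + 2)"
  have C0: "C \<ge> 0" using B0 by (simp add: C_def)
  have key: "eventually (\<lambda>h. \<bar>T h - L\<bar> \<le> \<kappa> * C) (at 0)" if \<kappa>: "0 < \<kappa>" "\<kappa> < 1" for \<kappa>
  proof -
    have "\<kappa>\<^sup>2 > 0" using \<kappa> by simp
    then obtain \<delta> where \<delta>: "\<delta> > 0" "\<And>h. \<bar>h\<bar> < \<delta> \<Longrightarrow>
     (LINT x|lborel. (f (x + h *\<^sub>R axis j 1) - f x - h * g x)\<^sup>2) \<le> \<kappa>\<^sup>2 * h\<^sup>2"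
      using translation_differentiable[OF f g wd] by blast
    have "\<bar>T h - L\<bar> \<le> \<kappa> * C" if h: "h \<noteq> 0" "\<bar>h\<bar> < min \<delta> \<kappa>" for h
    proof -
      define D where "D x = f (x + h *\<^sub>R ?e) - f x - h * g x" for x
      have fh: "square_integrable (\<lambda>x. f (x + h *\<^sub>R ?e))" using f by (rule square_integrable_translate)
      have D: "square_integrable D" unfolding D_def
        by (rule square_integrable_diff[OF square_integrable_diff[OF fh f] square_integrable_cmult[OF g]])
      have D2: "(LINT x|lborel. (D x)\<^sup>2) \<le> \<kappa>\<^sup>2 * h\<^sup>2" using \<delta>(2)[of h] h by (simp add: D_def)
      define E where "E x = (((f (x + h *\<^sub>R ?e))\<^sup>2 - (f x)\<^sup>2) / h - 2 * f x * g x)" for x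
      note sq = square_integrable_integrable
      have Ei: "integrable lborel E" unfolding E_def
        using sq[OF fh] sq[OF f] square_integrable_mult[OF f g] by (auto simp: mult.assoc)
      have "T h = (LINT x|lborel. \<Phi> x * (((f (x + h *\<^sub>R ?e))\<^sup>2 - (f x)\<^sup>2) / h))"
      proof -
        have 1: "integrable lborel (\<lambda>x. \<Phi> (x - h *\<^sub>R ?e) * (f x)\<^sup>2)" by (intro iB sq f) (auto simp: B)
        have 2: "integrable lborel (\<lambda>x. \<Phi> x * (f x)\<^sup>2)" by (intro iB sq f) (auto simp: B)
        have 3: "integrable lborel (\<lambda>x. \<Phi> x * (f (x + h *\<^sub>R ?e))\<^sup>2)" by (intro iB sq fh) (auto simp: B)
        have "T h = ((LINT x|lborel. \<Phi> (x - h *\<^sub>R ?e) * (f x)\<^sup>2) - (LINT x|lborel. \<Phi> x * (f x)\<^sup>2)) / h"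
          using 1 2 unfolding T_def
          by (simp add: left_diff_distrib diff_divide_distrib flip: Bochner_Integration.integral_diff integral_divide_zero)
        also have "(LINT x|lborel. \<Phi> (x - h *\<^sub>R ?e) * (f x)\<^sup>2) = (LINT x|lborel. \<Phi> x * (f (x + h *\<^sub>R ?e))\<^sup>2)"
          using integral_translate_vec[of "\<lambda>x. \<Phi> (x - h *\<^sub>R ?e) * (f x)\<^sup>2" "h *\<^sub>R ?e"] by simp
        finally show ?thesis using 2 3
          by (simp add: right_diff_distrib diff_divide_distrib flip: Bochner_Integration.integral_diff integral_divide_zero)
      qed
      moreover have "L = (LINT x|lborel. \<Phi> x * (2 * f x * g x))"
        by (simp add: L_def mult.assoc mult.left_commute[of _ 2])
      moreover have i1: "integrable lborel (\<lambda>x. \<Phi> x * (((f (x + h *\<^sub>R ?e))\<^sup>2 - (f x)\<^sup>2) / h))"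
        by (rule iB) (use sq[OF fh] sq[OF f] in \<open>auto simp: B\<close>)
      moreover have i2: "integrable lborel (\<lambda>x. \<Phi> x * (2 * f x * g x))"
        by (rule iB) (use square_integrable_mult[OF f g] in \<open>auto simp: B mult.assoc\<close>)
      ultimately have "T h - L = (LINT x|lborel. \<Phi> x * (((f (x + h *\<^sub>R ?e))\<^sup>2 - (f x)\<^sup>2) / h) - \<Phi> x * (2 * f x * g x))"
        using Bochner_Integration.integral_diff[OF i1 i2] by simp
      also have "\<dots> = (LINT x|lborel. \<Phi> x * E x)" by (simp only: E_def right_diff_distrib)
      also have "\<bar>\<dots>\<bar> \<le> (LINT x|lborel. \<bar>\<Phi> x * E x\<bar>)" by (rule integral_abs_bound)
      also have "\<dots> \<le> (LINT x|lborel. B * (\<kappa> * (f x)\<^sup>2 + (D x)\<^sup>2 / (\<kappa> * h\<^sup>2) + 2 * \<bar>h\<bar> * (g x)\<^sup>2 + 2 * (D x)\<^sup>2 / \<bar>h\<bar>))"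
      proof (rule integral_mono)
        show "integrable lborel (\<lambda>x. \<bar>\<Phi> x * E x\<bar>)" by (intro integrable_abs iB Ei) (auto simp: B)
        show "integrable lborel (\<lambda>x. B * (\<kappa> * (f x)\<^sup>2 + (D x)\<^sup>2 / (\<kappa> * h\<^sup>2) + 2 * \<bar>h\<bar> * (g x)\<^sup>2 + 2 * (D x)\<^sup>2 / \<bar>h\<bar>))"
          using sq[OF f] sq[OF g] sq[OF D] by simp
        fix x
        have "\<bar>E x\<bar> \<le> \<kappa> * (f x)\<^sup>2 + (D x)\<^sup>2 / (\<kappa> * h\<^sup>2) + 2 * \<bar>h\<bar> * (g x)\<^sup>2 + 2 * (D x)\<^sup>2 / \<bar>h\<bar>"
          unfolding E_def D_def using \<kappa>(1) h(1) by (rule square_increment_bound)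
        then show "\<bar>\<Phi> x * E x\<bar> \<le> B * (\<kappa> * (f x)\<^sup>2 + (D x)\<^sup>2 / (\<kappa> * h\<^sup>2) + 2 * \<bar>h\<bar> * (g x)\<^sup>2 + 2 * (D x)\<^sup>2 / \<bar>h\<bar>)"
          unfolding abs_mult using B(1)[of x] B0 by (intro mult_mono) auto
      qed
      also have "\<dots> = B * (\<kappa> * (LINT x|lborel. (f x)\<^sup>2) + (LINT x|lborel. (D x)\<^sup>2) / (\<kappa> * h\<^sup>2)
          + 2 * \<bar>h\<bar> * (LINT x|lborel. (g x)\<^sup>2) + 2 * (LINT x|lborel. (D x)\<^sup>2) / \<bar>h\<bar>)"
        using sq[OF f] sq[OF g] sq[OF D] by simp
      also have "\<dots> \<le> B * (\<kappa> * (LINT x|lborel. (f x)\<^sup>2) + \<kappa> + 2 * \<kappa> * (LINT x|lborel. (g x)\<^sup>2) + 2 * \<kappa>)"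
      proof (intro mult_left_mono B0 add_mono order_refl)
        have "(LINT x|lborel. (D x)\<^sup>2) / (\<kappa> * h\<^sup>2) \<le> (\<kappa>\<^sup>2 * h\<^sup>2) / (\<kappa> * h\<^sup>2)"
          using D2 \<kappa> h by (intro divide_right_mono) auto
        then show "(LINT x|lborel. (D x)\<^sup>2) / (\<kappa> * h\<^sup>2) \<le> \<kappa>" using \<kappa> h by (simp add: power2_eq_square)
        show "2 * \<bar>h\<bar> * (LINT x|lborel. (g x)\<^sup>2) \<le> 2 * \<kappa> * (LINT x|lborel. (g x)\<^sup>2)"
          using h by (intro mult_right_mono) auto
        have "2 * (LINT x|lborel. (D x)\<^sup>2) / \<bar>h\<bar> \<le> 2 * (\<kappa>\<^sup>2 * h\<^sup>2) / \<bar>h\<bar>"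
          using D2 by (intro divide_right_mono) auto
        also have "\<dots> = 2 * (\<kappa>\<^sup>2 * \<bar>h\<bar>)" using h by (simp add: power2_eq_square abs_if)
        also have "\<dots> \<le> 2 * (\<kappa> * 1)"
          using h \<kappa> by (intro mult_left_mono mult_mono) (auto simp: power2_eq_square mult_le_cancel_left1)
        finally show "2 * (LINT x|lborel. (D x)\<^sup>2) / \<bar>h\<bar> \<le> 2 * \<kappa>" by simp
      qed (use \<kappa> in simp)
      also have "\<dots> = \<kappa> * C" by (simp add: C_def algebra_simps)
      finally show ?thesis .
    qed
    then show ?thesis using \<delta>(1) \<kappa>(1)
      by (auto simp: eventually_at dist_real_def intro!: exI[of _ "min \<delta> \<kappa>"])
  qed
  have lim2: "(T \<longlongrightarrow> L) (at 0)"
  proof (rule tendstoI)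
    fix \<epsilon> :: real assume \<epsilon>: "\<epsilon> > 0"
    define \<kappa> where "\<kappa> = min (1/2) (\<epsilon> / (2 * (C + 1)))"
    have \<kappa>: "0 < \<kappa>" "\<kappa> < 1" using \<epsilon> C0 by (auto simp: \<kappa>_def)
    have "\<kappa> * C \<le> (\<epsilon> / (2 * (C + 1))) * C" using C0 by (intro mult_right_mono) (auto simp: \<kappa>_def)
    also have "\<dots> < \<epsilon>" using \<epsilon> C0 by (simp add: field_simps add_nonneg_pos)
    finally have "\<kappa> * C < \<epsilon>" .
    then show "eventually (\<lambda>h. dist (T h) L < \<epsilon>) (at 0)"
      using key[OF \<kappa>] by (auto simp: dist_real_def elim!: eventually_mono)
  qed
  have "(LINT x|lborel. - partial_deriv j \<Phi> x * (f x)\<^sup>2) = L"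
    using tendsto_unique[OF _ lim1 lim2] by simp
  then show ?thesis by (simp add: L_def mult.assoc)
qed

section \<open>A Hardy-type inequality\<close>

text \<open>Testing the product rule with the regularised radial field \<open>(y - x) / sqrt (|y - x|\<^sup>2 + \<delta>)\<close>,
  whose divergence is at least \<open>2 / sqrt (|y - x|\<^sup>2 + \<delta>)\<close>.\<close>

lemma radial_field_has_derivative:
  fixes x y :: R3
  assumes "\<delta> > 0"
  defines "r \<equiv> sqrt ((norm (y - x))\<^sup>2 + \<delta>)"
  shows "((\<lambda>y. (y - x) $ j / sqrt ((norm (y - x))\<^sup>2 + \<delta>)) has_derivative
    (\<lambda>h. h $ j / r - (y - x) $ j * ((y - x) \<bullet> h) / r ^ 3)) (at y)"
proof -
  have q: "(y - x) \<bullet> (y - x) + \<delta> > 0" using assms(1) by (simp add: add_nonneg_pos)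
  have r: "r > 0" "sqrt ((y - x) \<bullet> (y - x) + \<delta>) = r" "r * r = (y - x) \<bullet> (y - x) + \<delta>"
    using q by (auto simp: r_def power2_norm_eq_inner)
  have d1: "((\<lambda>y. (y - x) $ j) has_derivative (\<lambda>h. h $ j)) (at y)"
    by (auto intro!: derivative_eq_intros bounded_linear.has_derivative[OF bounded_linear_vec_nth])
  have d2: "((\<lambda>y. (y - x) \<bullet> (y - x) + \<delta>) has_derivative (\<lambda>h. 2 * ((y - x) \<bullet> h))) (at y)"
    by (auto intro!: derivative_eq_intros simp: inner_commute)
  have d3: "((\<lambda>y. inverse (sqrt ((y - x) \<bullet> (y - x) + \<delta>))) has_derivative
     (\<lambda>h. 2 * ((y - x) \<bullet> h) * (- (inverse r * (inverse r / 2) * inverse r)))) (at y)"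
  proof (rule has_derivative_compose[OF d2 has_field_derivative_imp_has_derivative, THEN has_derivative_eq_rhs])
    show "((\<lambda>t. inverse (sqrt t)) has_real_derivative (- (inverse r * (inverse r / 2) * inverse r)))
       (at ((y - x) \<bullet> (y - x) + \<delta>))"
      using q r(2) by (auto intro!: derivative_eq_intros)
  qed (simp add: mult.commute)
  have "((\<lambda>y. (y - x) $ j * inverse (sqrt ((y - x) \<bullet> (y - x) + \<delta>))) has_derivative
    (\<lambda>h. h $ j / r - (y - x) $ j * ((y - x) \<bullet> h) / r ^ 3)) (at y)"
    by (rule has_derivative_mult[OF d1 d3, THEN has_derivative_eq_rhs])
       (use r in \<open>simp add: field_simps power3_eq_cube\<close>)
  then show ?thesis by (simp add: divide_inverse power2_norm_eq_inner)
qed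

lemma sum_power2_component: "(\<Sum>j\<in>UNIV. (z $ j)\<^sup>2) = (norm (z :: R3))\<^sup>2"
  unfolding power2_norm_eq_inner inner_vec_def by (simp add: power2_eq_square)

lemma regularized_hardy:
  fixes f :: "R3 \<Rightarrow> real" and g :: "3 \<Rightarrow> R3 \<Rightarrow> real"
  assumes f: "square_integrable f" and g: "\<And>j. square_integrable (g j)" and wd: "\<And>j. weak_deriv j f (g j)"
    and \<eta>: "\<eta> > 0" and \<delta>: "\<delta> > 0"
  shows "integrable lborel (\<lambda>y. (f y)\<^sup>2 / sqrt ((norm (y - x))\<^sup>2 + \<delta>))" (is ?I)
    and "2 * (LINT y|lborel. (f y)\<^sup>2 / sqrt ((norm (y - x))\<^sup>2 + \<delta>))
      \<le> 3 * \<eta> * (LINT y|lborel. (f y)\<^sup>2) + (1 / \<eta>) * (\<Sum>j\<in>UNIV. LINT y|lborel. (g j y)\<^sup>2)" (is ?J)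
proof -
  define r where "r y = sqrt ((norm (y - x))\<^sup>2 + \<delta>)" for y
  define \<Phi> where "\<Phi> j y = (y - x) $ j / r y" for j y
  have r0: "r y > 0" for y using \<delta> by (simp add: r_def add_nonneg_pos)
  have r2: "(r y)\<^sup>2 = (norm (y - x))\<^sup>2 + \<delta>" for y using \<delta> by (simp add: r_def)
  have r\<delta>: "r y \<ge> sqrt \<delta>" for y by (simp add: r_def)
  have zr: "\<bar>(y - x) $ j\<bar> \<le> r y" for y j
  proof -
    have "\<bar>(y - x) $ j\<bar> \<le> norm (y - x)" by (rule component_le_norm_cart)
    also have "\<dots> \<le> r y" unfolding r_def using \<delta> by (simp add: real_le_rsqrt)
    finally show ?thesis .
  qed
  have D: "(\<Phi> j has_derivative (\<lambda>h. h $ j / r y - (y - x) $ j * ((y - x) \<bullet> h) / r y ^ 3)) (at y)" for j y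
    using radial_field_has_derivative[OF \<delta>, of x j y] by (simp add: \<Phi>_def[abs_def] r_def)
  have diff: "\<Phi> j differentiable_on UNIV" for j
    using D unfolding differentiable_on_def differentiable_def by blast
  have pd: "partial_deriv j (\<Phi> j) y = 1 / r y - ((y - x) $ j)\<^sup>2 / r y ^ 3" for j y
    using has_derivative_partial_deriv[OF D, of j j y]
    by (simp add: inner_axis power2_eq_square)
  \<comment> \<open>One bound for the field, which is at most 1, and for its derivative, which is at
    most 1 / sqrt \<delta>.\<close>
  define B where "B = 1 + 1 / sqrt \<delta>"
  have B1: "\<bar>\<Phi> j y\<bar> \<le> 1" for j y using zr[of y j] r0[of y] by (simp add: \<Phi>_def abs_divide)
  have B: "\<bar>\<Phi> j y\<bar> \<le> B" for j y using B1[of j y] \<delta> by (simp add: B_def add_increasing2)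
  have pdB: "\<bar>partial_deriv j (\<Phi> j) y\<bar> \<le> B" for j y
  proof -
    have "((y - x) $ j)\<^sup>2 \<le> (r y)\<^sup>2" using zr[of y j] r0[of y] by (simp flip: abs_le_square_iff)
    then have "((y - x) $ j)\<^sup>2 / r y ^ 3 \<le> (r y)\<^sup>2 / r y ^ 3" using r0[of y] by (intro divide_right_mono) auto
    also have "\<dots> = 1 / r y" using r0[of y] by (simp add: power2_eq_square power3_eq_cube)
    finally have "\<bar>partial_deriv j (\<Phi> j) y\<bar> \<le> 1 / r y" using r0[of y] unfolding pd
      by (simp add: abs_le_iff)
    also have "\<dots> \<le> 1 / sqrt \<delta>" using r\<delta>[of y] r0[of y] \<delta> by (intro divide_left_mono) auto
    finally show ?thesis by (simp add: B_def)
  qed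
  note [measurable] = square_integrable_measurable[OF f] square_integrable_measurable[OF g]
    borel_measurable_partial_deriv[OF diff]
  note sq = square_integrable_integrable
  have rm [measurable]: "r \<in> borel_measurable borel" unfolding r_def[abs_def] by measurable
  have "integrable lborel (\<lambda>y. (f y)\<^sup>2 / r y)"
  proof (rule Bochner_Integration.integrable_bound[where f="\<lambda>y. (1 / sqrt \<delta>) * (f y)\<^sup>2"])
    show "integrable lborel (\<lambda>y. (1 / sqrt \<delta>) * (f y)\<^sup>2)" using sq[OF f] by simp
    have "(f y)\<^sup>2 / r y \<le> (f y)\<^sup>2 / sqrt \<delta>" for y using r\<delta>[of y] \<delta> by (intro divide_left_mono) (auto simp: r0)
    then show "AE y in lborel. norm ((f y)\<^sup>2 / r y) \<le> norm ((1 / sqrt \<delta>) * (f y)\<^sup>2)"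
      using r0 \<delta> by (simp add: less_imp_le)
  qed measurable
  then show ?I by (simp add: r_def)
  have i1: "integrable lborel (\<lambda>y. partial_deriv j (\<Phi> j) y * (f y)\<^sup>2)" for j
  proof (rule Bochner_Integration.integrable_bound[where f="\<lambda>y. B * (f y)\<^sup>2"])
    show "integrable lborel (\<lambda>y. B * (f y)\<^sup>2)" using sq[OF f] by simp
    have "\<bar>partial_deriv j (\<Phi> j) y\<bar> * (f y)\<^sup>2 \<le> \<bar>B\<bar> * (f y)\<^sup>2" for y
      using pdB[of j y] by (intro mult_right_mono) auto
    then show "AE y in lborel. norm (partial_deriv j (\<Phi> j) y * (f y)\<^sup>2) \<le> norm (B * (f y)\<^sup>2)"
      by (simp add: abs_mult)
  qed measurable
  \<comment> \<open>Only the bound 1 on each component of the field is used, so f^2 is charged once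
    per coordinate; this is the origin of the 3 in front of \<eta>.\<close>
  have each: "(LINT y|lborel. partial_deriv j (\<Phi> j) y * (f y)\<^sup>2)
      \<le> \<eta> * (LINT y|lborel. (f y)\<^sup>2) + (1 / \<eta>) * (LINT y|lborel. (g j y)\<^sup>2)" for j
  proof -
    have "(LINT y|lborel. partial_deriv j (\<Phi> j) y * (f y)\<^sup>2) = - 2 * (LINT y|lborel. \<Phi> j y * f y * g j y)"
      by (rule integral_partial_deriv_square[OF f g wd diff B pdB])
    also have "\<dots> = (LINT y|lborel. - 2 * (\<Phi> j y * f y * g j y))" by simp
    also have "\<dots> \<le> (LINT y|lborel. \<eta> * (f y)\<^sup>2 + (1 / \<eta>) * (g j y)\<^sup>2)"
    proof (rule integral_mono')
      show "integrable lborel (\<lambda>y. \<eta> * (f y)\<^sup>2 + (1 / \<eta>) * (g j y)\<^sup>2)" using sq[OF f] sq[OF g] by simp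
      fix y
      have "- 2 * (\<Phi> j y * f y * g j y) \<le> \<bar>\<Phi> j y\<bar> * \<bar>2 * (sqrt \<eta> * f y) * (g j y / sqrt \<eta>)\<bar>"
        using \<eta> by (simp add: abs_mult[symmetric] mult_ac)
      also have "\<dots> \<le> 1 * ((sqrt \<eta> * f y)\<^sup>2 + (g j y / sqrt \<eta>)\<^sup>2)"
        by (intro mult_mono B1 two_mult_le_sum_squares) auto
      finally show "- 2 * (\<Phi> j y * f y * g j y) \<le> \<eta> * (f y)\<^sup>2 + (1 / \<eta>) * (g j y)\<^sup>2"
        using \<eta> by (simp add: power_mult_distrib power_divide)
    qed (use \<eta> in simp)
    also have "\<dots> = \<eta> * (LINT y|lborel. (f y)\<^sup>2) + (1 / \<eta>) * (LINT y|lborel. (g j y)\<^sup>2)"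
      using sq[OF f] sq[OF g] by simp
    finally show ?thesis .
  qed
  have "2 * (LINT y|lborel. (f y)\<^sup>2 / r y) = (LINT y|lborel. 2 * ((f y)\<^sup>2 / r y))"
    by (simp only: integral_mult_right_zero)
  also have "\<dots> \<le> (LINT y|lborel. (\<Sum>j\<in>UNIV. partial_deriv j (\<Phi> j) y * (f y)\<^sup>2))"
  proof (rule integral_mono)
    show "integrable lborel (\<lambda>y. 2 * ((f y)\<^sup>2 / r y))"
      by (rule integrable_mult_right) (use \<open>?I\<close> in \<open>simp add: r_def\<close>)
    show "integrable lborel (\<lambda>y. \<Sum>j\<in>UNIV. partial_deriv j (\<Phi> j) y * (f y)\<^sup>2)"
      using i1 by (rule Bochner_Integration.integrable_sum)
    fix y
    have "(\<Sum>j\<in>UNIV. partial_deriv j (\<Phi> j) y) = 3 / r y - (norm (y - x))\<^sup>2 / r y ^ 3"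
      by (simp add: pd sum_subtractf flip: sum_divide_distrib sum_power2_component)
    also have "(norm (y - x))\<^sup>2 / r y ^ 3 \<le> (r y)\<^sup>2 / r y ^ 3"
      using r0[of y] \<delta> by (intro divide_right_mono) (auto simp: r2)
    moreover have "(r y)\<^sup>2 / r y ^ 3 = 1 / r y" using r0[of y] by (simp add: power2_eq_square power3_eq_cube)
    ultimately have "2 / r y \<le> (\<Sum>j\<in>UNIV. partial_deriv j (\<Phi> j) y)" by (simp add: diff_divide_distrib)
    then have "2 / r y * (f y)\<^sup>2 \<le> (\<Sum>j\<in>UNIV. partial_deriv j (\<Phi> j) y) * (f y)\<^sup>2" by (rule mult_right_mono) simp
    then show "2 * ((f y)\<^sup>2 / r y) \<le> (\<Sum>j\<in>UNIV. partial_deriv j (\<Phi> j) y * (f y)\<^sup>2)"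
      by (simp add: sum_distrib_right)
  qed
  also have "\<dots> = (\<Sum>j\<in>UNIV. LINT y|lborel. partial_deriv j (\<Phi> j) y * (f y)\<^sup>2)"
    using i1 by (rule Bochner_Integration.integral_sum)
  also have "\<dots> \<le> (\<Sum>j\<in>UNIV. \<eta> * (LINT y|lborel. (f y)\<^sup>2) + (1 / \<eta>) * (LINT y|lborel. (g j y)\<^sup>2))"
    by (intro sum_mono each)
  also have "\<dots> = 3 * \<eta> * (LINT y|lborel. (f y)\<^sup>2) + (1 / \<eta>) * (\<Sum>j\<in>UNIV. LINT y|lborel. (g j y)\<^sup>2)"
    by (simp add: sum.distrib sum_distrib_left)
  finally show ?J by (simp add: r_def)
qed

text \<open>The regularised bound does not depend on \<delta>, so Fatou's lemma carries it to
  \<delta> = 0 and yields integrability at the same time.\<close>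

lemma hardy_real:
  fixes f :: "R3 \<Rightarrow> real" and g :: "3 \<Rightarrow> R3 \<Rightarrow> real"
  assumes f: "square_integrable f" and g: "\<And>j. square_integrable (g j)" and wd: "\<And>j. weak_deriv j f (g j)"
    and \<eta>: "\<eta> > 0"
  shows "integrable lborel (\<lambda>y. (f y)\<^sup>2 / norm (x - y))" (is ?I)
    and "2 * (LINT y|lborel. (f y)\<^sup>2 / norm (x - y))
      \<le> 3 * \<eta> * (LINT y|lborel. (f y)\<^sup>2) + (1 / \<eta>) * (\<Sum>j\<in>UNIV. LINT y|lborel. (g j y)\<^sup>2)" (is "2 * ?L \<le> ?R")
proof -
  note [measurable] = square_integrable_measurable[OF f]
  let ?\<delta> = "\<lambda>n. inverse (real (Suc n))"
  define F where "F n y = (f y)\<^sup>2 / sqrt ((norm (y - x))\<^sup>2 + ?\<delta> n)" for n y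
  have \<delta>: "?\<delta> n > 0" for n by simp
  have Fi: "integrable lborel (F n)" for n
    unfolding F_def[abs_def] by (rule regularized_hardy[OF f g wd \<eta> \<delta>])
  have Fb: "2 * integral\<^sup>L lborel (F n) \<le> ?R" for n
    unfolding F_def[abs_def] by (rule regularized_hardy[OF f g wd \<eta> \<delta>])
  have F0: "F n y \<ge> 0" for n y by (simp add: F_def)
  have lim: "(\<lambda>n. F n y) \<longlonglongrightarrow> (f y)\<^sup>2 / norm (x - y)" if "y \<noteq> x" for y
  proof -
    have "(\<lambda>n. (f y)\<^sup>2 / sqrt ((norm (y - x))\<^sup>2 + ?\<delta> n)) \<longlonglongrightarrow> (f y)\<^sup>2 / sqrt ((norm (y - x))\<^sup>2 + 0)"
      using that by (intro tendsto_intros LIMSEQ_inverse_real_of_nat) auto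
    then show ?thesis by (simp add: F_def norm_minus_commute)
  qed
  \<comment> \<open>At y = x division by zero gives 0, which need not be the limit; the point is a
    null set.\<close>
  have AE: "AE y in lborel. (\<lambda>n. ennreal (F n y)) \<longlonglongrightarrow> ennreal ((f y)\<^sup>2 / norm (x - y))"
    using AE_lborel_singleton[of x]
  proof eventually_elim
    case (elim y)
    then show ?case using lim[of y] by (intro tendsto_ennrealI) auto
  qed
  have "(\<integral>\<^sup>+y. ennreal ((f y)\<^sup>2 / norm (x - y)) \<partial>lborel) = (\<integral>\<^sup>+y. liminf (\<lambda>n. ennreal (F n y)) \<partial>lborel)"
    by (rule nn_integral_cong_AE)
       (use AE in \<open>eventually_elim, auto dest: lim_imp_Liminf[OF sequentially_bot]\<close>)
  also have "\<dots> \<le> liminf (\<lambda>n. \<integral>\<^sup>+y. ennreal (F n y) \<partial>lborel)"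
    by (rule nn_integral_liminf) (auto simp: F_def[abs_def])
  also have "\<dots> \<le> liminf (\<lambda>n::nat. ennreal (?R / 2))"
  proof (rule Liminf_mono, rule always_eventually, rule allI)
    fix n
    have "(\<integral>\<^sup>+y. ennreal (F n y) \<partial>lborel) = ennreal (integral\<^sup>L lborel (F n))"
      using F0 by (intro nn_integral_eq_integral Fi) auto
    also have "\<dots> \<le> ennreal (?R / 2)" using Fb[of n] by (intro ennreal_leI) simp
    finally show "(\<integral>\<^sup>+y. ennreal (F n y) \<partial>lborel) \<le> ennreal (?R / 2)" .
  qed
  also have "\<dots> = ennreal (?R / 2)" by (simp add: Liminf_const)
  finally have nn: "(\<integral>\<^sup>+y. ennreal ((f y)\<^sup>2 / norm (x - y)) \<partial>lborel) \<le> ennreal (?R / 2)" .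
  show I: ?I
  proof (rule integrableI_bounded)
    show "(\<lambda>y. (f y)\<^sup>2 / norm (x - y)) \<in> borel_measurable lborel" by measurable
    show "(\<integral>\<^sup>+y. ennreal (norm ((f y)\<^sup>2 / norm (x - y))) \<partial>lborel) < \<infinity>"
      using nn by (simp add: le_less_trans[OF _ ennreal_less_top])
  qed
  have "ennreal ?L \<le> ennreal (?R / 2)"
    using nn nn_integral_eq_integral[OF I] by simp
  moreover have "?R \<ge> 0" using \<eta> by (simp add: sum_nonneg)
  ultimately show "2 * ?L \<le> ?R" by (subst (asm) ennreal_le_iff) auto
qed

section \<open>The energy space\<close>

lemma square_integrable_normI:
  fixes f :: "R3 \<Rightarrow> 'a::euclidean_space" and g :: "R3 \<Rightarrow> 'b::euclidean_space"
  assumes f: "square_integrable f" and g[measurable]: "g \<in> borel_measurable borel"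
    and le: "\<And>x. norm (g x) \<le> norm (f x)"
  shows "square_integrable g"
proof -
  have [measurable]: "f \<in> borel_measurable borel" using f by (simp add: square_integrable_def)
  have "integrable lborel (\<lambda>x. (norm (g x))\<^sup>2)"
  proof (rule Bochner_Integration.integrable_bound)
    show "integrable lborel (\<lambda>x. (norm (f x))\<^sup>2)" using f by (simp add: square_integrable_def)
    show "AE x in lborel. norm ((norm (g x))\<^sup>2) \<le> norm ((norm (f x))\<^sup>2)"
      using le by (simp add: power_mono)
  qed measurable
  then show ?thesis by (simp add: square_integrable_def)
qed

lemma square_integrable_Re_Im:
  fixes v :: "R3 \<Rightarrow> complex"
  assumes v: "square_integrable v"
  shows "square_integrable (\<lambda>x. Re (v x))" "square_integrable (\<lambda>x. Im (v x))"
proof -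
  have [measurable]: "v \<in> borel_measurable borel" using v by (simp add: square_integrable_def)
  show "square_integrable (\<lambda>x. Re (v x))" "square_integrable (\<lambda>x. Im (v x))"
    by (rule square_integrable_normI[OF v]; simp add: abs_Re_le_cmod abs_Im_le_cmod)+
qed

lemma measurable_vec_nth_complex [measurable]:
  "g \<in> borel_measurable M \<Longrightarrow> (\<lambda>x. (g x :: complex ^ 3) $ j) \<in> borel_measurable M"
  by (rule borel_measurable_continuous_on[OF linear_continuous_on[OF bounded_linear_vec_nth]])

lemma square_integrable_vec_nth:
  fixes g :: "R3 \<Rightarrow> complex ^ 3"
  assumes g: "square_integrable g"
  shows "square_integrable (\<lambda>x. g x $ j)"
proof -
  have [measurable]: "g \<in> borel_measurable borel" using g by (simp add: square_integrable_def)
  have "cmod (g x $ j) \<le> norm (g x)" for x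
    unfolding norm_vec_def by (rule member_le_L2_set) auto
  then show ?thesis by (intro square_integrable_normI[OF g]) simp_all
qed

lemma power2_norm_complex3:
  "(norm (g :: complex ^ 3))\<^sup>2 = (\<Sum>j\<in>UNIV. (Re (g $ j))\<^sup>2) + (\<Sum>j\<in>UNIV. (Im (g $ j))\<^sup>2)"
  by (simp add: norm_vec_def L2_set_def sum_nonneg cmod_power2 sum.distrib)

lemma integrable_test_function_scaleR:
  fixes v :: "R3 \<Rightarrow> complex"
  assumes \<phi>: "test_function \<phi>" and v: "square_integrable v"
  shows "integrable lborel (\<lambda>x. \<phi> x *\<^sub>R v x)"
proof -
  note s\<phi> = square_integrable_test_function[OF \<phi>]
  have "integrable lborel (\<lambda>x. complex_of_real (\<phi> x * Re (v x)) + \<i> * complex_of_real (\<phi> x * Im (v x)))"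
    using square_integrable_mult[OF s\<phi> square_integrable_Re_Im(1)[OF v]]
      square_integrable_mult[OF s\<phi> square_integrable_Re_Im(2)[OF v]]
    by (intro Bochner_Integration.integrable_add integrable_mult_right integrable_of_real)
  moreover have "complex_of_real (\<phi> x * Re (v x)) + \<i> * complex_of_real (\<phi> x * Im (v x)) = \<phi> x *\<^sub>R v x" for x
    by (simp add: complex_eq_iff)
  ultimately show ?thesis by simp
qed

lemma weak_gradient_iff_weak_deriv:
  assumes v: "square_integrable v" and g: "square_integrable g"
  shows "weak_gradient v g \<longleftrightarrow> (\<forall>j. weak_deriv j (\<lambda>x. Re (v x)) (\<lambda>x. Re (g x $ j)) \<and>
     weak_deriv j (\<lambda>x. Im (v x)) (\<lambda>x. Im (g x $ j)))"
proof -
  have ReIm: "Re (LINT x|lborel. \<phi> x *\<^sub>R u x) = (LINT x|lborel. \<phi> x * Re (u x))"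
    "Im (LINT x|lborel. \<phi> x *\<^sub>R u x) = (LINT x|lborel. \<phi> x * Im (u x))"
    if "test_function \<phi>" "square_integrable u" for \<phi> and u :: "R3 \<Rightarrow> complex"
    using integral_bounded_linear[OF bounded_linear_Re integrable_test_function_scaleR[OF that]]
      integral_bounded_linear[OF bounded_linear_Im integrable_test_function_scaleR[OF that]] by simp_all
  show ?thesis
    unfolding weak_gradient_def weak_deriv_def complex_eq_iff uminus_complex.sel
    by (auto simp: ReIm v square_integrable_vec_nth[OF g] test_function_partial_deriv)
qed

text \<open>The difference is orthogonal to every test function, so
  \<open>norm_le_by_test_functions\<close> applies with C = 0.\<close>

lemma weak_deriv_unique:
  assumes g1: "square_integrable g1" and g2: "square_integrable g2"
    and wd: "weak_deriv j f g1" "weak_deriv j f g2"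
  shows "AE x in lborel. g1 x = g2 x"
proof -
  define D where "D x = g1 x - g2 x" for x
  have D: "square_integrable D" unfolding D_def using g1 g2 by (rule square_integrable_diff)
  have "(LINT x|lborel. (D x)\<^sup>2) \<le> 0"
  proof (rule norm_le_by_test_functions[OF D])
    fix \<phi> assume \<phi>: "test_function \<phi>"
    note s\<phi> = square_integrable_test_function[OF \<phi>]
    have "(LINT x|lborel. \<phi> x * g1 x) = (LINT x|lborel. \<phi> x * g2 x)"
      using wd \<phi> by (simp add: weak_deriv_def)
    then have "(LINT x|lborel. D x * \<phi> x) = 0"
      using square_integrable_mult[OF g1 s\<phi>] square_integrable_mult[OF g2 s\<phi>]
      by (simp add: D_def left_diff_distrib mult.commute[of "\<phi> _"])
    then show "2 * (LINT x|lborel. D x * \<phi> x) \<le> 0 + (LINT x|lborel. (\<phi> x)\<^sup>2)" by simp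
  qed
  moreover have "(LINT x|lborel. (D x)\<^sup>2) \<ge> 0" by simp
  ultimately have "AE x in lborel. (D x)\<^sup>2 = 0"
    using integral_nonneg_eq_0_iff_AE[OF square_integrable_integrable[OF D]] by simp
  then show ?thesis by eventually_elim (simp add: D_def)
qed

lemma H1_grad:
  assumes "v \<in> H1" shows "square_integrable v" "square_integrable (grad v)" "weak_gradient v (grad v)"
proof -
  have "\<exists>g. square_integrable g \<and> weak_gradient v g" using assms by (simp add: H1_def)
  then have "square_integrable (grad v) \<and> weak_gradient v (grad v)" unfolding grad_def by (rule someI_ex)
  then show "square_integrable (grad v)" "weak_gradient v (grad v)" by auto
  show "square_integrable v" using assms by (simp add: H1_def)
qed

text \<open>\<open>grad\<close> is picked by \<open>SOME\<close>, so its values cannot be computed.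
  Here any explicitly found weak gradient may replace it, as needed for rescaled functions and
  differences.\<close>

lemma H1_weak_gradient:
  assumes v: "square_integrable v" and g: "square_integrable g" and w: "weak_gradient v g"
  shows "v \<in> H1" "AE x in lborel. grad v x = g x" "grad_sq v = (LINT x|lborel. (norm (g x))\<^sup>2)"
proof -
  show H: "v \<in> H1" using assms by (auto simp: H1_def)
  note gr = H1_grad[OF H]
  have "AE x in lborel. Re (grad v x $ j) = Re (g x $ j)" "AE x in lborel. Im (grad v x $ j) = Im (g x $ j)" for j
    using w gr(3) unfolding weak_gradient_iff_weak_deriv[OF v g] weak_gradient_iff_weak_deriv[OF v gr(2)]
    by (auto intro!: weak_deriv_unique[where j=j, OF square_integrable_Re_Im(1) square_integrable_Re_Im(1)]
      weak_deriv_unique[where j=j, OF square_integrable_Re_Im(2) square_integrable_Re_Im(2)]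
      square_integrable_vec_nth g gr(2))
  then have "AE x in lborel. \<forall>j\<in>UNIV. Re (grad v x $ j) = Re (g x $ j) \<and> Im (grad v x $ j) = Im (g x $ j)"
    by (intro AE_finite_allI AE_conjI) auto
  then show AE: "AE x in lborel. grad v x = g x"
    by eventually_elim (simp add: vec_eq_iff complex_eq_iff)
  have [measurable]: "g \<in> borel_measurable borel" "grad v \<in> borel_measurable borel"
    using g gr(2) by (auto simp: square_integrable_def)
  show "grad_sq v = (LINT x|lborel. (norm (g x))\<^sup>2)"
    unfolding grad_sq_def by (rule integral_cong_AE) (use AE in auto)
qed

lemma X_H1: "v \<in> X \<Longrightarrow> v \<in> H1" by (simp add: X_def)

lemma X_measurable: "v \<in> X \<Longrightarrow> v \<in> borel_measurable borel"
  using H1_grad(1)[OF X_H1] by (simp add: square_integrable_def)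

lemma X_integrable:
  assumes "v \<in> X"
  shows "integrable lborel (\<lambda>x. (cmod (v x))\<^sup>2)" "integrable lborel (\<lambda>x. (norm (grad v x))\<^sup>2)"
    "integrable lborel (\<lambda>x. ((x $ 1)\<^sup>2 + (x $ 2)\<^sup>2) * (cmod (v x))\<^sup>2)"
  using H1_grad[OF X_H1[OF assms]] assms by (auto simp: square_integrable_def X_def)

text \<open>No integrability is required, since a nonintegrable integrand has integral 0.\<close>

lemma functionals_nonneg:
  "grad_sq v \<ge> 0" "mass v \<ge> 0" "trap v \<ge> 0" "coulomb v x \<ge> 0" "hartree v \<ge> 0" "Lnorm_pow q v \<ge> 0"
  by (auto simp: grad_sq_def mass_def trap_def coulomb_def hartree_def Lnorm_pow_def
      intro!: Bochner_Integration.integral_nonneg mult_nonneg_nonneg)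

lemma coulomb_measurable:
  assumes [measurable]: "v \<in> borel_measurable borel"
  shows "coulomb v \<in> borel_measurable borel"
  unfolding coulomb_def[abs_def] by measurable

section \<open>Behaviour under scaling\<close>

definition rescale :: "real \<Rightarrow> real \<Rightarrow> (R3 \<Rightarrow> complex) \<Rightarrow> R3 \<Rightarrow> complex" where
  "rescale k c v = (\<lambda>x. k *\<^sub>R v (c *\<^sub>R x))"

lemma square_integrable_rescale:
  fixes f :: "R3 \<Rightarrow> 'a::euclidean_space"
  assumes f: "square_integrable f" and c: "c > 0"
  shows "square_integrable (\<lambda>x. k *\<^sub>R f (c *\<^sub>R x))"
proof -
  have [measurable]: "f \<in> borel_measurable borel" using f by (simp add: square_integrable_def)
  have "integrable lborel (\<lambda>x. (norm (f (c *\<^sub>R x)))\<^sup>2)"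
    using integrable_affine_vec[of "\<lambda>x. (norm (f x))\<^sup>2" c 0] f c by (simp add: square_integrable_def)
  then show ?thesis by (simp add: square_integrable_def power_mult_distrib)
qed

lemma weak_gradient_rescale:
  assumes v: "square_integrable v" and g: "square_integrable g" and w: "weak_gradient v g" and c: "c > 0"
  shows "weak_gradient (rescale k c v) (\<lambda>x. (k * c) *\<^sub>R g (c *\<^sub>R x))"
  unfolding weak_gradient_def
proof (intro allI impI)
  fix \<phi> j assume \<phi>: "test_function \<phi>"
  have [measurable]: "v \<in> borel_measurable borel" "g \<in> borel_measurable borel"
    using v g by (auto simp: square_integrable_def)
  \<comment> \<open>Dilated inversely, so that the substitution y = c x restores \<phi>.\<close>
  define \<psi> where "\<psi> y = \<phi> ((1/c) *\<^sub>R y + 0)" for y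
  have \<psi>: "test_function \<psi>" unfolding \<psi>_def[abs_def] using \<phi> c by (intro test_function_affine) auto
  have pd: "partial_deriv j \<psi> = (\<lambda>y. (1/c) * partial_deriv j \<phi> ((1/c) *\<^sub>R y + 0))"
    unfolding \<psi>_def[abs_def] by (rule partial_deriv_affine[OF test_function_differentiable[OF \<phi>]])
  note [measurable] = test_function_measurable[OF \<psi>] test_function_measurable[OF test_function_partial_deriv[OF \<psi>]]
  have m: "(\<lambda>y. partial_deriv j \<psi> y *\<^sub>R v y) \<in> borel_measurable borel"
    "(\<lambda>y. \<psi> y *\<^sub>R (g y $ j)) \<in> borel_measurable borel" by measurable
  have e1: "(LINT y|lborel. partial_deriv j \<psi> y *\<^sub>R v y) = c ^ 3 *\<^sub>R (LINT x|lborel. (1/c) *\<^sub>R (partial_deriv j \<phi> x *\<^sub>R v (c *\<^sub>R x)))"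
    using integral_affine_vec[OF m(1), of c 0] c by (simp add: pd)
  have e2: "(LINT y|lborel. \<psi> y *\<^sub>R (g y $ j)) = c ^ 3 *\<^sub>R (LINT x|lborel. \<phi> x *\<^sub>R (g (c *\<^sub>R x) $ j))"
    using integral_affine_vec[OF m(2), of c 0] c by (simp add: \<psi>_def)
  have "c ^ 3 *\<^sub>R ((1/c) *\<^sub>R (LINT x|lborel. partial_deriv j \<phi> x *\<^sub>R v (c *\<^sub>R x)))
      = c ^ 3 *\<^sub>R (- (LINT x|lborel. \<phi> x *\<^sub>R (g (c *\<^sub>R x) $ j)))"
    using w[unfolded weak_gradient_def, rule_format, OF \<psi>, of j]
    unfolding e1 e2 integral_scaleR_right scaleR_minus_right .
  then have e3: "(1/c) *\<^sub>R (LINT x|lborel. partial_deriv j \<phi> x *\<^sub>R v (c *\<^sub>R x))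
      = - (LINT x|lborel. \<phi> x *\<^sub>R (g (c *\<^sub>R x) $ j))"
    using c by (simp only: scaleR_cancel_left) auto
  have "(LINT x|lborel. partial_deriv j \<phi> x *\<^sub>R rescale k c v x)
      = (LINT x|lborel. k *\<^sub>R (partial_deriv j \<phi> x *\<^sub>R v (c *\<^sub>R x)))"
    by (simp add: rescale_def mult.commute)
  also have "\<dots> = k *\<^sub>R (LINT x|lborel. partial_deriv j \<phi> x *\<^sub>R v (c *\<^sub>R x))"
    by (rule integral_scaleR_right)
  also have "\<dots> = (k * c) *\<^sub>R ((1/c) *\<^sub>R (LINT x|lborel. partial_deriv j \<phi> x *\<^sub>R v (c *\<^sub>R x)))"
    using c by simp
  also have "\<dots> = - ((k * c) *\<^sub>R (LINT x|lborel. \<phi> x *\<^sub>R (g (c *\<^sub>R x) $ j)))" unfolding e3 by simp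
  also have "\<dots> = - (LINT x|lborel. (k * c) *\<^sub>R (\<phi> x *\<^sub>R (g (c *\<^sub>R x) $ j)))"
    by (simp only: integral_scaleR_right)
  also have "\<dots> = - (LINT x|lborel. \<phi> x *\<^sub>R (((k * c) *\<^sub>R g (c *\<^sub>R x)) $ j))"
    by (simp add: mult_ac)
  finally show "(LINT x|lborel. partial_deriv j \<phi> x *\<^sub>R rescale k c v x)
      = - (LINT x|lborel. \<phi> x *\<^sub>R (((k * c) *\<^sub>R g (c *\<^sub>R x)) $ j))" .
qed

text \<open>Each integration gives c^(-3). The squared gradient adds c^2 and the trap weight c^(-2);
  the Coulomb kernel gives c, so the potential scales as c^(-2) and the Hartree term as
  c^(-5).\<close>

lemma
  assumes v: "v \<in> X" and c: "c > 0" and k: "k > 0"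
  shows rescale_in_X: "rescale k c v \<in> X"
    and grad_sq_rescale: "grad_sq (rescale k c v) = k\<^sup>2 / c * grad_sq v"
    and mass_rescale: "mass (rescale k c v) = k\<^sup>2 / c ^ 3 * mass v"
    and trap_rescale: "trap (rescale k c v) = k\<^sup>2 / c ^ 5 * trap v"
    and hartree_rescale: "hartree (rescale k c v) = k ^ 4 / c ^ 5 * hartree v"
    and Lnorm_pow_rescale: "Lnorm_pow q (rescale k c v) = k powr q / c ^ 3 * Lnorm_pow q v"
proof -
  have [measurable]: "v \<in> borel_measurable borel" by (rule X_measurable[OF v])
  note H = H1_grad[OF X_H1[OF v]]
  have [measurable]: "grad v \<in> borel_measurable borel" using H(2) by (simp add: square_integrable_def)
  have [measurable]: "coulomb v \<in> borel_measurable borel" by (rule coulomb_measurable) simp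
  have sub: "(LINT x|lborel. F (c *\<^sub>R x)) = (1 / c ^ 3) * integral\<^sup>L lborel F"
    if "F \<in> borel_measurable borel" for F :: "R3 \<Rightarrow> real"
    using integral_affine_vec[OF that, of c 0] c by simp
  have sr: "square_integrable (rescale k c v)"
    unfolding rescale_def by (rule square_integrable_rescale[OF H(1) c])
  note wg = H1_weak_gradient[OF sr square_integrable_rescale[OF H(2) c] weak_gradient_rescale[OF H c]]
  have "integrable lborel (\<lambda>x. ((c * x $ 1)\<^sup>2 + (c * x $ 2)\<^sup>2) * (cmod (v (c *\<^sub>R x)))\<^sup>2)"
    using integrable_affine_vec[of "\<lambda>x. ((x $ 1)\<^sup>2 + (x $ 2)\<^sup>2) * (cmod (v x))\<^sup>2" c 0] X_integrable(3)[OF v] c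
    by simp
  then have "integrable lborel (\<lambda>x. (k\<^sup>2 / c\<^sup>2) * (((c * x $ 1)\<^sup>2 + (c * x $ 2)\<^sup>2) * (cmod (v (c *\<^sub>R x)))\<^sup>2))"
    by (rule integrable_mult_right)
  also have "(\<lambda>x. (k\<^sup>2 / c\<^sup>2) * (((c * x $ 1)\<^sup>2 + (c * x $ 2)\<^sup>2) * (cmod (v (c *\<^sub>R x)))\<^sup>2))
     = (\<lambda>x. ((x $ 1)\<^sup>2 + (x $ 2)\<^sup>2) * (cmod (rescale k c v x))\<^sup>2)"
    using c by (intro ext) (simp add: rescale_def power_mult_distrib field_simps)
  finally show "rescale k c v \<in> X" using wg(1) by (simp add: X_def)
  have "grad_sq (rescale k c v) = (LINT x|lborel. (k * c)\<^sup>2 * (norm (grad v (c *\<^sub>R x)))\<^sup>2)"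
    unfolding wg(3) by (simp add: power_mult_distrib)
  also have "\<dots> = (k * c)\<^sup>2 * ((1 / c ^ 3) * grad_sq v)"
    using sub[of "\<lambda>x. (norm (grad v x))\<^sup>2"] by (simp add: grad_sq_def)
  finally show "grad_sq (rescale k c v) = k\<^sup>2 / c * grad_sq v"
    using c by (simp add: power2_eq_square power3_eq_cube)
  have "mass (rescale k c v) = (LINT x|lborel. k\<^sup>2 * (cmod (v (c *\<^sub>R x)))\<^sup>2)"
    unfolding mass_def rescale_def by (simp add: power_mult_distrib)
  also have "\<dots> = k\<^sup>2 * ((1 / c ^ 3) * mass v)" using sub[of "\<lambda>x. (cmod (v x))\<^sup>2"] by (simp add: mass_def)
  finally show "mass (rescale k c v) = k\<^sup>2 / c ^ 3 * mass v" by simp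
  have "trap (rescale k c v) = (LINT x|lborel. (k\<^sup>2 / c\<^sup>2) * (((c * x $ 1)\<^sup>2 + (c * x $ 2)\<^sup>2) * (cmod (v (c *\<^sub>R x)))\<^sup>2))"
    unfolding trap_def rescale_def using c
    by (intro Bochner_Integration.integral_cong refl) (simp add: power_mult_distrib field_simps)
  also have "\<dots> = (k\<^sup>2 / c\<^sup>2) * ((1 / c ^ 3) * trap v)"
    using sub[of "\<lambda>x. ((x $ 1)\<^sup>2 + (x $ 2)\<^sup>2) * (cmod (v x))\<^sup>2"] by (simp only: integral_mult_right_zero) (simp add: trap_def)
  also have "\<dots> = k\<^sup>2 / c ^ 5 * trap v"
    using c by (simp add: power2_eq_square power3_eq_cube eval_nat_numeral)
  finally show "trap (rescale k c v) = k\<^sup>2 / c ^ 5 * trap v" .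
  have coul: "coulomb (rescale k c v) x = (k\<^sup>2 / c\<^sup>2) * coulomb v (c *\<^sub>R x)" for x
  proof -
    have n: "norm (c *\<^sub>R x - c *\<^sub>R y) = c * norm (x - y)" for y
      using c by (simp flip: scaleR_diff_right)
    have "coulomb (rescale k c v) x = (LINT y|lborel. (k\<^sup>2 * c) * ((cmod (v (c *\<^sub>R y)))\<^sup>2 / norm (c *\<^sub>R x - c *\<^sub>R y)))"
      unfolding coulomb_def rescale_def n using c
      by (intro Bochner_Integration.integral_cong refl) (simp add: power_mult_distrib)
    also have "\<dots> = (k\<^sup>2 * c) * ((1 / c ^ 3) * coulomb v (c *\<^sub>R x))"
      using sub[of "\<lambda>y. (cmod (v y))\<^sup>2 / norm (c *\<^sub>R x - y)"] by (simp only: integral_mult_right_zero) (simp add: coulomb_def)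
    finally show ?thesis using c by (simp add: power2_eq_square power3_eq_cube)
  qed
  have "hartree (rescale k c v) = (LINT x|lborel. (k ^ 4 / c\<^sup>2) * (coulomb v (c *\<^sub>R x) * (cmod (v (c *\<^sub>R x)))\<^sup>2))"
    unfolding hartree_def coul
    by (intro Bochner_Integration.integral_cong refl)
       (simp add: rescale_def power_mult_distrib eval_nat_numeral)
  also have "\<dots> = (k ^ 4 / c\<^sup>2) * ((1 / c ^ 3) * hartree v)"
    using sub[of "\<lambda>x. coulomb v x * (cmod (v x))\<^sup>2"] by (simp only: integral_mult_right_zero) (simp add: hartree_def)
  also have "\<dots> = k ^ 4 / c ^ 5 * hartree v"
    using c by (simp add: power2_eq_square power3_eq_cube eval_nat_numeral)
  finally show "hartree (rescale k c v) = k ^ 4 / c ^ 5 * hartree v" .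
  have "Lnorm_pow q (rescale k c v) = (LINT x|lborel. k powr q * cmod (v (c *\<^sub>R x)) powr q)"
    unfolding Lnorm_pow_def rescale_def using k by (simp add: powr_mult)
  also have "\<dots> = k powr q * ((1 / c ^ 3) * Lnorm_pow q v)"
    using sub[of "\<lambda>x. cmod (v x) powr q"] by (simp add: Lnorm_pow_def)
  finally show "Lnorm_pow q (rescale k c v) = k powr q / c ^ 3 * Lnorm_pow q v" by simp
qed

section \<open>The two-parameter scaling family\<close>

text \<open>
  The exponents are those of \<open>\<nabla>\<close>, mass, trap, Hartree and \<open>L\<^bsup>p+2\<^esup>\<close> terms under \<open>v \<mapsto> k v(cx)\<close> with
  \<open>k = exp (z/2 + 3y)\<close> and \<open>c = exp y\<close>; the parameters absorb \<open>\<omega>\<close>, \<open>b\<^sup>2\<close>, \<open>l2\<close> and \<open>l3/(p+2)\<close>.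
\<close>

locale scaling_profile =
  fixes a m \<tau> h n p :: real
  assumes a: "a > 0" and m: "m > 0" and \<tau>: "\<tau> \<ge> 0" and h: "h \<ge> 0" and n: "n > 0"
    and p: "4/3 \<le> p" "p < 4"
begin

definition tA where "tA z y = a * exp (z + 5 * y)"
definition tM where "tM z y = m * exp (z + 3 * y)"
definition tT where "tT z y = \<tau> * exp (z + y)"
definition tH where "tH z y = h * exp (2 * z + 7 * y)"
definition tP where "tP z y = n * exp ((p/2 + 1) * z + (3 * p + 3) * y)"

lemmas t_defs = tA_def tM_def tT_def tH_def tP_def

definition fS where "fS z y = 1/2 * tA z y + 1/2 * tM z y + 1/2 * tT z y + 1/4 * tH z y - tP z y"
definition fK where "fK z y = 5/2 * tA z y + 3/2 * tM z y + 1/2 * tT z y + 7/4 * tH z y - (3*p+3) * tP z y"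
definition fQ where "fQ z y = tA z y - tT z y + 1/4 * tH z y - 3*p/2 * tP z y"
text \<open>The combination that eliminates \<open>tP\<close>. All remaining coefficients are
  nonnegative for p >= 4/3, so it is coercive where \<open>fS\<close> is not visibly so, and it
  equals \<open>fS\<close> on \<open>fK = 0\<close>.\<close>

definition fJ where "fJ z y = fS z y - fK z y / (3*p+3)"

lemma t_pos: "tA z y > 0" "tM z y > 0" "tT z y \<ge> 0" "tH z y \<ge> 0" "tP z y > 0"
  using a m \<tau> h n by (auto simp: t_defs)

lemma fJ_eq: "fJ z y = (3*p-2)/(2*(3*p+3)) * tA z y + 3*p/(2*(3*p+3)) * tM z y
    + (3*p+2)/(2*(3*p+3)) * tT z y + (3*p-4)/(4*(3*p+3)) * tH z y"
proof -
  have "3*p+3 \<noteq> 0" using p by simp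
  then show ?thesis unfolding fJ_def fS_def fK_def by (simp add: divide_simps) (simp add: algebra_simps)
qed

lemma fJ_ge: "(3*p-2)/(2*(3*p+3)) * tA z y \<le> fJ z y"
  unfolding fJ_eq using t_pos[of z y] p by (simp add: add_nonneg_nonneg)

text \<open>Two directions will matter: u = 0, k = -1 lowers y alone, and u = 1 lowers z while k
  corrects y.\<close>

lemma deriv_line:
  shows "((\<lambda>t. fS (z - u * t) (y + k * t)) has_real_derivative
      (- u * ((fK z y - fQ z y) / 3) + k * fK z y)) (at 0)" (is ?S)
   and "((\<lambda>t. fK (z - u * t) (y + k * t)) has_real_derivative
      (- u * (5/2 * tA z y + 3/2 * tM z y + 1/2 * tT z y + 7/2 * tH z y - (p/2+1) * (3*p+3) * tP z y)
       + k * (25/2 * tA z y + 9/2 * tM z y + 1/2 * tT z y + 49/4 * tH z y - (3*p+3)^2 * tP z y))) (at 0)" (is ?K)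
proof -
  show ?S unfolding fS_def fK_def fQ_def t_defs
    by (auto intro!: derivative_eq_intros) (simp add: field_simps)
  show ?K unfolding fS_def fK_def fQ_def t_defs
    by (auto intro!: derivative_eq_intros) (simp add: field_simps power2_eq_square)
qed

text \<open>The threshold p = 4/3 is exactly where 3p+3 reaches 7, the exponent of the Hartree
  term.\<close>

lemma tP_ge_7: assumes "d \<ge> 0" shows "tP z y * exp (7 * d) \<le> tP z (y + d)"
proof -
  have "7 * d \<le> (3*p+3) * d" using assms p by (intro mult_right_mono) auto
  then show ?thesis using n unfolding tP_def
    by (simp add: exp_add[symmetric] algebra_simps)
qed

lemma t_shift: "tA z (y+d) = tA z y * exp (5*d)" "tM z (y+d) = tM z y * exp (3*d)"
  "tT z (y+d) = tT z y * exp d" "tH z (y+d) = tH z y * exp (7*d)"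
  unfolding t_defs by (simp_all add: exp_add[symmetric] algebra_simps)

text \<open>As y grows, the single negative term gains at least the factor exp (7d), the positive
  ones at most that; the gradient term gains only exp (5d), which makes the inequality
  strict.\<close>

lemma fK_shift_neg:
  assumes "fK z y \<le> 0" "d > 0" shows "fK z (y + d) < 0"
proof -
  have "fK z (y+d) \<le> 5/2 * tA z y * exp (5*d) + 3/2 * tM z y * exp (3*d) + 1/2 * tT z y * exp d
     + 7/4 * tH z y * exp (7*d) - (3*p+3) * (tP z y * exp (7*d))"
    unfolding fK_def t_shift
    using mult_left_mono[OF tP_ge_7[of d z y], of "3*p+3"] assms p by linarith
  also have "\<dots> < (5/2 * tA z y + 3/2 * tM z y + 1/2 * tT z y + 7/4 * tH z y - (3*p+3) * tP z y) * exp (7*d)"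
  proof -
    have "tA z y * exp (5*d) < tA z y * exp (7*d)" "tM z y * exp (3*d) \<le> tM z y * exp (7*d)"
      "tT z y * exp d \<le> tT z y * exp (7*d)" using t_pos[of z y] assms
      by (auto intro!: mult_left_mono)
    then show ?thesis by (simp add: algebra_simps)
  qed
  also have "\<dots> \<le> 0" using assms(1) unfolding fK_def by (simp add: mult_nonpos_nonneg)
  finally show ?thesis .
qed

lemma fS_y_deriv: "((\<lambda>y. fS z y) has_real_derivative fK z y) (at y)"
  unfolding fS_def fK_def t_defs
  by (auto intro!: derivative_eq_intros)

lemma fS_shift_le:
  assumes "fK z y \<le> 0" "d \<ge> 0" shows "fS z (y + d) \<le> fS z y"
proof (rule DERIV_nonpos_imp_nonincreasing[where f="\<lambda>y. fS z y"])
  fix x assume x: "y \<le> x" "x \<le> y + d"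
  have "fK z x \<le> 0" using fK_shift_neg[of z y "x - y"] x assms by (cases "x = y") auto
  then show "\<exists>D. ((\<lambda>y. fS z y) has_real_derivative D) (at x) \<and> D \<le> 0" using fS_y_deriv by blast
qed (use assms in auto)

text \<open>The equation \<open>fK = 0\<close> bounds the nonlinear term of \<open>fQ\<close> below
  by 5/7 \<open>tA\<close> + 1/2 \<open>tH\<close>. A unit shift multiplies this bound by exp 7 and
  \<open>tA\<close> by exp 5 only, and exp 2 > 7/5 closes the gap.\<close>

lemma fQ_shift_neg:
  assumes "fK z y = 0" shows "fQ z (y + 1) < 0"
proof -
  have e: "exp (2::real) > 7/5" using exp_ge_add_one_self[of 2] by linarith
  have e7: "exp (7::real) = exp 5 * exp 2" by (simp add: exp_add[symmetric])
  \<comment> \<open>The factor 2/7 compares the nonlinear coefficients of \<open>fK\<close> and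
    \<open>fQ\<close>; equality holds at p = 4/3.\<close>
  have q: "(2/7) * ((3*p+3) * tP z y) \<le> 3*p/2 * tP z y"
  proof -
    have "(2/7) * (3*p+3) \<le> 3*p/2" using p by simp
    from mult_right_mono[OF this, of "tP z y"] t_pos[of z y] show ?thesis by (simp add: algebra_simps)
  qed
  have k: "(3*p+3) * tP z y = 5/2 * tA z y + 3/2 * tM z y + 1/2 * tT z y + 7/4 * tH z y"
    using assms unfolding fK_def by simp
  have "3*p/2 * tP z y \<ge> 5/7 * tA z y + 1/2 * tH z y" using q k t_pos[of z y] by linarith
  then have "(5/7 * tA z y + 1/2 * tH z y) * exp 7 \<le> 3*p/2 * tP z y * exp 7" by simp
  also have "\<dots> \<le> 3*p/2 * tP z (y+1)" using tP_ge_7[of 1 z y] p by (simp add: mult.assoc mult_left_mono)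
  finally have 1: "(5/7 * tA z y + 1/2 * tH z y) * exp 7 \<le> 3*p/2 * tP z (y+1)" .
  have "7/5 * (tA z y * exp 5) < tA z y * exp 7"
    using e t_pos[of z y] unfolding e7 by (simp add: algebra_simps)
  moreover have "tH z y * exp 7 \<ge> 0" "tT z y * exp 1 \<ge> 0" using t_pos[of z y] by auto
  ultimately show ?thesis using 1 unfolding fQ_def t_shift
    by (simp add: algebra_simps)
qed

lemma continuous_f [continuous_intros]:
  "continuous_on A (\<lambda>x. fS (f x) (g x))" "continuous_on A (\<lambda>x. fK (f x) (g x))"
  "continuous_on A (\<lambda>x. fQ (f x) (g x))" "continuous_on A (\<lambda>x. fJ (f x) (g x))"
  if "continuous_on A f" "continuous_on A g"
  unfolding fS_def fK_def fQ_def fJ_def t_defs using p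
  by (auto intro!: continuous_intros that)

text \<open>Otherwise \<open>fQ\<close> changes sign on the unit segment above the point, and at its
  zero \<open>fK < 0\<close> while \<open>fS\<close> has not increased, against the hypothesis on
  c.\<close>

lemma fQ_nonpos:
  assumes c: "\<And>z y. fK z y < 0 \<Longrightarrow> fQ z y = 0 \<Longrightarrow> c \<le> fS z y"
    and k: "fK z y = 0" and s: "fS z y < c"
  shows "fQ z y \<le> 0"
proof (rule ccontr)
  assume pos: "\<not> fQ z y \<le> 0"
  have "continuous_on {y..y+1} (\<lambda>x. fQ z x)" by (intro continuous_intros)
  then obtain x where x: "y \<le> x" "x \<le> y + 1" "fQ z x = 0"
    using IVT2'[of "\<lambda>x. fQ z x" "y+1" 0 y] pos fQ_shift_neg[OF k] by auto
  then have "x > y" using pos by (cases "x = y") auto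
  then have "fK z x < 0" "fS z x \<le> fS z y"
    using fK_shift_neg[of z y "x - y"] fS_shift_le[of z y "x - y"] k by auto
  then show False using c[of z x] x s by simp
qed

section \<open>A priori bounds for y where \<open>fK <= 0\<close> or \<open>fJ < c\<close>\<close>

lemma exp_ge_imp_ge_ln: "0 < r \<Longrightarrow> r \<le> exp (x::real) \<Longrightarrow> ln r \<le> x"
  by (metis exp_gt_zero ln_exp ln_le_cancel_iff)

text \<open>Mass against nonlinearity. For z <= 0 the excess factor exp (p z/2) is at most 1, so the
  bound is uniform in z and supplies the lower edge of a compact set.\<close>

lemma fK_nonpos_lower_y:
  assumes "fK z y \<le> 0" "z \<le> 0" shows "ln (m / (2 * (p+1) * n)) / (3*p) \<le> y"
proof -
  define E F where "E = exp (z + 3*y)" and "F = exp (3*p*y)"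
  have "3/2 * tM z y \<le> (3*p+3) * tP z y" using assms(1) t_pos[of z y] unfolding fK_def by linarith
  also have "tP z y \<le> n * (E * F)"
    unfolding tP_def E_def F_def exp_add[symmetric] using n assms(2) p
    by (auto simp: algebra_simps mult_nonneg_nonpos)
  finally have "3/2 * (m * E) \<le> (3*p+3) * (n * (E * F))"
    using p by (simp add: tM_def E_def mult_left_mono)
  then have "E * (3/2 * m) \<le> E * ((3*p+3) * (n * F))" by (simp only: mult_ac)
  then have "3/2 * m \<le> (3*p+3) * (n * F)" unfolding E_def by (rule mult_left_le_imp_le) simp
  then have "m \<le> (2*(p+1)*n) * F" by (simp add: algebra_simps)
  then have "m / (2*(p+1)*n) \<le> F" using n p by (subst pos_divide_le_eq) (simp_all add: mult_ac)
  then have "ln (m / (2*(p+1)*n)) \<le> 3*p*y" using m n p unfolding F_def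
    by (intro exp_ge_imp_ge_ln) auto
  then show ?thesis using p by (simp add: field_simps)
qed

text \<open>Gradient against nonlinearity. Unlike the previous bound, this one drives y to infinity
  as z tends to minus infinity.\<close>

lemma fK_nonpos_lower_y':
  assumes "fK z y \<le> 0"
  shows "(ln (5/2 * a / ((3*p+3) * n)) - p * z / 2) / (3*p-2) \<le> y"
proof -
  define E F where "E = exp (z + 5*y)" and "F = exp (p*z/2 + (3*p-2)*y)"
  have "5/2 * tA z y \<le> (3*p+3) * tP z y" using assms(1) t_pos[of z y] unfolding fK_def by linarith
  also have "tP z y = n * (E * F)"
    unfolding tP_def E_def F_def exp_add[symmetric] by (simp add: algebra_simps)
  finally have "E * (5/2 * a) \<le> E * ((3*p+3) * (n * F))"
    by (simp only: mult_ac E_def tA_def)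
  then have "5/2 * a \<le> (3*p+3) * (n * F)" unfolding E_def by (rule mult_left_le_imp_le) simp
  then have "5/2 * a / ((3*p+3)*n) \<le> F" using n p by (subst pos_divide_le_eq) (simp_all add: mult_ac)
  then have "ln (5/2 * a / ((3*p+3)*n)) \<le> p*z/2 + (3*p-2)*y" using a n p unfolding F_def
    by (intro exp_ge_imp_ge_ln) auto
  then show ?thesis using p by (simp add: field_simps)
qed

text \<open>The gradient part of \<open>fJ\<close> alone controls z + 5y; |c| + 1 replaces c to keep
  the logarithm's argument positive.\<close>

lemma fJ_lt_upper_y:
  assumes "fJ z y < c"
  shows "5 * y < ln ((\<bar>c\<bar> + 1) / ((3*p-2)/(2*(3*p+3)) * a)) - z"
proof -
  define j where "j = (3*p-2)/(2*(3*p+3)) * a"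
  have j: "j > 0" using a p by (simp add: j_def)
  have "j * exp (z + 5*y) \<le> fJ z y" using fJ_ge[of z y] by (simp add: j_def tA_def mult.assoc)
  then have "j * exp (z + 5*y) < \<bar>c\<bar> + 1" using assms by linarith
  then have "exp (z + 5*y) < (\<bar>c\<bar> + 1) / j" using j by (simp add: field_simps)
  then have "z + 5*y < ln ((\<bar>c\<bar> + 1) / j)"
    by (metis exp_gt_zero exp_less_cancel_iff exp_ln order.strict_trans)
  then show ?thesis unfolding j_def by simp
qed

text \<open>At z = -Z the lower bound for y grows with slope p / (2(3p-2)) in Z, the upper bound
  from \<open>fJ < c\<close> only with slope 1/5. The former is larger because p < 4, so the two
  exclude each other for large Z.\<close>

lemma fJ_large:
  obtains Z where "Z > 0" "\<And>y. fK (-Z) y \<le> 0 \<Longrightarrow> fJ (-Z) y \<ge> c"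
proof -
  define L where "L = ln (5/2 * a / ((3*p+3) * n))"
  define U where "U = ln ((\<bar>c\<bar> + 1) / ((3*p-2)/(2*(3*p+3)) * a))"
  define D where "D = 3*p-2"
  have D: "D > 0" using p by (simp add: D_def)
  \<comment> \<open>The value at which the two bounds cross; the maximum with 1 ensures
    positivity.\<close>
  define Z where "Z = max 1 ((U - 5 * L / D) * (2 * D / (4-p)))"
  show ?thesis
  proof (rule that[of Z])
    show "Z > 0" by (simp add: Z_def)
    fix y assume "fK (-Z) y \<le> 0"
    from fK_nonpos_lower_y'[OF this] have y: "(L + p*Z/2) / D \<le> y" by (simp add: L_def D_def)
    show "fJ (-Z) y \<ge> c"
    proof (rule ccontr)
      assume "\<not> fJ (-Z) y \<ge> c"
      then have "5 * y < U + Z" using fJ_lt_upper_y[of "-Z" y c] by (simp add: U_def)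
      then have 1: "5 * ((L + p*Z/2) / D) < U + Z" using y by linarith
      have "(U - 5 * L / D) * (2 * D / (4-p)) \<le> Z" by (simp add: Z_def)
      then have "U - 5 * L / D \<le> Z * ((4-p) / (2*D))" using D p by (simp add: field_simps)
      also have "(4-p) / (2*D) = 5*p/(2*D) - 1" using D by (simp add: field_simps) (simp add: D_def)
      finally have "U - 5 * L / D \<le> Z * (5*p/(2*D)) - Z" by (simp add: right_diff_distrib)
      moreover have "5 * ((L + p*Z/2) / D) = 5 * L / D + Z * (5*p/(2*D))" using D by (simp add: field_simps)
      ultimately show False using 1 by linarith
    qed
  qed
qed

text \<open>Replacing one factor 3p+3 by 7 and inserting \<open>fK = 0\<close>, the Hartree terms
  cancel and at least 5 \<open>tA\<close> remains with a minus sign. Hence \<open>fK = 0\<close> can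
  be followed by solving for the change in y.\<close>

lemma fK_y_deriv_neg:
  assumes "fK z y = 0"
  shows "25/2 * tA z y + 9/2 * tM z y + 1/2 * tT z y + 49/4 * tH z y - (3*p+3)^2 * tP z y < 0"
proof -
  have k: "(3*p+3) * tP z y = 5/2 * tA z y + 3/2 * tM z y + 1/2 * tT z y + 7/4 * tH z y"
    using assms unfolding fK_def by simp
  have "7 * ((3*p+3) * tP z y) \<le> (3*p+3) * ((3*p+3) * tP z y)"
    using p t_pos[of z y] by (intro mult_right_mono) auto
  then show ?thesis using k t_pos[of z y] by (simp add: power2_eq_square mult.assoc)
qed

text \<open>
  If \<open>fS 0 0 < c\<close>, minimise \<open>fJ + \<epsilon> z\<close> over \<open>fK \<le> 0\<close>, \<open>-Z \<le> z \<le> 0\<close>. A minimiser has \<open>fK = 0\<close>, hence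
  \<open>fQ \<le> 0\<close>, and then decreasing \<open>z\<close> with a suitable change of \<open>y\<close> still lowers the functional;
  the penalty \<open>\<epsilon> z\<close> makes this strict when \<open>fQ = 0\<close>.
\<close>

theorem fS_ge_of_fK_zero:
  assumes c: "\<And>z y. fK z y < 0 \<Longrightarrow> fQ z y = 0 \<Longrightarrow> c \<le> fS z y"
    and k0: "fK 0 0 = 0"
  shows "c \<le> fS 0 0"
proof (rule ccontr)
  assume s0: "\<not> c \<le> fS 0 0"
  obtain Z where Z: "Z > 0" "\<And>y. fK (-Z) y \<le> 0 \<Longrightarrow> fJ (-Z) y \<ge> c" using fJ_large by blast
  have J0: "fJ 0 0 = fS 0 0" using k0 by (simp add: fJ_def)
  \<comment> \<open>The penalty varies by less than c - fS 0 0 over the whole z-range, so a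
    minimiser still has \<open>fJ < c\<close>.\<close>
  define \<epsilon> where "\<epsilon> = (c - fS 0 0) / (2*Z)"
  have \<epsilon>: "\<epsilon> > 0" "\<epsilon> * Z < c - fS 0 0" using s0 Z by (auto simp: \<epsilon>_def)
  define lo where "lo = ln (m / (2 * (p+1) * n)) / (3*p)"
  define hi where "hi = (ln ((\<bar>c\<bar> + 1) / ((3*p-2)/(2*(3*p+3)) * a)) + Z) / 5"
  have bd: "lo \<le> y" "y \<le> hi" if "fK z y \<le> 0" "fJ z y < c" "-Z \<le> z" "z \<le> 0" for z y
    using fK_nonpos_lower_y[of z y] fJ_lt_upper_y[of z y c] that by (auto simp: lo_def hi_def)
  \<comment> \<open>The margin 1 in y keeps a minimiser, which lies between \<open>lo\<close> and
    \<open>hi\<close>, off the horizontal edges.\<close>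
  define C where "C = ({-Z..0} \<times> {lo-1..hi+1}) \<inter> {w. fK (fst w) (snd w) \<le> 0}"
  have "closed {w::real\<times>real. fK (fst w) (snd w) \<le> 0}"
    by (intro closed_Collect_le continuous_intros)
  then have "compact C" unfolding C_def by (intro compact_Int_closed compact_Times) auto
  moreover have "(0,0) \<in> C" using k0 Z bd[of 0 0] s0 J0 by (auto simp: C_def)
  moreover have "continuous_on C (\<lambda>w. fJ (fst w) (snd w) + \<epsilon> * fst w)" by (intro continuous_intros)
  ultimately obtain w where w: "w \<in> C"
    and min: "\<And>v. v \<in> C \<Longrightarrow> fJ (fst w) (snd w) + \<epsilon> * fst w \<le> fJ (fst v) (snd v) + \<epsilon> * fst v"
    using continuous_attains_inf[of C "\<lambda>w. fJ (fst w) (snd w) + \<epsilon> * fst w"] by blast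
  define z y where "z = fst w" and "y = snd w"
  have z: "-Z \<le> z" "z \<le> 0" and K: "fK z y \<le> 0" using w by (auto simp: C_def z_def y_def)
  have "fJ z y + \<epsilon> * z \<le> fJ 0 0" using min[OF \<open>(0,0) \<in> C\<close>] by (simp add: z_def y_def)
  moreover have "\<epsilon> * (-Z) \<le> \<epsilon> * z" using z \<epsilon> by (intro mult_left_mono) auto
  ultimately have J: "fJ z y < c" using \<epsilon> J0 by simp
  have y: "lo \<le> y" "y \<le> hi" using bd[OF K J z] .
  have zZ: "-Z < z" using Z(2)[of y] K J z by (cases "z = -Z") auto
  \<comment> \<open>The edge z = -Z is excluded by \<open>fJ_large\<close>. The edge z = 0 causes no
    trouble because only directions with u >= 0 are tried.\<close>
  have descent: False
    if F: "((\<lambda>t. fJ (z - u * t) (y + k * t) + \<epsilon> * (z - u * t)) has_real_derivative dJ) (at 0)" "dJ < 0"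
      and ev: "eventually (\<lambda>t. fK (z - u * t) (y + k * t) \<le> 0) (at_right 0)" and u: "u \<ge> 0" for u k dJ
  proof -
    obtain d where d: "d > 0" "\<And>t. 0 < t \<Longrightarrow> t < d \<Longrightarrow>
        fJ (z - u * t) (y + k * t) + \<epsilon> * (z - u * t) < fJ z y + \<epsilon> * z"
      using DERIV_neg_dec_right[OF F] by auto
    have e1: "eventually (\<lambda>t. t < d) (at_right (0::real))" using d(1) by (rule eventually_at_right_real[THEN eventually_mono]) auto
    have "((\<lambda>t. z - u * t) \<longlongrightarrow> z - u * 0) (at_right 0)" "((\<lambda>t. y + k * t) \<longlongrightarrow> y + k * 0) (at_right 0)"
      by (intro tendsto_intros)+
    then have e2: "eventually (\<lambda>t. z - u * t > -Z) (at_right 0)"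
      "eventually (\<lambda>t. y + k * t > lo - 1) (at_right 0)" "eventually (\<lambda>t. y + k * t < hi + 1) (at_right 0)"
      using zZ y by (auto intro!: order_tendstoD)
    have "eventually (\<lambda>t::real. False) (at_right 0)"
      using ev e1 e2 eventually_at_right_less[of 0]
    proof eventually_elim
      case (elim t)
      have "u * t \<ge> 0" using u elim by simp
      then have "(z - u * t, y + k * t) \<in> C" using elim z unfolding C_def by auto
      from min[OF this] d(2)[of t] elim show False by (simp add: z_def y_def)
    qed
    then show False by simp
  qed
  have J_deriv: "((\<lambda>t. fJ (z - u * t) (y + k * t) + \<epsilon> * (z - u * t)) has_real_derivative
      (dS - dK / (3*p+3) - \<epsilon> * u)) (at 0)"
    if "((\<lambda>t. fS (z - u * t) (y + k * t)) has_real_derivative dS) (at 0)"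
       "((\<lambda>t. fK (z - u * t) (y + k * t)) has_real_derivative dK) (at 0)" for u k dS dK
    unfolding fJ_def using that p by (auto intro!: derivative_eq_intros DERIV_cdivide)
  define Kz where "Kz = 5/2 * tA z y + 3/2 * tM z y + 1/2 * tT z y + 7/2 * tH z y - (p/2+1) * (3*p+3) * tP z y"
  define Ky where "Ky = 25/2 * tA z y + 9/2 * tM z y + 1/2 * tT z y + 49/4 * tH z y - (3*p+3)^2 * tP z y"
  note dl = deriv_line[of z _ y, folded Kz_def Ky_def]
  have K0: "fK z y = 0"
  proof (rule ccontr)
    assume "fK z y \<noteq> 0"
    then have neg: "fK z y < 0" using K by simp
    have "((\<lambda>t. fK (z - 0 * t) (y + (-1) * t)) \<longlongrightarrow> fK (z - 0 * 0) (y + (-1) * 0)) (at_right 0)"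
      using DERIV_isCont[OF dl(2)[of 0 "-1"]] by (simp add: isCont_def filterlim_at_split)
    then have ev: "eventually (\<lambda>t. fK (z - 0 * t) (y + (-1) * t) \<le> 0) (at_right 0)"
      using neg by (auto dest!: order_tendstoD(2)[of _ "fK z y" "at_right 0" 0] elim!: eventually_mono)
    \<comment> \<open>The derivative of \<open>fJ\<close> when y decreases. It is negative because
      no positive term of \<open>fK\<close> has a y-exponent above 3p+3, and that of the gradient
      term is strictly smaller.\<close>
    have "- fK z y + Ky / (3*p+3) < 0"
    proof -
      have "Ky < (3*p+3) * fK z y"
      proof -
        have "5 * tA z y < (3*p+3) * tA z y" "3 * tM z y \<le> (3*p+3) * tM z y"
          "1 * tT z y \<le> (3*p+3) * tT z y" "7 * tH z y \<le> (3*p+3) * tH z y"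
          using t_pos[of z y] p by (intro mult_right_mono mult_strict_right_mono; simp)+
        moreover have "(3*p+3) * fK z y = 5/2 * ((3*p+3) * tA z y) + 3/2 * ((3*p+3) * tM z y)
          + 1/2 * ((3*p+3) * tT z y) + 7/4 * ((3*p+3) * tH z y) - (3*p+3)^2 * tP z y"
          unfolding fK_def by (simp add: power2_eq_square field_simps)
        ultimately show ?thesis unfolding Ky_def by linarith
      qed
      then show ?thesis using p by (simp add: field_simps)
    qed
    then show False
      using descent[OF J_deriv[OF dl(1)[of 0 "-1"] dl(2)[of 0 "-1"]] _ ev] by simp
  qed
  then have "fS z y < c" using J by (simp add: fJ_def)
  then have Q: "fQ z y \<le> 0" using fQ_nonpos[OF c K0] by blast
  have Ky: "Ky < 0" using fK_y_deriv_neg[OF K0] by (simp add: Ky_def)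
  \<comment> \<open>The change of y makes the derivative of \<open>fK\<close> slightly negative, so
    the path enters the admissible region. This costs \<epsilon>/2 in \<open>fJ\<close> while the
    penalty gains \<epsilon>; the total derivative is fQ/3 - \<epsilon>/2 < 0.\<close>
  define \<kappa> where "\<kappa> = (Kz - \<epsilon> * (3*p+3) / 2) / Ky"
  have dK: "- 1 * Kz + \<kappa> * Ky = - \<epsilon> * (3*p+3) / 2" using Ky by (simp add: \<kappa>_def)
  have neg: "- \<epsilon> * (3*p+3) / 2 < 0" using \<epsilon> p by simp
  have ev: "eventually (\<lambda>t. fK (z - 1 * t) (y + \<kappa> * t) \<le> 0) (at_right 0)"
  proof -
    obtain d where "d > 0" "\<And>t. 0 < t \<Longrightarrow> t < d \<Longrightarrow> fK (z - 1 * t) (y + \<kappa> * t) < 0"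
      using DERIV_neg_dec_right[OF dl(2)[of 1 \<kappa>, unfolded dK] neg] K0 by auto
    then show ?thesis unfolding eventually_at_right_field by (metis less_imp_le)
  qed
  have "- 1 * ((fK z y - fQ z y) / 3) + \<kappa> * fK z y - (- \<epsilon> * (3*p+3) / 2) / (3*p+3) - \<epsilon> * 1 < 0"
  proof -
    have "(- \<epsilon> * (3*p+3) / 2) / (3*p+3) = - \<epsilon> / 2" using p by (simp add: field_simps)
    then show ?thesis using K0 Q \<epsilon> by simp
  qed
  then show False
    using descent[OF J_deriv[OF dl(1)[of 1 \<kappa>] dl(2)[of 1 \<kappa>, unfolded dK]] _ ev] by simp
qed

end

section \<open>Continuity of the functionals\<close>

lemma weak_gradient_diff:
  assumes v: "v \<in> H1" and w: "w \<in> H1"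
  shows "weak_gradient (\<lambda>x. v x - w x) (\<lambda>x. grad v x - grad w x)"
  unfolding weak_gradient_def
proof (intro allI impI)
  fix \<phi> j assume \<phi>: "test_function \<phi>"
  note \<phi>' = test_function_partial_deriv[OF \<phi>, of j]
  note V = H1_grad[OF v] and W = H1_grad[OF w]
  note i = integrable_test_function_scaleR[OF \<phi>' V(1)] integrable_test_function_scaleR[OF \<phi>' W(1)]
    integrable_test_function_scaleR[OF \<phi> square_integrable_vec_nth[OF V(2), of j]]
    integrable_test_function_scaleR[OF \<phi> square_integrable_vec_nth[OF W(2), of j]]
  show "(LINT x|lborel. partial_deriv j \<phi> x *\<^sub>R (v x - w x)) = - (LINT x|lborel. \<phi> x *\<^sub>R ((grad v x - grad w x) $ j))"
    using V(3) W(3) \<phi> i by (simp add: weak_gradient_def scaleR_diff_right)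
qed

lemma norm_power2_diff_le: "(norm (a - b))\<^sup>2 \<le> 2 * (norm a)\<^sup>2 + 2 * (norm (b :: 'a::real_normed_vector))\<^sup>2"
proof -
  have "(norm (a - b))\<^sup>2 \<le> (norm a + norm b)\<^sup>2" by (intro power_mono norm_triangle_ineq4) simp
  also have "\<dots> \<le> 2 * (norm a)\<^sup>2 + 2 * (norm b)\<^sup>2"
    using two_mult_le_sum_squares[of "norm a" "norm b"] by (simp add: power2_sum)
  finally show ?thesis .
qed

lemma square_integrable_diff_vec:
  fixes f g :: "R3 \<Rightarrow> 'a::euclidean_space"
  assumes f: "square_integrable f" and g: "square_integrable g"
  shows "square_integrable (\<lambda>x. f x - g x)"
proof -
  have [measurable]: "f \<in> borel_measurable borel" "g \<in> borel_measurable borel"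
    using f g by (auto simp: square_integrable_def)
  have "integrable lborel (\<lambda>x. (norm (f x - g x))\<^sup>2)"
  proof (rule Bochner_Integration.integrable_bound)
    show "integrable lborel (\<lambda>x. 2 * (norm (f x))\<^sup>2 + 2 * (norm (g x))\<^sup>2)"
      using f g by (simp add: square_integrable_def)
    show "AE x in lborel. norm ((norm (f x - g x))\<^sup>2) \<le> norm (2 * (norm (f x))\<^sup>2 + 2 * (norm (g x))\<^sup>2)"
      using norm_power2_diff_le by (intro AE_I2) simp
  qed measurable
  then show ?thesis by (simp add: square_integrable_def)
qed

lemma
  assumes v: "v \<in> X" and w: "w \<in> X"
  shows X_diff: "(\<lambda>x. v x - w x) \<in> X"
    and grad_sq_diff: "grad_sq (\<lambda>x. v x - w x) = (LINT x|lborel. (norm (grad v x - grad w x))\<^sup>2)"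
proof -
  note V = H1_grad[OF X_H1[OF v]] and W = H1_grad[OF X_H1[OF w]]
  note wg = H1_weak_gradient[OF square_integrable_diff_vec[OF V(1) W(1)] square_integrable_diff_vec[OF V(2) W(2)]
    weak_gradient_diff[OF X_H1[OF v] X_H1[OF w]]]
  have [measurable]: "v \<in> borel_measurable borel" "w \<in> borel_measurable borel"
    using X_measurable v w by auto
  have "integrable lborel (\<lambda>x. ((x $ 1)\<^sup>2 + (x $ 2)\<^sup>2) * (cmod (v x - w x))\<^sup>2)"
  proof (rule Bochner_Integration.integrable_bound)
    show "integrable lborel (\<lambda>x. 2 * (((x $ 1)\<^sup>2 + (x $ 2)\<^sup>2) * (cmod (v x))\<^sup>2) + 2 * (((x $ 1)\<^sup>2 + (x $ 2)\<^sup>2) * (cmod (w x))\<^sup>2))"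
      using X_integrable(3)[OF v] X_integrable(3)[OF w] by (intro Bochner_Integration.integrable_add integrable_mult_right)
    have "((x $ 1)\<^sup>2 + (x $ 2)\<^sup>2) * (cmod (v x - w x))\<^sup>2 \<le> ((x $ 1)\<^sup>2 + (x $ 2)\<^sup>2) * (2 * (cmod (v x))\<^sup>2 + 2 * (cmod (w x))\<^sup>2)" for x
      by (intro mult_left_mono norm_power2_diff_le) simp
    then show "AE x in lborel. norm (((x $ 1)\<^sup>2 + (x $ 2)\<^sup>2) * (cmod (v x - w x))\<^sup>2) \<le>
      norm (2 * (((x $ 1)\<^sup>2 + (x $ 2)\<^sup>2) * (cmod (v x))\<^sup>2) + 2 * (((x $ 1)\<^sup>2 + (x $ 2)\<^sup>2) * (cmod (w x))\<^sup>2))"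
      by (intro AE_I2) (simp add: algebra_simps)
  qed measurable
  then show "(\<lambda>x. v x - w x) \<in> X" using wg(1) by (simp add: X_def)
  show "grad_sq (\<lambda>x. v x - w x) = (LINT x|lborel. (norm (grad v x - grad w x))\<^sup>2)" by (rule wg(3))
qed

text \<open>A Young form of continuity: the term that does not vanish carries an arbitrarily small
  \<delta>, the large factor multiplies the distance.\<close>

lemma norm_power2_diff_bound:
  fixes a b :: "'a::real_normed_vector"
  assumes \<delta>: "\<delta> > 0"
  shows "\<bar>(norm a)\<^sup>2 - (norm b)\<^sup>2\<bar> \<le> \<delta> * (norm b)\<^sup>2 + (1 + 1/\<delta>) * (norm (a - b))\<^sup>2"
proof -
  define n where "n = norm (a - b)"
  define d where "d = norm a - norm b"
  have "(norm a)\<^sup>2 - (norm b)\<^sup>2 = d\<^sup>2 + 2 * d * norm b"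
    by (simp add: d_def power2_eq_square algebra_simps)
  then have "\<bar>(norm a)\<^sup>2 - (norm b)\<^sup>2\<bar> \<le> d\<^sup>2 + 2 * \<bar>d\<bar> * norm b"
    using abs_triangle_ineq[of "d\<^sup>2" "2 * d * norm b"] by (simp add: abs_mult)
  also have "\<dots> \<le> n\<^sup>2 + 2 * n * norm b"
  proof (intro add_mono mult_right_mono mult_left_mono)
    show ab: "\<bar>d\<bar> \<le> n" unfolding n_def d_def by (rule norm_triangle_ineq3)
    show "d\<^sup>2 \<le> n\<^sup>2" using ab by (simp add: abs_le_square_iff[symmetric] n_def)
  qed auto
  also have "2 * n * norm b \<le> \<delta> * (norm b)\<^sup>2 + (1/\<delta>) * n\<^sup>2"
    using two_mult_le_sum_squares[of "n / sqrt \<delta>" "sqrt \<delta> * norm b"] \<delta>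
    by (simp add: power_mult_distrib power_divide)
  finally show ?thesis by (simp add: n_def algebra_simps)
qed

text \<open>The weight \<mu> lets one estimate serve gradient, mass, trap and, with weight 1 / |x -
  y|, the Coulomb potential.\<close>

lemma integral_norm_power2_diff_bound:
  fixes f g h :: "'a \<Rightarrow> 'b::real_normed_vector" and \<mu> :: "'a \<Rightarrow> real"
  assumes f: "integrable M (\<lambda>x. \<mu> x * (norm (f x))\<^sup>2)" and g: "integrable M (\<lambda>x. \<mu> x * (norm (g x))\<^sup>2)"
    and h: "integrable M (\<lambda>x. \<mu> x * (norm (f x - g x))\<^sup>2)"
    and \<mu>: "\<And>x. \<mu> x \<ge> 0" and \<delta>: "\<delta> > 0"
  shows "(LINT x|M. \<bar>\<mu> x * (norm (f x))\<^sup>2 - \<mu> x * (norm (g x))\<^sup>2\<bar>)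
      \<le> \<delta> * (LINT x|M. \<mu> x * (norm (g x))\<^sup>2) + (1 + 1/\<delta>) * (LINT x|M. \<mu> x * (norm (f x - g x))\<^sup>2)"
    and "\<bar>(LINT x|M. \<mu> x * (norm (f x))\<^sup>2) - (LINT x|M. \<mu> x * (norm (g x))\<^sup>2)\<bar>
      \<le> \<delta> * (LINT x|M. \<mu> x * (norm (g x))\<^sup>2) + (1 + 1/\<delta>) * (LINT x|M. \<mu> x * (norm (f x - g x))\<^sup>2)"
proof -
  show 1: "(LINT x|M. \<bar>\<mu> x * (norm (f x))\<^sup>2 - \<mu> x * (norm (g x))\<^sup>2\<bar>)
      \<le> \<delta> * (LINT x|M. \<mu> x * (norm (g x))\<^sup>2) + (1 + 1/\<delta>) * (LINT x|M. \<mu> x * (norm (f x - g x))\<^sup>2)"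
  proof -
    have "(LINT x|M. \<bar>\<mu> x * (norm (f x))\<^sup>2 - \<mu> x * (norm (g x))\<^sup>2\<bar>)
       \<le> (LINT x|M. \<delta> * (\<mu> x * (norm (g x))\<^sup>2) + (1 + 1/\<delta>) * (\<mu> x * (norm (f x - g x))\<^sup>2))"
    proof (rule integral_mono)
      show "integrable M (\<lambda>x. \<bar>\<mu> x * (norm (f x))\<^sup>2 - \<mu> x * (norm (g x))\<^sup>2\<bar>)"
        using f g by (intro integrable_abs Bochner_Integration.integrable_diff)
      show "integrable M (\<lambda>x. \<delta> * (\<mu> x * (norm (g x))\<^sup>2) + (1 + 1/\<delta>) * (\<mu> x * (norm (f x - g x))\<^sup>2))"
        using g h by (intro Bochner_Integration.integrable_add integrable_mult_right)
      fix x
      have "\<bar>\<mu> x * (norm (f x))\<^sup>2 - \<mu> x * (norm (g x))\<^sup>2\<bar> = \<mu> x * \<bar>(norm (f x))\<^sup>2 - (norm (g x))\<^sup>2\<bar>"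
        using \<mu>[of x] by (simp add: abs_mult flip: right_diff_distrib)
      also have "\<dots> \<le> \<mu> x * (\<delta> * (norm (g x))\<^sup>2 + (1 + 1/\<delta>) * (norm (f x - g x))\<^sup>2)"
        by (intro mult_left_mono norm_power2_diff_bound \<delta> \<mu>)
      finally show "\<bar>\<mu> x * (norm (f x))\<^sup>2 - \<mu> x * (norm (g x))\<^sup>2\<bar>
        \<le> \<delta> * (\<mu> x * (norm (g x))\<^sup>2) + (1 + 1/\<delta>) * (\<mu> x * (norm (f x - g x))\<^sup>2)"
        by (simp add: algebra_simps)
    qed
    also have "\<dots> = \<delta> * (LINT x|M. \<mu> x * (norm (g x))\<^sup>2) + (1 + 1/\<delta>) * (LINT x|M. \<mu> x * (norm (f x - g x))\<^sup>2)"
      using g h by (subst Bochner_Integration.integral_add) (simp_all only: integrable_mult_right integral_mult_right_zero)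
    finally show ?thesis .
  qed
  have "\<bar>LINT x|M. \<mu> x * (norm (f x))\<^sup>2 - \<mu> x * (norm (g x))\<^sup>2\<bar> \<le> (LINT x|M. \<bar>\<mu> x * (norm (f x))\<^sup>2 - \<mu> x * (norm (g x))\<^sup>2\<bar>)"
    by (rule integral_abs_bound)
  then show "\<bar>(LINT x|M. \<mu> x * (norm (f x))\<^sup>2) - (LINT x|M. \<mu> x * (norm (g x))\<^sup>2)\<bar>
      \<le> \<delta> * (LINT x|M. \<mu> x * (norm (g x))\<^sup>2) + (1 + 1/\<delta>) * (LINT x|M. \<mu> x * (norm (f x - g x))\<^sup>2)"
    using 1 f g by simp
qed

lemma Xdist_power2:
  "(Xdist v w)\<^sup>2 = grad_sq (\<lambda>x. v x - w x) + mass (\<lambda>x. v x - w x) + trap (\<lambda>x. v x - w x)"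
  using functionals_nonneg by (simp add: Xdist_def Xnorm_def add_nonneg_nonneg)

lemma functional_diff_bounds:
  assumes v: "v \<in> X" and w: "w \<in> X" and \<delta>: "\<delta> > 0"
  shows "\<bar>grad_sq v - grad_sq w\<bar> \<le> \<delta> * grad_sq w + (1 + 1/\<delta>) * (Xdist v w)\<^sup>2"
    and "\<bar>mass v - mass w\<bar> \<le> \<delta> * mass w + (1 + 1/\<delta>) * (Xdist v w)\<^sup>2"
    and "(LINT x|lborel. \<bar>(cmod (v x))\<^sup>2 - (cmod (w x))\<^sup>2\<bar>) \<le> \<delta> * mass w + (1 + 1/\<delta>) * (Xdist v w)\<^sup>2"
    and "\<bar>trap v - trap w\<bar> \<le> \<delta> * trap w + (1 + 1/\<delta>) * (Xdist v w)\<^sup>2"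
proof -
  note V = X_integrable[OF v] and W = X_integrable[OF w] and D = X_integrable[OF X_diff[OF v w]]
  have le: "A \<le> B + (1 + 1/\<delta>) * (Xdist v w)\<^sup>2" if "A \<le> B + (1 + 1/\<delta>) * C" "C \<le> (Xdist v w)\<^sup>2" for A B C
    using that(1) mult_left_mono[OF that(2), of "1 + 1/\<delta>"] \<delta> by simp
  have C: "grad_sq (\<lambda>x. v x - w x) \<le> (Xdist v w)\<^sup>2" "mass (\<lambda>x. v x - w x) \<le> (Xdist v w)\<^sup>2"
    "trap (\<lambda>x. v x - w x) \<le> (Xdist v w)\<^sup>2"
    unfolding Xdist_power2 using functionals_nonneg by (simp_all add: add_nonneg_nonneg)
  have Dg: "integrable lborel (\<lambda>x. (norm (grad v x - grad w x))\<^sup>2)"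
    using square_integrable_diff_vec[OF H1_grad(2)[OF X_H1[OF v]] H1_grad(2)[OF X_H1[OF w]]]
    by (simp add: square_integrable_def)
  show "\<bar>grad_sq v - grad_sq w\<bar> \<le> \<delta> * grad_sq w + (1 + 1/\<delta>) * (Xdist v w)\<^sup>2"
    using integral_norm_power2_diff_bound(2)[of lborel "\<lambda>_. 1" "grad v" "grad w" \<delta>] V(2) W(2) Dg \<delta>
    by (intro le[OF _ C(1)]) (simp add: grad_sq_diff[OF v w] grad_sq_def)
  show "\<bar>mass v - mass w\<bar> \<le> \<delta> * mass w + (1 + 1/\<delta>) * (Xdist v w)\<^sup>2"
    using integral_norm_power2_diff_bound(2)[of lborel "\<lambda>_. 1" v w \<delta>] V(1) W(1) D(1) \<delta>
    by (intro le[OF _ C(2)]) (simp add: mass_def)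
  show "(LINT x|lborel. \<bar>(cmod (v x))\<^sup>2 - (cmod (w x))\<^sup>2\<bar>) \<le> \<delta> * mass w + (1 + 1/\<delta>) * (Xdist v w)\<^sup>2"
    using integral_norm_power2_diff_bound(1)[of lborel "\<lambda>_. 1" v w \<delta>] V(1) W(1) D(1) \<delta>
    by (intro le[OF _ C(2)]) (simp add: mass_def)
  show "\<bar>trap v - trap w\<bar> \<le> \<delta> * trap w + (1 + 1/\<delta>) * (Xdist v w)\<^sup>2"
    unfolding trap_def
    using integral_norm_power2_diff_bound(2)[of lborel "\<lambda>x. (x $ 1)\<^sup>2 + (x $ 2)\<^sup>2" v w \<delta>] V(3) W(3) D(3) \<delta>
    by (intro le[OF _ C(3)[unfolded trap_def]]) simp
qed

text \<open>Applied to real and imaginary parts, the Hardy-type inequality bounds the Coulomb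
  potential uniformly in x. The free \<eta> is exploited in \<open>grad_sq_pos\<close>; elsewhere
  \<eta> = 1 suffices.\<close>

lemma
  assumes v: "v \<in> X" and \<eta>: "\<eta> > 0"
  shows coulomb_integrable: "integrable lborel (\<lambda>y. (cmod (v y))\<^sup>2 / norm (x - y))"
    and coulomb_le: "2 * coulomb v x \<le> 3 * \<eta> * mass v + (1 / \<eta>) * grad_sq v"
proof -
  note H = H1_grad[OF X_H1[OF v]]
  have wd: "weak_deriv j (\<lambda>x. Re (v x)) (\<lambda>x. Re (grad v x $ j))"
    "weak_deriv j (\<lambda>x. Im (v x)) (\<lambda>x. Im (grad v x $ j))" for j
    using H(3) unfolding weak_gradient_iff_weak_deriv[OF H(1,2)] by auto
  note s = square_integrable_Re_Im[OF H(1)] square_integrable_Re_Im[OF square_integrable_vec_nth[OF H(2)]]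
  note R = hardy_real[OF s(1) s(3) wd(1) \<eta>, of x] and I = hardy_real[OF s(2) s(4) wd(2) \<eta>, of x]
  have e: "(cmod (v y))\<^sup>2 / norm (x - y) = (Re (v y))\<^sup>2 / norm (x - y) + (Im (v y))\<^sup>2 / norm (x - y)" for y
    by (simp add: cmod_power2 add_divide_distrib)
  show "integrable lborel (\<lambda>y. (cmod (v y))\<^sup>2 / norm (x - y))" unfolding e using R(1) I(1) by simp
  have "coulomb v x = (LINT y|lborel. (Re (v y))\<^sup>2 / norm (x - y)) + (LINT y|lborel. (Im (v y))\<^sup>2 / norm (x - y))"
    unfolding coulomb_def e using R(1) I(1) by simp
  moreover have "mass v = (LINT y|lborel. (Re (v y))\<^sup>2) + (LINT y|lborel. (Im (v y))\<^sup>2)"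
    unfolding mass_def cmod_power2 using s by (intro Bochner_Integration.integral_add square_integrable_integrable)
  moreover have "grad_sq v = (\<Sum>j\<in>UNIV. LINT y|lborel. (Re (grad v y $ j))\<^sup>2) + (\<Sum>j\<in>UNIV. LINT y|lborel. (Im (grad v y $ j))\<^sup>2)"
    unfolding grad_sq_def power2_norm_complex3 using s[THEN square_integrable_integrable] by simp
  ultimately show "2 * coulomb v x \<le> 3 * \<eta> * mass v + (1 / \<eta>) * grad_sq v"
    using R(2) I(2) by (simp add: algebra_simps)
qed

text \<open>If the gradient vanished, \<eta> tending to 0 in \<open>coulomb_le\<close> would force
  the Coulomb potential at the origin, hence v, to vanish. The positivity is required by
  \<open>scaling_profile\<close>.\<close>

lemma grad_sq_pos:
  assumes v: "v \<in> X" and m: "mass v > 0" shows "grad_sq v > 0"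
proof (rule ccontr)
  assume "\<not> grad_sq v > 0"
  then have 0: "grad_sq v = 0" using functionals_nonneg(1)[of v] by simp
  have "2 * coulomb v 0 \<le> 0 + e" if "e > 0" for e
    using coulomb_le[OF v, of "e / (3 * mass v)" 0] 0 m that by simp
  then have "2 * coulomb v 0 \<le> 0" by (rule field_le_epsilon)
  then have "coulomb v 0 = 0" using functionals_nonneg(4)[of v 0] by simp
  then have "AE y in lborel. (cmod (v y))\<^sup>2 / norm (0 - y) = 0"
    using integral_nonneg_eq_0_iff_AE[OF coulomb_integrable[OF v zero_less_one, of 0]] by (simp add: coulomb_def)
  then have "AE y in lborel. (cmod (v y))\<^sup>2 = 0"
    using AE_lborel_singleton[of 0] by eventually_elim simp
  then have "mass v = 0" unfolding mass_def by (rule integral_eq_zero_AE)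
  then show False using m by simp
qed

lemma hartree_integrable:
  assumes v: "v \<in> X" and w: "w \<in> X"
  shows "integrable lborel (\<lambda>x. coulomb v x * (cmod (w x))\<^sup>2)"
proof (rule Bochner_Integration.integrable_bound)
  have [measurable]: "w \<in> borel_measurable borel" "coulomb v \<in> borel_measurable borel"
    using X_measurable[OF w] coulomb_measurable[OF X_measurable[OF v]] by auto
  let ?C = "(3 * mass v + grad_sq v) / 2"
  show "integrable lborel (\<lambda>x. ?C * (cmod (w x))\<^sup>2)" using X_integrable(1)[OF w] by (rule integrable_mult_right)
  have "coulomb v x \<le> ?C" for x using coulomb_le[OF v zero_less_one, of x] by simp
  then have "coulomb v x * (cmod (w x))\<^sup>2 \<le> ?C * (cmod (w x))\<^sup>2" for x by (rule mult_right_mono) simp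
  then show "AE x in lborel. norm (coulomb v x * (cmod (w x))\<^sup>2) \<le> norm (?C * (cmod (w x))\<^sup>2)"
    using functionals_nonneg by (intro AE_I2) (simp add: abs_of_nonneg add_nonneg_nonneg)
  show "(\<lambda>x. coulomb v x * (cmod (w x))\<^sup>2) \<in> borel_measurable lborel" by measurable
qed

lemma coulomb_diff_bound:
  assumes v: "v \<in> X" and w: "w \<in> X" and \<delta>: "\<delta> > 0"
  shows "\<bar>coulomb v x - coulomb w x\<bar> \<le> \<delta> * coulomb w x + (1 + 1/\<delta>) * (2 * (Xdist v w)\<^sup>2)"
proof -
  note D = X_diff[OF v w]
  have "\<bar>coulomb v x - coulomb w x\<bar> \<le> \<delta> * coulomb w x + (1 + 1/\<delta>) * coulomb (\<lambda>x. v x - w x) x"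
    using integral_norm_power2_diff_bound(2)[of lborel "\<lambda>y. 1 / norm (x - y)" v w \<delta>]
      coulomb_integrable[OF v zero_less_one] coulomb_integrable[OF w zero_less_one]
      coulomb_integrable[OF D zero_less_one] \<delta>
    by (simp add: coulomb_def)
  also have "coulomb (\<lambda>x. v x - w x) x \<le> 2 * (Xdist v w)\<^sup>2"
    using coulomb_le[OF D zero_less_one, of x] functionals_nonneg(1-3)[of "\<lambda>x. v x - w x"]
    unfolding Xdist_power2 by simp
  finally show ?thesis using \<delta> by (simp add: mult_left_mono)
qed

text \<open>The difference splits into a change of potential tested against |v|^2 and the fixed
  bounded potential of w tested against |v|^2 - |w|^2.\<close>

lemma hartree_diff_bound:
  assumes v: "v \<in> X" and w: "w \<in> X" and \<delta>: "\<delta> > 0"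
  defines "C \<equiv> (3 * mass w + grad_sq w) / 2"
  shows "\<bar>hartree v - hartree w\<bar> \<le> \<delta> * (C * mass v + C * mass w) +
     (1 + 1/\<delta>) * ((2 * mass v + C) * (Xdist v w)\<^sup>2)"
proof -
  have [measurable]: "w \<in> borel_measurable borel" "v \<in> borel_measurable borel"
    "coulomb v \<in> borel_measurable borel" "coulomb w \<in> borel_measurable borel"
    using X_measurable[OF w] X_measurable[OF v] coulomb_measurable by auto
  define U where "U = \<delta> * C + (1 + 1/\<delta>) * (2 * (Xdist v w)\<^sup>2)"
  have Cw: "coulomb w x \<le> C" for x using coulomb_le[OF w zero_less_one, of x] by (simp add: C_def)
  have C0: "C \<ge> 0" using functionals_nonneg by (simp add: C_def)
  have U: "\<bar>coulomb v x - coulomb w x\<bar> \<le> U" for x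
  proof -
    have "\<delta> * coulomb w x \<le> \<delta> * C" using Cw \<delta> by (simp add: mult_left_mono)
    then show ?thesis using coulomb_diff_bound[OF v w \<delta>, of x] by (simp add: U_def)
  qed
  note iv = X_integrable(1)[OF v] and iw = X_integrable(1)[OF w]
  have "hartree v - hartree w = (LINT x|lborel. coulomb v x * (cmod (v x))\<^sup>2 - coulomb w x * (cmod (w x))\<^sup>2)"
    unfolding hartree_def using hartree_integrable[OF v v] hartree_integrable[OF w w] by simp
  also have "\<bar>\<dots>\<bar> \<le> (LINT x|lborel. \<bar>coulomb v x * (cmod (v x))\<^sup>2 - coulomb w x * (cmod (w x))\<^sup>2\<bar>)"
    by (rule integral_abs_bound)
  also have "\<dots> \<le> (LINT x|lborel. U * (cmod (v x))\<^sup>2 + C * \<bar>(cmod (v x))\<^sup>2 - (cmod (w x))\<^sup>2\<bar>)"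
  proof (rule integral_mono)
    show "integrable lborel (\<lambda>x. \<bar>coulomb v x * (cmod (v x))\<^sup>2 - coulomb w x * (cmod (w x))\<^sup>2\<bar>)"
      using hartree_integrable[OF v v] hartree_integrable[OF w w] by simp
    show "integrable lborel (\<lambda>x. U * (cmod (v x))\<^sup>2 + C * \<bar>(cmod (v x))\<^sup>2 - (cmod (w x))\<^sup>2\<bar>)"
      using iv iw by simp
    fix x
    have "coulomb v x * (cmod (v x))\<^sup>2 - coulomb w x * (cmod (w x))\<^sup>2
        = (coulomb v x - coulomb w x) * (cmod (v x))\<^sup>2 + coulomb w x * ((cmod (v x))\<^sup>2 - (cmod (w x))\<^sup>2)"
      by (simp add: algebra_simps)
    also have "\<bar>\<dots>\<bar> \<le> \<bar>coulomb v x - coulomb w x\<bar> * (cmod (v x))\<^sup>2 + coulomb w x * \<bar>(cmod (v x))\<^sup>2 - (cmod (w x))\<^sup>2\<bar>"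
      by (rule order_trans[OF abs_triangle_ineq]) (simp add: abs_mult functionals_nonneg)
    also have "\<dots> \<le> U * (cmod (v x))\<^sup>2 + C * \<bar>(cmod (v x))\<^sup>2 - (cmod (w x))\<^sup>2\<bar>"
      by (intro add_mono mult_right_mono U Cw) auto
    finally show "\<bar>coulomb v x * (cmod (v x))\<^sup>2 - coulomb w x * (cmod (w x))\<^sup>2\<bar>
      \<le> U * (cmod (v x))\<^sup>2 + C * \<bar>(cmod (v x))\<^sup>2 - (cmod (w x))\<^sup>2\<bar>" .
  qed
  also have "\<dots> = U * mass v + C * (LINT x|lborel. \<bar>(cmod (v x))\<^sup>2 - (cmod (w x))\<^sup>2\<bar>)"
    using iv iw by (simp add: mass_def)
  also have "\<dots> \<le> U * mass v + C * (\<delta> * mass w + (1 + 1/\<delta>) * (Xdist v w)\<^sup>2)"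
    using functional_diff_bounds(3)[OF v w \<delta>] C0 by (simp add: mult_left_mono)
  finally show ?thesis by (simp add: U_def algebra_simps)
qed

lemma tendsto_by_young_bound:
  fixes G :: "'a \<Rightarrow> real"
  assumes bd: "\<And>\<delta>. \<delta> > 0 \<Longrightarrow> eventually (\<lambda>s. \<bar>G s - G0\<bar> \<le> \<delta> * A + (1 + 1/\<delta>) * (B * (d s)\<^sup>2)) F"
    and d: "(d \<longlongrightarrow> 0) F" and A: "A \<ge> 0"
  shows "(G \<longlongrightarrow> G0) F"
proof (rule tendstoI)
  fix e :: real assume e: "e > 0"
  define \<delta> where "\<delta> = e / (2 * (A + 1))"
  have \<delta>: "\<delta> > 0" "\<delta> * A < e / 2 + 0" using e A by (auto simp: \<delta>_def field_simps add_nonneg_pos)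
  have "((\<lambda>s. (1 + 1/\<delta>) * (B * (d s)\<^sup>2)) \<longlongrightarrow> (1 + 1/\<delta>) * (B * 0\<^sup>2)) F" by (intro tendsto_intros d)
  then have "eventually (\<lambda>s. (1 + 1/\<delta>) * (B * (d s)\<^sup>2) < e / 2) F"
    using e by (intro order_tendstoD(2)) auto
  with bd[OF \<delta>(1)] show "eventually (\<lambda>s. dist (G s) G0 < e) F"
    by eventually_elim (use \<delta>(2) in \<open>unfold dist_real_def, linarith\<close>)
qed

lemma functionals_tendsto:
  assumes \<psi>: "eventually (\<lambda>s. \<psi> s \<in> X) F" and w: "w \<in> X" and d: "((\<lambda>s. Xdist (\<psi> s) w) \<longlongrightarrow> 0) F"
  shows "((\<lambda>s. grad_sq (\<psi> s)) \<longlongrightarrow> grad_sq w) F" "((\<lambda>s. mass (\<psi> s)) \<longlongrightarrow> mass w) F"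
    "((\<lambda>s. trap (\<psi> s)) \<longlongrightarrow> trap w) F" "((\<lambda>s. hartree (\<psi> s)) \<longlongrightarrow> hartree w) F"
proof -
  show "((\<lambda>s. grad_sq (\<psi> s)) \<longlongrightarrow> grad_sq w) F"
    by (rule tendsto_by_young_bound[where A="grad_sq w" and B=1, OF _ d])
       (use \<psi> in \<open>auto elim!: eventually_mono simp: functional_diff_bounds[OF _ w] functionals_nonneg\<close>)
  show m: "((\<lambda>s. mass (\<psi> s)) \<longlongrightarrow> mass w) F"
    by (rule tendsto_by_young_bound[where A="mass w" and B=1, OF _ d])
       (use \<psi> in \<open>auto elim!: eventually_mono simp: functional_diff_bounds[OF _ w] functionals_nonneg\<close>)
  show "((\<lambda>s. trap (\<psi> s)) \<longlongrightarrow> trap w) F"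
    by (rule tendsto_by_young_bound[where A="trap w" and B=1, OF _ d])
       (use \<psi> in \<open>auto elim!: eventually_mono simp: functional_diff_bounds[OF _ w] functionals_nonneg\<close>)
  define C where "C = (3 * mass w + grad_sq w) / 2"
  have C0: "C \<ge> 0" using functionals_nonneg by (simp add: C_def)
  \<comment> \<open>A uniform mass bound near the limit makes the constants of
    \<open>hartree_diff_bound\<close> independent of s.\<close>
  have em: "eventually (\<lambda>s. mass (\<psi> s) < mass w + 1) F" using m by (rule order_tendstoD(2)) simp
  show "((\<lambda>s. hartree (\<psi> s)) \<longlongrightarrow> hartree w) F"
  proof (rule tendsto_by_young_bound[where A="C * (mass w + 1) + C * mass w" and B="2 * (mass w + 1) + C", OF _ d])
    fix \<delta> :: real assume \<delta>: "\<delta> > 0"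
    show "eventually (\<lambda>s. \<bar>hartree (\<psi> s) - hartree w\<bar> \<le> \<delta> * (C * (mass w + 1) + C * mass w) +
       (1 + 1/\<delta>) * ((2 * (mass w + 1) + C) * (Xdist (\<psi> s) w)\<^sup>2)) F"
      using \<psi> em
    proof eventually_elim
      case (elim s)
      have "\<bar>hartree (\<psi> s) - hartree w\<bar> \<le> \<delta> * (C * mass (\<psi> s) + C * mass w) +
         (1 + 1/\<delta>) * ((2 * mass (\<psi> s) + C) * (Xdist (\<psi> s) w)\<^sup>2)"
        unfolding C_def by (rule hartree_diff_bound[OF elim(1) w \<delta>])
      also have "\<dots> \<le> \<delta> * (C * (mass w + 1) + C * mass w) +
         (1 + 1/\<delta>) * ((2 * (mass w + 1) + C) * (Xdist (\<psi> s) w)\<^sup>2)"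
        using elim(2) C0 \<delta> by (intro add_mono mult_left_mono mult_right_mono) auto
      finally show ?case .
    qed
  qed (use C0 functionals_nonneg in auto)
qed

text \<open>A solution attains its initial datum only almost everywhere, so the signs of
  \<open>K\<close> and \<open>Q\<close> at time 0 are transferred by this.\<close>

lemma functionals_cong_AE:
  assumes v: "v \<in> X" and w: "w \<in> X" and AE: "AE x in lborel. v x = w x"
  shows "grad_sq v = grad_sq w" "mass v = mass w" "trap v = trap w" "hartree v = hartree w"
    "Lnorm_pow q v = Lnorm_pow q w"
proof -
  have [measurable]: "w \<in> borel_measurable borel" "v \<in> borel_measurable borel"
    using X_measurable[OF w] X_measurable[OF v] by auto
  have "weak_gradient w (grad v)"
    unfolding weak_gradient_def
  proof (intro allI impI)
    fix \<phi> j assume \<phi>: "test_function \<phi>"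
    note [measurable] = test_function_measurable[OF test_function_partial_deriv[OF \<phi>]]
    have "(LINT x|lborel. partial_deriv j \<phi> x *\<^sub>R w x) = (LINT x|lborel. partial_deriv j \<phi> x *\<^sub>R v x)"
      by (rule integral_cong_AE) (use AE in auto)
    then show "(LINT x|lborel. partial_deriv j \<phi> x *\<^sub>R w x) = - (LINT x|lborel. \<phi> x *\<^sub>R (grad v x $ j))"
      using H1_grad(3)[OF X_H1[OF v]] \<phi> by (simp add: weak_gradient_def)
  qed
  from H1_weak_gradient(3)[OF H1_grad(1)[OF X_H1[OF w]] H1_grad(2)[OF X_H1[OF v]] this]
  show "grad_sq v = grad_sq w" by (simp add: grad_sq_def)
  show "mass v = mass w" unfolding mass_def by (rule integral_cong_AE) (use AE in auto)
  show "trap v = trap w" unfolding trap_def by (rule integral_cong_AE) (use AE in auto)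
  have "coulomb v x = coulomb w x" for x unfolding coulomb_def by (rule integral_cong_AE) (use AE in auto)
  then have "coulomb v = coulomb w" ..
  moreover have [measurable]: "coulomb w \<in> borel_measurable borel" by (rule coulomb_measurable) simp
  ultimately show "hartree v = hartree w" unfolding hartree_def by (intro integral_cong_AE) (use AE in auto)
  show "Lnorm_pow q v = Lnorm_pow q w" unfolding Lnorm_pow_def by (rule integral_cong_AE) (use AE in auto)
qed

section \<open>The variational argument\<close>

lemma mass_pos_of_K_neg:
  assumes "K b \<omega> l2 l3 p v < 0" "v \<in> X" "l2 \<ge> 0" "\<omega> > 0" shows "mass v > 0"
proof (rule ccontr)
  assume "\<not> mass v > 0"
  then have "mass v = 0" using functionals_nonneg(2)[of v] by simp
  then have "AE x in lborel. (cmod (v x))\<^sup>2 = 0"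
    using integral_nonneg_eq_0_iff_AE[OF X_integrable(1)[OF assms(2)]] by (simp add: mass_def)
  then have "AE x in lborel. cmod (v x) powr (p + 2) = 0" by eventually_elim simp
  then have "Lnorm_pow (p + 2) v = 0" unfolding Lnorm_pow_def by (rule integral_eq_zero_AE)
  then have "K b \<omega> l2 l3 p v \<ge> 0"
    using functionals_nonneg assms by (simp add: K_def add_nonneg_nonneg)
  then show False using assms by simp
qed

text \<open>Each planar point (z, y) represents the element \<open>W z y\<close> of
  \<open>X\<close>, with the origin representing v. A planar zero of \<open>fQ\<close> with
  \<open>fK < 0\<close> is therefore a member of \<open>N\<close>, and the planar theorem
  applies.\<close>

theorem S_ge_of_K_zero:
  assumes v: "v \<in> X" and m: "mass v > 0" and K0: "K b \<omega> l2 l3 p v = 0"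
    and l2: "l2 \<ge> 0" and l3: "l3 > 0" and p: "4/3 \<le> p" "p < 4" and \<omega>: "\<omega> > 0"
    and c: "\<And>w. w \<in> N b \<omega> l2 l3 p \<Longrightarrow> c \<le> S b \<omega> l2 l3 p w"
  shows "c \<le> S b \<omega> l2 l3 p v"
proof -
  define n where "n = l3 * Lnorm_pow (p + 2) v / (p + 2)"
  have nonneg: "b\<^sup>2 * trap v \<ge> 0" "l2 * hartree v \<ge> 0" using functionals_nonneg l2 by auto
  have gp: "grad_sq v > 0" by (rule grad_sq_pos[OF v m])
  have \<omega>m: "\<omega> * mass v > 0" using \<omega> m by simp
  have "(3 * p + 3) * n = 5/2 * grad_sq v + 3/2 * (\<omega> * mass v) + 1/2 * (b\<^sup>2 * trap v) + 7/4 * (l2 * hartree v)"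
    using K0 by (simp add: K_def n_def algebra_simps)
  \<comment> \<open>On \<open>K = 0\<close> the nonlinear term must balance a positive gradient
    term, so it cannot vanish.\<close>
  then have "(3 * p + 3) * n > 0" using gp \<omega>m nonneg by simp
  then have n: "n > 0" using p by (simp add: zero_less_mult_iff)
  interpret scaling_profile "grad_sq v" "\<omega> * mass v" "b\<^sup>2 * trap v" "l2 * hartree v" n p
    by unfold_locales (use gp \<omega>m nonneg n p in auto)
  define W where "W z y = rescale (exp (z/2 + 3*y)) (exp y) v" for z y
  have k2: "(exp (z/2 + 3*y))\<^sup>2 = exp (z + 6*y)" "(exp (z/2 + 3*y)) ^ 4 = exp (2*z + 12*y)" for z y :: real
    by (simp_all flip: exp_of_nat_mult add: algebra_simps)
  have ce: "(exp y) ^ 3 = exp (3*y)" "(exp y) ^ 5 = exp (5*y)" for y :: real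
    by (simp_all flip: exp_of_nat_mult)
  have ex: "(exp (z/2 + 3*y))\<^sup>2 / exp y = exp (z + 5*y)" "(exp (z/2 + 3*y))\<^sup>2 / (exp y) ^ 3 = exp (z + 3*y)"
    "(exp (z/2 + 3*y))\<^sup>2 / (exp y) ^ 5 = exp (z + y)" "(exp (z/2 + 3*y)) ^ 4 / (exp y) ^ 5 = exp (2*z + 7*y)"
    "(exp (z/2 + 3*y)) powr (p + 2) / (exp y) ^ 3 = exp ((p/2 + 1) * z + (3*p + 3) * y)" for z y :: real
    unfolding k2 ce exp_diff[symmetric] powr_def by (simp_all add: algebra_simps flip: exp_diff)
  have WX: "W z y \<in> X" for z y unfolding W_def by (rule rescale_in_X[OF v]) auto
  have tW: "grad_sq (W z y) = exp (z + 5*y) * grad_sq v" "mass (W z y) = exp (z + 3*y) * mass v"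
    "trap (W z y) = exp (z + y) * trap v" "hartree (W z y) = exp (2*z + 7*y) * hartree v"
    "Lnorm_pow (p + 2) (W z y) = exp ((p/2 + 1) * z + (3*p + 3) * y) * Lnorm_pow (p + 2) v" for z y
    by (simp_all only: W_def grad_sq_rescale[OF v exp_gt_zero exp_gt_zero]
        mass_rescale[OF v exp_gt_zero exp_gt_zero] trap_rescale[OF v exp_gt_zero exp_gt_zero]
        hartree_rescale[OF v exp_gt_zero exp_gt_zero] Lnorm_pow_rescale[OF v exp_gt_zero exp_gt_zero] ex)
  have P: "l3 / (p + 2) * Lnorm_pow (p + 2) (W z y) = tP z y" for z y
  proof -
    have "l3 / (p + 2) * Lnorm_pow (p + 2) (W z y) = n * exp ((p/2 + 1) * z + (3*p + 3) * y)"
      by (simp add: tW n_def)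
    then show ?thesis by (simp only: tP_def)
  qed
  have fS: "fS z y = S b \<omega> l2 l3 p (W z y)" for z y
    unfolding fS_def S_def P unfolding tW tA_def tM_def tT_def tH_def by (simp add: mult_ac)
  have fK: "fK z y = K b \<omega> l2 l3 p (W z y)" for z y
  proof -
    have "l3 * (3 * p + 3) / (p + 2) * Lnorm_pow (p + 2) (W z y) = (3 * p + 3) * tP z y"
      unfolding P[symmetric] by simp
    then show ?thesis
      unfolding fK_def K_def unfolding tW(1-4) tA_def tM_def tT_def tH_def by (simp add: mult_ac)
  qed
  have fQ: "fQ z y = Q b l2 l3 p (W z y)" for z y
  proof -
    have "3 * l3 * p / (2 * (p + 2)) * Lnorm_pow (p + 2) (W z y) = 3 * p / 2 * tP z y"
      unfolding P[symmetric] by simp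
    then show ?thesis
      unfolding fQ_def Q_def unfolding tW(1-4) tA_def tT_def tH_def by (simp add: mult_ac)
  qed
  have W0: "W 0 0 = v" by (simp add: W_def rescale_def)
  have "c \<le> fS 0 0"
  proof (rule fS_ge_of_fK_zero)
    show "fK 0 0 = 0" using K0 by (simp add: fK W0)
    show "c \<le> fS z y" if "fK z y < 0" "fQ z y = 0" for z y
      using c[of "W z y"] that WX[of z y] by (simp add: N_def fS fK fQ)
  qed
  then show ?thesis by (simp add: fS W0)
qed

text \<open>Decreasing the amplitude lowers \<open>S - Q/2\<close>, whose coefficients are nonnegative, and must leave
  the region \<open>K < 0, Q < 0\<close>; at the exit point \<open>S - Q/2 \<ge> S \<ge> c\<close>.\<close>

theorem Q_le_of_K_neg:
  assumes v: "v \<in> X" and K: "K b \<omega> l2 l3 p v < 0" and Q: "Q b l2 l3 p v < 0"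
    and l2: "l2 \<ge> 0" and l3: "l3 > 0" and p: "4/3 \<le> p" "p < 4" and \<omega>: "\<omega> > 0"
    and c: "\<And>w. w \<in> N b \<omega> l2 l3 p \<Longrightarrow> c \<le> S b \<omega> l2 l3 p w"
  shows "Q b l2 l3 p v \<le> 2 * (S b \<omega> l2 l3 p v - c)"
proof -
  have m: "mass v > 0" by (rule mass_pos_of_K_neg[OF K v l2 \<omega>])
  define W where "W k = rescale k 1 v" for k
  have WX: "W k \<in> X" if "k > 0" for k unfolding W_def using that by (intro rescale_in_X[OF v]) auto
  have tW: "grad_sq (W k) = k\<^sup>2 * grad_sq v" "mass (W k) = k\<^sup>2 * mass v"
    "trap (W k) = k\<^sup>2 * trap v" "hartree (W k) = k ^ 4 * hartree v"
    "Lnorm_pow (p + 2) (W k) = k powr (p + 2) * Lnorm_pow (p + 2) v" if "k > 0" for k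
    unfolding W_def using that
    by (simp_all add: grad_sq_rescale[OF v] mass_rescale[OF v] trap_rescale[OF v] hartree_rescale[OF v]
        Lnorm_pow_rescale[OF v])
  define a0 where "a0 = 5/2 * grad_sq v + 3 * \<omega>/2 * mass v + b\<^sup>2/2 * trap v"
  have a0: "a0 > 0" unfolding a0_def using functionals_nonneg \<omega> m by (intro add_nonneg_pos add_pos_nonneg) auto
  define d0 where "d0 = l3 * (3 * p + 3) / (p + 2) * Lnorm_pow (p + 2) v"
  define fK where "fK k = k\<^sup>2 * a0 + k ^ 4 * (7 * l2/4 * hartree v) - k powr (p + 2) * d0" for k
  define q0 where "q0 = 3 * l3 * p / (2 * (p + 2)) * Lnorm_pow (p + 2) v"
  define fQ where "fQ k = k\<^sup>2 * (grad_sq v - b\<^sup>2 * trap v) + k ^ 4 * (l2/4 * hartree v) - k powr (p + 2) * q0" for k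
  have fK: "K b \<omega> l2 l3 p (W k) = fK k" if "k > 0" for k
    unfolding K_def tW[OF that] fK_def a0_def d0_def by (simp add: algebra_simps)
  have fQ: "Q b l2 l3 p (W k) = fQ k" if "k > 0" for k
    unfolding Q_def tW[OF that] fQ_def q0_def by (simp add: algebra_simps)
  have W1: "W 1 = v" by (simp add: W_def rescale_def)
  have p2: "p + 2 = 2 + p" by simp
  have d0: "d0 \<ge> 0" using functionals_nonneg l3 p by (simp add: d0_def)
  have nonneg: "l2 * hartree v \<ge> 0" "b\<^sup>2 * trap v \<ge> 0" using functionals_nonneg l2 by auto
  obtain k0 where k0: "0 < k0" "k0 < 1" "fK k0 > 0"
  proof -
    \<comment> \<open>After division by k^2 the nonlinear part is of order k^p and disappears at
      small amplitude, leaving a0 > 0. Thus \<open>K\<close> is positive there.\<close>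
    have "((\<lambda>k. a0 - k powr p * d0) \<longlongrightarrow> a0 - 0 powr p * d0) (at_right 0)"
      using p eventually_mono[OF eventually_at_right_less[of "0::real"], of "(\<le>) 0"]
      by (intro tendsto_intros) auto
    then have "eventually (\<lambda>k. a0 - k powr p * d0 > 0) (at_right (0::real))"
      using a0 p by (intro order_tendstoD(1)) auto
    moreover have "eventually (\<lambda>k. k < 1) (at_right (0::real))"
      by (rule eventually_at_right_real[THEN eventually_mono]) auto
    ultimately have "eventually (\<lambda>k. 0 < k \<and> k < 1 \<and> a0 - k powr p * d0 > 0) (at_right (0::real))"
      using eventually_at_right_less[of 0] by eventually_elim auto
    then obtain k where k: "0 < k" "k < 1" "a0 - k powr p * d0 > 0"
      using eventually_happens[of _ "at_right (0::real)"] by auto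
    have "fK k = k\<^sup>2 * (a0 - k powr p * d0) + k ^ 4 * (7 * l2/4 * hartree v)"
      unfolding fK_def p2 powr_add using k(1) by (simp add: algebra_simps)
    moreover have "k\<^sup>2 * (a0 - k powr p * d0) > 0" using k by simp
    moreover have "k ^ 4 * (7 * l2/4 * hartree v) \<ge> 0" using nonneg by simp
    ultimately have "fK k > 0" by (simp only: add_pos_nonneg)
    with k show ?thesis by (intro that)
  qed
  \<comment> \<open>A zero of the maximum is an exit point: either \<open>K = 0\<close>, or
    \<open>Q = 0\<close> with \<open>K < 0\<close>; in both cases \<open>Q <= 0\<close>.\<close>
  have cont: "continuous_on {k0..1} (\<lambda>k. max (fK k) (fQ k))"
    unfolding fK_def fQ_def using k0(1) by (intro continuous_intros) auto
  have "max (fK 1) (fQ 1) < 0" using K Q fK[of 1] fQ[of 1] W1 by simp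
  moreover have "max (fK k0) (fQ k0) > 0" using k0 by simp
  ultimately obtain k where k: "k0 \<le> k" "k \<le> 1" "max (fK k) (fQ k) = 0"
    using IVT2'[of "\<lambda>k. max (fK k) (fQ k)" 1 0 k0] cont k0 by auto
  have k_pos: "k > 0" using k k0 by simp
  have Sk: "c \<le> S b \<omega> l2 l3 p (W k)"
  proof (cases "fK k = 0")
    case True
    show ?thesis
    proof (rule S_ge_of_K_zero[OF WX[OF k_pos] _ _ l2 l3 p \<omega> c])
      show "mass (W k) > 0" using m k_pos by (simp add: tW)
      show "K b \<omega> l2 l3 p (W k) = 0" using True fK k_pos by simp
    qed
  next
    case False
    then have "fK k < 0" "fQ k = 0" using k(3) by (auto simp: max_def split: if_splits)
    then show ?thesis using WX[OF k_pos] fK fQ k_pos by (intro c) (simp add: N_def)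
  qed
  \<comment> \<open>Half of \<open>Q\<close> is exactly what cancels the gradient, and p >= 4/3
    makes the last coefficient nonnegative.\<close>
  have R: "S b \<omega> l2 l3 p w - Q b l2 l3 p w / 2 = \<omega>/2 * mass w + b\<^sup>2 * trap w + l2/8 * hartree w
      + (3 * p / 4 - 1) * (l3 / (p + 2) * Lnorm_pow (p + 2) w)" for w
  proof -
    define P where "P = l3 / (p + 2) * Lnorm_pow (p + 2) w"
    have q: "3 * l3 * p / (2 * (p + 2)) * Lnorm_pow (p + 2) w = 3 * p / 2 * P" by (simp add: P_def)
    show ?thesis unfolding S_def Q_def q P_def[symmetric] by (simp add: field_simps)
  qed
  have "Q b l2 l3 p (W k) \<le> 0" using k(3) fQ[OF k_pos] by simp
  then have "c \<le> S b \<omega> l2 l3 p (W k) - Q b l2 l3 p (W k) / 2" using Sk by simp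
  also have "\<dots> \<le> S b \<omega> l2 l3 p v - Q b l2 l3 p v / 2"
  proof -
    have k24: "k\<^sup>2 \<le> 1" "k ^ 4 \<le> 1" "k powr (p + 2) \<le> 1"
      using k k_pos p by (auto simp: power_le_one powr_le1)
    have le: "t * x \<le> x" if "t \<le> 1" "x \<ge> 0" for t x :: real using mult_right_mono[OF that] by simp
    show ?thesis unfolding R tW[OF k_pos]
      using functionals_nonneg l2 l3 p \<omega>
      by (intro add_mono mult_left_mono le k24) auto
  qed
  finally show ?thesis by simp
qed

section \<open>Invariance along the flow\<close>

lemma time_interval_interval:
  "0 \<in> time_interval T \<Longrightarrow> t \<in> time_interval T \<Longrightarrow> {0..t} \<subseteq> time_interval T"
  by (auto simp: time_interval_def intro: le_less_trans[of "ereal _" "ereal t" T])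

text \<open>\<open>S\<close> is conserved and stays below c. Hence \<open>K\<close> cannot vanish,
  by \<open>S_ge_of_K_zero\<close>; with \<open>K < 0\<close> established at all times, a zero of
  \<open>Q\<close> would put the trajectory into \<open>N\<close> below c. The order matters, since
  membership in \<open>N\<close> presupposes the sign of \<open>K\<close>.\<close>

theorem K_set_trajectory:
  assumes l2: "l2 \<ge> 0" and l3: "l3 > 0" and p: "4/3 \<le> p" "p < 4" and \<omega>: "\<omega> > 0"
    and cons: "conserves_mass_and_energy b l2 l3 p"
    and c: "\<And>w. w \<in> N b \<omega> l2 l3 p \<Longrightarrow> c \<le> S b \<omega> l2 l3 p w"
    and \<psi>0: "\<psi>0 \<in> X" "S b \<omega> l2 l3 p \<psi>0 < c" "K b \<omega> l2 l3 p \<psi>0 < 0" "Q b l2 l3 p \<psi>0 < 0"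
    and sol: "nls_solution b l2 l3 p \<psi>0 T \<psi>" and t: "t \<in> time_interval T"
  shows "S b \<omega> l2 l3 p (\<psi> t) = S b \<omega> l2 l3 p \<psi>0" "\<psi> t \<in> X" "K b \<omega> l2 l3 p (\<psi> t) < 0" "Q b l2 l3 p (\<psi> t) < 0"
proof -
  let ?I = "time_interval T"
  have T: "0 \<in> ?I" using sol by (simp add: nls_solution_def time_interval_def zero_ereal_def)
  have X\<psi>: "\<psi> s \<in> X" if "s \<in> ?I" for s using sol that by (simp add: nls_solution_def)
  then show "\<psi> t \<in> X" using t .
  have ME: "mass (\<psi> s) = mass \<psi>0" "energy b l2 l3 p (\<psi> s) = energy b l2 l3 p \<psi>0" if "s \<in> ?I" for s
    using cons sol \<psi>0(1) that unfolding conserves_mass_and_energy_def by blast+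
  have SE: "S b \<omega> l2 l3 p w = energy b l2 l3 p w + \<omega>/2 * mass w" for w
    by (simp add: S_def energy_def)
  have S: "S b \<omega> l2 l3 p (\<psi> s) = S b \<omega> l2 l3 p \<psi>0" if "s \<in> ?I" for s
    unfolding SE ME[OF that] ..
  then show "S b \<omega> l2 l3 p (\<psi> t) = S b \<omega> l2 l3 p \<psi>0" using t .
  have m: "mass (\<psi> s) > 0" if "s \<in> ?I" for s
    using mass_pos_of_K_neg[OF \<psi>0(3,1) l2 \<omega>] ME(1)[OF that] by simp
  have cont: "continuous_on ?I (\<lambda>s. grad_sq (\<psi> s))" "continuous_on ?I (\<lambda>s. mass (\<psi> s))"
    "continuous_on ?I (\<lambda>s. trap (\<psi> s))" "continuous_on ?I (\<lambda>s. hartree (\<psi> s))"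
  proof -
    have ev: "eventually (\<lambda>s. \<psi> s \<in> X) (at r within ?I)" for r
      using X\<psi> by (auto simp: eventually_at_filter)
    have "((\<lambda>s. Xdist (\<psi> s) (\<psi> r)) \<longlongrightarrow> 0) (at r within ?I)" if "r \<in> ?I" for r
      using sol that by (simp add: nls_solution_def)
    note * = functionals_tendsto[OF ev X\<psi> this]
    show "continuous_on ?I (\<lambda>s. grad_sq (\<psi> s))" "continuous_on ?I (\<lambda>s. mass (\<psi> s))"
      "continuous_on ?I (\<lambda>s. trap (\<psi> s))" "continuous_on ?I (\<lambda>s. hartree (\<psi> s))"
      unfolding continuous_on_def using * by blast+
  qed
  \<comment> \<open>Energy conservation expresses the \<open>L\<^bsup>p+2\<^esup>\<close> term through the others, so its continuity needs no
    Sobolev embedding.\<close>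
  define P where "P w = l3 / (p + 2) * Lnorm_pow (p + 2) w" for w
  have "P (\<psi> s) = 1/2 * grad_sq (\<psi> s) + b\<^sup>2/2 * trap (\<psi> s) + l2/4 * hartree (\<psi> s) - energy b l2 l3 p \<psi>0"
    if "s \<in> ?I" for s
    using ME(2)[OF that] by (simp add: energy_def P_def)
  moreover have "continuous_on ?I (\<lambda>s. 1/2 * grad_sq (\<psi> s) + b\<^sup>2/2 * trap (\<psi> s) + l2/4 * hartree (\<psi> s) - energy b l2 l3 p \<psi>0)"
    by (intro continuous_intros cont)
  ultimately have contP: "continuous_on ?I (\<lambda>s. P (\<psi> s))" by (simp cong: continuous_on_cong)
  have KP: "K b \<omega> l2 l3 p w = 5/2 * grad_sq w + 3 * \<omega>/2 * mass w + b\<^sup>2/2 * trap w + 7 * l2/4 * hartree w - (3*p+3) * P w" for w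
    by (simp add: K_def P_def)
  have QP: "Q b l2 l3 p w = grad_sq w - b\<^sup>2 * trap w + l2/4 * hartree w - 3 * p / 2 * P w" for w
    by (simp add: Q_def P_def)
  have contK: "continuous_on ?I (\<lambda>s. K b \<omega> l2 l3 p (\<psi> s))" unfolding KP by (intro continuous_intros cont contP)
  have contQ: "continuous_on ?I (\<lambda>s. Q b l2 l3 p (\<psi> s))" unfolding QP by (intro continuous_intros cont contP)
  have "AE x in lborel. \<psi> 0 x = \<psi>0 x" using sol by (simp add: nls_solution_def)
  note cong = functionals_cong_AE[OF X\<psi>[OF T] \<psi>0(1) this]
  have init: "K b \<omega> l2 l3 p (\<psi> 0) < 0" "Q b l2 l3 p (\<psi> 0) < 0" using \<psi>0 by (simp_all add: K_def Q_def cong)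
  \<comment> \<open>A continuous function without zeros keeps its sign, by the intermediate value
    theorem.\<close>
  have stays: "F t < 0" if F: "continuous_on ?I F" "F 0 < 0" "\<And>s. s \<in> ?I \<Longrightarrow> F s \<noteq> 0" and t: "t \<in> ?I"
    for F :: "real \<Rightarrow> real" and t
  proof (rule ccontr)
    assume "\<not> F t < 0"
    moreover have "t \<ge> 0" using t by (simp add: time_interval_def)
    moreover have "continuous_on {0..t} F" using F(1) time_interval_interval[OF T t] by (rule continuous_on_subset)
    ultimately obtain s where "0 \<le> s" "s \<le> t" "F s = 0" using IVT'[of F 0 0 t] F(2) by auto
    then show False using F(3)[of s] time_interval_interval[OF T t] by auto
  qed
  have Kneg: "K b \<omega> l2 l3 p (\<psi> s) < 0" if "s \<in> ?I" for s
  proof (rule stays[OF contK init(1) _ that])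
    fix r assume r: "r \<in> ?I"
    show "K b \<omega> l2 l3 p (\<psi> r) \<noteq> 0"
      using S_ge_of_K_zero[OF X\<psi>[OF r] m[OF r] _ l2 l3 p \<omega> c] S[OF r] \<psi>0(2) by auto
  qed
  then show "K b \<omega> l2 l3 p (\<psi> t) < 0" using t .
  show "Q b l2 l3 p (\<psi> t) < 0"
  proof (rule stays[OF contQ init(2) _ t])
    fix r assume r: "r \<in> ?I"
    show "Q b l2 l3 p (\<psi> r) \<noteq> 0"
      using c[of "\<psi> r"] X\<psi>[OF r] Kneg[OF r] S[OF r] \<psi>0(2) by (auto simp: N_def)
  qed
qed

theorem lemma1p10:
  fixes b l2 l3 p \<omega> :: real and u :: "R3 \<Rightarrow> complex"
  assumes "b \<noteq> 0" and "l2 \<ge> 0" and "l3 > 0" and "4/3 \<le> p" and "p < 4"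
    and "locally_well_posed b l2 l3 p"
    and "conserves_mass_and_energy b l2 l3 p"
    and "\<omega> > 0"
    and "ground_state b \<omega> l2 l3 p u"
    and "alpha b \<omega> l2 l3 p \<ge> ereal (S b \<omega> l2 l3 p u)"
    and "p < 2 \<Longrightarrow> (deriv ^^ 2) (\<lambda>s. S b \<omega> l2 l3 p (dilate s u)) 1 \<le> 0"
  shows "invariant_under_flow b l2 l3 p (K_set b \<omega> l2 l3 p u) \<and>
    (\<forall>\<psi>0 \<in> K_set b \<omega> l2 l3 p u. \<forall>T \<psi>. maximal_nls_solution b l2 l3 p \<psi>0 T \<psi> \<longrightarrow>
       (\<forall>t \<in> time_interval T.
          Q b l2 l3 p (\<psi> t) \<le> 2 * (S b \<omega> l2 l3 p \<psi>0 - S b \<omega> l2 l3 p u)))"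
proof -
  have c: "S b \<omega> l2 l3 p u \<le> S b \<omega> l2 l3 p w" if "w \<in> N b \<omega> l2 l3 p" for w
  proof -
    have "ereal (S b \<omega> l2 l3 p u) \<le> ereal (S b \<omega> l2 l3 p w)"
      using assms(10) INF_lower[OF that, of "\<lambda>v. ereal (S b \<omega> l2 l3 p v)"] unfolding alpha_def by (rule order_trans)
    then show ?thesis by simp
  qed
  have main: "\<psi> t \<in> K_set b \<omega> l2 l3 p u \<and>
      Q b l2 l3 p (\<psi> t) \<le> 2 * (S b \<omega> l2 l3 p \<psi>0 - S b \<omega> l2 l3 p u)"
    if \<psi>0: "\<psi>0 \<in> K_set b \<omega> l2 l3 p u" and sol: "maximal_nls_solution b l2 l3 p \<psi>0 T \<psi>" and t: "t \<in> time_interval T"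
    for \<psi>0 T \<psi> t
  proof -
    have "nls_solution b l2 l3 p \<psi>0 T \<psi>" using sol by (simp add: maximal_nls_solution_def)
    note tr = K_set_trajectory[OF assms(2-5,8,7) c _ _ _ _ this t]
    have tr: "S b \<omega> l2 l3 p (\<psi> t) = S b \<omega> l2 l3 p \<psi>0" "\<psi> t \<in> X" "K b \<omega> l2 l3 p (\<psi> t) < 0" "Q b l2 l3 p (\<psi> t) < 0"
      using tr \<psi>0 by (auto simp: K_set_def)
    \<comment> \<open>The estimate is applied to \<psi> t; conservation of \<open>S\<close> replaces
      its action by that of the initial datum.\<close>
    then show ?thesis
      using Q_le_of_K_neg[OF tr(2-4) assms(2-5,8) c] \<psi>0 by (simp add: K_set_def)
  qed
  then show ?thesis unfolding invariant_under_flow_def by blast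
qed

end
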